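(* Let $1\le p<\infty$, $0<r<\infty$, $0<q\le\infty$, $\frac1s:=\left(\frac1r-\frac1p\right)_+$. Let $u,v,w\in\mathfrak M^+$ with $\int_0^t u<\infty$ for all $t>0$, and let $k$ be an Oinarov kernel with constant $D$. Let $C_T\in[0,\infty]$ be the least constant such that $\|Tf\|_{L^r_u}\le C_T\|f\|_{L^p_v}$ for all $f\in\mathfrak M^+$, where $$(Tf)(x)=\left(\int_x^\infty w(y)\left(\int_0^y k(y,z)f(z)\,dz\right)^q dy\right)^{1/q}\ (q<\infty),\qquad (Tf)(x)=\operatorname*{ess\,sup}_{y\ge x} w(y)\int_0^y k(y,z)f(z)\,dz\ (q=\infty).$$ If $q<\infty$, let $A_0,A_1\in[0,\infty]$ be the least constants such that for all $f\in\mathfrak M^+$ $$\left(\int_0^\infty u(x)\left(\int_x^\infty w\right)^{\frac rq}\left(\int_0^x k(x,z)f(z)\,dz\right)^r dx\right)^{\frac1r}\le A_0\|f\|_{L^p_v},$$ $$\left(\int_0^\infty u(x)\left(\int_x^\infty [k(z,x)]^q w(z)\,dz\right)^{\frac rq}\left(\int_0^x f\right)^r dx\right)^{\frac1r}\le A_1\|f\|_{L^p_v};$$ if $q=\infty$, let $A_0,A_1\in[0,\infty]$ be the least constants such that for all $f\in\mathfrak M^+$ $$\left(\int_0^\infty u(x)\left[\operatorname*{ess\,sup}_{y\ge x}w(y)\right]^r\left(\int_0^x k(x,z)f(z)\,dz\right)^r dx\right)^{\frac1r}\le A_0\|f\|_{L^p_v},$$ $$\left(\int_0^\infty u(x)\left[\operatorname*{ess\,sup}_{y\ge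 x}w(y)k(y,x)\right]^r\left(\int_0^x f\right)^r dx\right)^{\frac1r}\le A_1\|f\|_{L^p_v}.$$ Let $$A_2:=\begin{cases}\displaystyle\sup_{t\in(0,\infty)}\left(\int_0^t u\right)^{\frac1r}\|H_t\|_{L^p_v\to L^q_w},& p\le r,\\[2mm] \displaystyle\left(\int_0^\infty u(x)\left(\int_0^x u\right)^{\frac sp}\|H_{\sigma^{-1}(x),\sigma(x)}\|^s_{L^p_v\to L^q_w}\,dx\right)^{\frac1s},& r<p.\end{cases}$$ Then $C_T<\infty$ if and only if $A_0$, $A_1$ and $A_2$ are all finite. Moreover, $C_T\approx A_0+A_1+A_2$, i.e. each side is bounded by the other times a positive constant depending only on $p,q,r,D$.
   Context: $\mathfrak M$ is the set of measurable functions on $[0,\infty)$, $\mathfrak M^+\subset\mathfrak M$ the non-negative ones. For $0<p<\infty$, $v\in\mathfrak M^+$: $\|f\|_{L^p_v}:=\left(\int_0^\infty|f|^pv\right)^{1/p}$; for $p=\infty$: $\|f\|_{L^\infty_v}:=\operatorname{ess\,sup}_{x\ge0}v(x)|f(x)|$. For a positive operator $H$ on $\mathfrak M^+$, $\|H\|_{L^p_v\to L^q_w}\in[0,\infty]$ is the least $C$ with $\|Hf\|_{L^q_w}\le C\|f\|_{L^p_v}$ for all $f\in\mathfrak M^+$. Expressions $0\cdot\infty$, $\frac\infty\infty$, $\frac00$ are taken to be $0$. $(a)_+=\max(a,0)$ ($s$ is used only when $r<p$). Oinarov kernel with constant $D\ge1$: a Borel function $k(x,y)\ge0$ on $[0,\infty)^2$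 with $k(x,y)=0$ if $x<y$ and $\frac1D(k(x,z)+k(z,y))\le k(x,y)\le D(k(x,z)+k(z,y))$ for all $x\ge z\ge y\ge0$. The functions $\sigma:[0,\infty)\to[0,\infty]$ and $\sigma^{-1}:[0,\infty)\to[0,\infty)$ are defined (with $\inf\varnothing=\infty$) by $$\sigma(x):=\inf\left\{y>0:\int_0^y u\ge2\int_0^x u\right\},\qquad \sigma^{-1}(x):=\inf\left\{y>0:\int_0^y u\ge\tfrac12\int_0^x u\right\}.$$ For $0<c<d\le\infty$ and $f\in\mathfrak M^+$: $$(H_{c,d}f)(x):=\chi_{[c,d)}(x)\int_{\sigma^{-1}(c)}^x k(x,z)f(z)\,dz,\qquad (H_cf)(x):=\chi_{[c,\infty)}(x)\int_0^x k(x,z)f(z)\,dz.$$ (In $A_2$ with $r<p$, the integrand is $0$ at points $x$ with $\int_0^xu=0$.) *)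

theory Defs
  imports "HOL-Analysis.Analysis" "HOL-Probability.Essential_Supremum"
begin

text \<open>
  Non-negative functions are \<^typ>\<open>ennreal\<close>-valued, so the value infinity is allowed, and
  \<open>0 * \<infinity> = 0\<close> holds in \<^typ>\<open>ennreal\<close>. Functions on the half-line are functions on
  \<^typ>\<open>real\<close> of which only the values on \<open>{0..}\<close> matter.
\<close>

definition Mplus :: "(real \<Rightarrow> ennreal) set" where
  "Mplus = borel_measurable (lebesgue_on {0..})"

text \<open>Real powers of extended non-negative numbers; meant for exponents \<open>a > 0\<close> only.\<close>

definition enn_powr :: "ennreal \<Rightarrow> real \<Rightarrow> ennreal" (infixr "powe" 80) where
  "x powe a = (if x = \<infinity> then \<infinity> else ennreal (enn2real x powr a))"

text \<open>The weighted norm, for an exponent \<open>0 < p \<le> \<infinity>\<close>.\<close>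

definition Lnorm :: "ennreal \<Rightarrow> (real \<Rightarrow> ennreal) \<Rightarrow> (real \<Rightarrow> ennreal) \<Rightarrow> ennreal" where
  "Lnorm p v f =
     (if p = \<infinity> then esssup (lebesgue_on {0..}) (\<lambda>x. v x * f x)
      else (\<integral>\<^sup>+x\<in>{0..}. f x powe enn2real p * v x \<partial>lebesgue) powe (1 / enn2real p))"

text \<open>
  The least \<open>C \<in> [0,\<infinity>]\<close> with \<open>\<Phi> f \<le> C \<parallel>f\<parallel>\<close> for all \<open>f\<close>. The infimum is \<open>\<infinity>\<close> if no finite
  \<open>C\<close> is admissible (this includes the case that \<open>\<Phi> f > 0\<close> for some \<open>f\<close> of norm 0).
\<close>

definition best_const ::
  "ennreal \<Rightarrow> (real \<Rightarrow> ennreal) \<Rightarrow> ((real \<Rightarrow> ennreal) \<Rightarrow> ennreal) \<Rightarrow> ennreal" where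
  "best_const p v \<Phi> = Inf {C. \<forall>f\<in>Mplus. \<Phi> f \<le> C * Lnorm p v f}"

definition op_norm ::
  "ennreal \<Rightarrow> (real \<Rightarrow> ennreal) \<Rightarrow> ennreal \<Rightarrow> (real \<Rightarrow> ennreal)
    \<Rightarrow> ((real \<Rightarrow> ennreal) \<Rightarrow> real \<Rightarrow> ennreal) \<Rightarrow> ennreal" where
  "op_norm p v q w H = best_const p v (\<lambda>f. Lnorm q w (H f))"

definition oinarov_kernel :: "real \<Rightarrow> (real \<Rightarrow> real \<Rightarrow> ennreal) \<Rightarrow> bool" where
  "oinarov_kernel D k \<longleftrightarrow>
     1 \<le> D \<and>
     (\<lambda>(x, y). k x y) \<in> borel_measurable (restrict_space borel ({0..} \<times> {0..})) \<and>
     (\<forall>x y. 0 \<le> x \<and> x < y \<longrightarrow> k x y = 0) \<and>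
     (\<forall>x y z. 0 \<le> y \<and> y \<le> z \<and> z \<le> x \<longrightarrow>
        ennreal (1 / D) * (k x z + k z y) \<le> k x y \<and>
        k x y \<le> ennreal D * (k x z + k z y))"

definition kernel_op ::
  "(real \<Rightarrow> real \<Rightarrow> ennreal) \<Rightarrow> (real \<Rightarrow> ennreal) \<Rightarrow> real \<Rightarrow> ennreal" where
  "kernel_op k f x = (\<integral>\<^sup>+z\<in>{0..x}. k x z * f z \<partial>lebesgue)"

definition T_op ::
  "ennreal \<Rightarrow> (real \<Rightarrow> ennreal) \<Rightarrow> (real \<Rightarrow> real \<Rightarrow> ennreal)
    \<Rightarrow> (real \<Rightarrow> ennreal) \<Rightarrow> real \<Rightarrow> ennreal" where
  "T_op q w k f x =
     (if q = \<infinity> then esssup (lebesgue_on {x..}) (\<lambda>y. w y * kernel_op k f y)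
      else (\<integral>\<^sup>+y\<in>{x..}. w y * kernel_op k f y powe enn2real q \<partial>lebesgue)
             powe (1 / enn2real q))"

definition C_T ::
  "real \<Rightarrow> ennreal \<Rightarrow> real \<Rightarrow> (real \<Rightarrow> ennreal) \<Rightarrow> (real \<Rightarrow> ennreal) \<Rightarrow> (real \<Rightarrow> ennreal)
    \<Rightarrow> (real \<Rightarrow> real \<Rightarrow> ennreal) \<Rightarrow> ennreal" where
  "C_T p q r u v w k = op_norm (ennreal p) v (ennreal r) u (T_op q w k)"

definition A0 ::
  "real \<Rightarrow> ennreal \<Rightarrow> real \<Rightarrow> (real \<Rightarrow> ennreal) \<Rightarrow> (real \<Rightarrow> ennreal) \<Rightarrow> (real \<Rightarrow> ennreal)
    \<Rightarrow> (real \<Rightarrow> real \<Rightarrow> ennreal) \<Rightarrow> ennreal" where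
  "A0 p q r u v w k = best_const (ennreal p) v (\<lambda>f.
     (\<integral>\<^sup>+x\<in>{0..}. u x *
        (if q = \<infinity> then esssup (lebesgue_on {x..}) w powe r
         else (\<integral>\<^sup>+y\<in>{x..}. w y \<partial>lebesgue) powe (r / enn2real q)) *
        (\<integral>\<^sup>+z\<in>{0..x}. k x z * f z \<partial>lebesgue) powe r \<partial>lebesgue) powe (1 / r))"

definition A1 ::
  "real \<Rightarrow> ennreal \<Rightarrow> real \<Rightarrow> (real \<Rightarrow> ennreal) \<Rightarrow> (real \<Rightarrow> ennreal) \<Rightarrow> (real \<Rightarrow> ennreal)
    \<Rightarrow> (real \<Rightarrow> real \<Rightarrow> ennreal) \<Rightarrow> ennreal" where
  "A1 p q r u v w k = best_const (ennreal p) v (\<lambda>f.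
     (\<integral>\<^sup>+x\<in>{0..}. u x *
        (if q = \<infinity> then esssup (lebesgue_on {x..}) (\<lambda>y. w y * k y x) powe r
         else (\<integral>\<^sup>+z\<in>{x..}. k z x powe enn2real q * w z \<partial>lebesgue) powe (r / enn2real q)) *
        (\<integral>\<^sup>+z\<in>{0..x}. f z \<partial>lebesgue) powe r \<partial>lebesgue) powe (1 / r))"

definition primitive :: "(real \<Rightarrow> ennreal) \<Rightarrow> real \<Rightarrow> ennreal" where
  "primitive u x = (\<integral>\<^sup>+t\<in>{0..x}. u t \<partial>lebesgue)"

definition sigma :: "(real \<Rightarrow> ennreal) \<Rightarrow> real \<Rightarrow> ennreal" where
  "sigma u x = Inf {ennreal y | y. 0 < y \<and> 2 * primitive u x \<le> primitive u y}"

text \<open>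
  For \<open>x \<ge> 0\<close> the set below is non-empty (it contains \<open>x\<close>, or every \<open>y > 0\<close> if \<open>x = 0\<close>) and
  bounded below, so the infimum in \<^typ>\<open>real\<close> is the intended one.
\<close>

definition sigma_inv :: "(real \<Rightarrow> ennreal) \<Rightarrow> real \<Rightarrow> real" where
  "sigma_inv u x = Inf {y. 0 < y \<and> ennreal (1 / 2) * primitive u x \<le> primitive u y}"

definition H_block ::
  "(real \<Rightarrow> ennreal) \<Rightarrow> (real \<Rightarrow> real \<Rightarrow> ennreal) \<Rightarrow> real \<Rightarrow> ennreal
    \<Rightarrow> (real \<Rightarrow> ennreal) \<Rightarrow> real \<Rightarrow> ennreal" where
  "H_block u k c d f x =
     indicator {y. c \<le> y \<and> ennreal y < d} x *
     (\<integral>\<^sup>+z\<in>{sigma_inv u c..x}. k x z * f z \<partial>lebesgue)"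

definition H_tail ::
  "(real \<Rightarrow> real \<Rightarrow> ennreal) \<Rightarrow> real \<Rightarrow> (real \<Rightarrow> ennreal) \<Rightarrow> real \<Rightarrow> ennreal" where
  "H_tail k c f x = indicator {c..} x * (\<integral>\<^sup>+z\<in>{0..x}. k x z * f z \<partial>lebesgue)"

text \<open>For \<open>r \<ge> p\<close> the value of \<open>s\<close> should be \<open>\<infinity>\<close>; here it is 0, but it is used only for \<open>r < p\<close>.\<close>

definition s_exp :: "real \<Rightarrow> real \<Rightarrow> real" where
  "s_exp p r = 1 / max (1 / r - 1 / p) 0"

text \<open>
  \<open>H_block u k c d\<close> is meant for \<open>c > 0\<close>. In the case \<open>r < p\<close> below, \<open>c = sigma_inv u x\<close> is 0
  exactly where \<open>primitive u x = 0\<close>; there the factor \<open>primitive u x powe (s / p)\<close> makes the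
  integrand 0.
\<close>

definition A2 ::
  "real \<Rightarrow> ennreal \<Rightarrow> real \<Rightarrow> (real \<Rightarrow> ennreal) \<Rightarrow> (real \<Rightarrow> ennreal) \<Rightarrow> (real \<Rightarrow> ennreal)
    \<Rightarrow> (real \<Rightarrow> real \<Rightarrow> ennreal) \<Rightarrow> ennreal" where
  "A2 p q r u v w k =
     (if p \<le> r then
        SUP t\<in>{0<..}. primitive u t powe (1 / r) * op_norm (ennreal p) v q w (H_tail k t)
      else let s = s_exp p r in
        (\<integral>\<^sup>+x\<in>{0..}. u x * primitive u x powe (s / p) *
           op_norm (ennreal p) v q w (H_block u k (sigma_inv u x) (sigma u x)) powe s
           \<partial>lebesgue) powe (1 / s))"

end

theory Submission
  imports Defs
begin

text \<open>
  Let \<open>U\<close> be the primitive of \<open>u\<close>, and cut the half-line into the levels \<open>E n\<close> on which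
  \<open>lam n \<le> U < lam (n + 1)\<close>, where \<open>lam n = sqrt 2 ^ n\<close>. As \<open>T f\<close> is non-increasing and the weights
  \<open>lam n\<close> are geometric, \<open>T f\<close> may be replaced on \<open>E (m - 1)\<close> by the contribution of \<open>E m\<close> alone. For
  \<open>x\<close> in \<open>E (m - 1)\<close> and \<open>y\<close> in \<open>E m\<close>, the kernel inequality \<open>k y z \<le> D * (k y x + k x z)\<close> bounds
  the integral of \<open>k y z * f z\<close> over \<open>z \<le> y\<close> by the integrands of \<open>A0\<close> and \<open>A1\<close> at \<open>x\<close>
  and a local term that sees only the part of \<open>f\<close> in \<open>E (m - 1) \<union> E m\<close>. The local terms are
  summed with \<open>A2\<close>, by Hoelder's inequality if \<open>r < p\<close>.

  Conversely, \<open>A0\<close>, \<open>A1\<close> and, for \<open>p \<le> r\<close>, \<open>A2\<close> are bounded by pointwise lower bounds for \<open>T f\<close>;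
  for \<open>r < p\<close> one tests \<open>T\<close> on a combination of near-extremal functions for the tails
  \<open>H_tail k t\<close> with \<open>U t = lam m\<close>.
\<close>

subsection \<open>Powers, best constants and weighted norms\<close>

text \<open>Three obstacles shape the argument. \<open>N g powe r\<close> is in general only
  quasi-subadditive, so a sum over infinitely many levels would accumulate unbounded constants; this
  is harmless once the accumulation is slower than the growth of the levels. Next, the highest level
  may carry arbitrarily little mass of \<open>u\<close>, but the level below it cannot: if the
  primitive reaches level m, then \<open>E (m - 1)\<close> has mass comparable with
  \<open>lam m\<close>. This is why x runs through \<open>E (m - 1)\<close>: averaging over it
  against \<open>u\<close> turns a sum over m back into an integral over x. Finally, measurability
  in x of \<open>T f\<close> and of the integrand of \<open>A1\<close> is never established, so
  integrals over x are handled as lower integrals. Throughout, the constants are compared through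
  positive real upper bounds S, which keeps products of 0 and infinity out of the estimates.\<close>

lemma powe_ennreal: "0 \<le> x \<Longrightarrow> ennreal x powe a = ennreal (x powr a)"
  by (simp add: enn_powr_def)

lemma powe_top [simp]: "\<infinity> powe a = \<infinity>" "top powe a = top"
  by (simp_all add: enn_powr_def)

lemma zero_powe [simp]: "0 powe a = 0"
  by (simp add: enn_powr_def)

lemma one_powe [simp]: "1 powe a = 1"
  by (simp add: enn_powr_def)

lemma powe_indicator [simp]: "indicator A x powe a = indicator A x"
  by (auto simp: indicator_def)

lemma powe_one [simp]: "x powe 1 = x"
  by (cases x) (auto simp: powe_ennreal)

lemma powe_mono: "x \<le> y \<Longrightarrow> 0 \<le> a \<Longrightarrow> x powe a \<le> y powe a"
  by (cases x; cases y) (auto simp: powe_ennreal top_unique intro!: ennreal_leI powr_mono2)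

lemma powe_powe: "(x powe a) powe b = x powe (a * b)"
  by (cases x) (auto simp: powe_ennreal powr_powr)

lemma powe_le_iff:
  assumes "0 < a"
  shows "x powe a \<le> y powe a \<longleftrightarrow> x \<le> y"
proof
  assume "x powe a \<le> y powe a"
  then have "(x powe a) powe (1/a) \<le> (y powe a) powe (1/a)"
    using assms by (rule_tac powe_mono) auto
  moreover have "(z powe a) powe (1/a) = z" for z
    using assms by (simp add: powe_powe)
  ultimately show "x \<le> y" by simp
qed (use assms in \<open>auto intro: powe_mono\<close>)

lemma powe_inverse_le_iff:
  assumes "0 < a"
  shows "x powe (1 / a) \<le> y \<longleftrightarrow> x \<le> y powe a"
  using powe_le_iff[OF assms, of "x powe (1/a)" y] assms by (simp add: powe_powe)

lemma powe_mult: "0 < a \<Longrightarrow> (x * y) powe a = x powe a * y powe a"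
  by (cases x; cases y)
    (auto simp: powe_ennreal powr_mult ennreal_top_mult ennreal_mult_top
        simp flip: ennreal_mult)

lemma measurable_powe [measurable (raw)]:
  assumes [measurable]: "f \<in> borel_measurable M"
  shows "(\<lambda>x. f x powe a) \<in> borel_measurable M"
proof -
  have "Measurable.pred M (\<lambda>x. f x = \<infinity>)"
    by measurable
  then show ?thesis unfolding enn_powr_def by measurable
qed

text \<open>If y <= d x, the first term alone dominates, with d chosen so that (1 + d)^a = \<rho>;
  otherwise x < y / d and the second term dominates.\<close>

lemma powe_sum_le:
  assumes "0 < a" "1 < \<rho>"
  shows "\<exists>C>0. \<forall>x y. (x + y) powe a \<le> ennreal \<rho> * x powe a + ennreal C * y powe a"
proof -
  define d where "d = \<rho> powr (1 / a) - 1"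
  have "1 powr (1/a) < \<rho> powr (1/a)"
    using assms by (intro powr_less_mono2) auto
  then have d: "0 < d" by (simp add: d_def)
  have d1: "(1 + d) powr a = \<rho>" using assms by (simp add: d_def powr_powr)
  define C where "C = (1 + 1 / d) powr a"
  have "1 + 1 / d > 0" using d by (simp add: add_pos_pos)
  then have C: "C > 0" unfolding C_def by simp
  have "(x + y) powe a \<le> ennreal \<rho> * x powe a + ennreal C * y powe a" for x y
  proof (cases "x = \<infinity> \<or> y = \<infinity>")
    case True
    then show ?thesis using C assms
      by (auto simp: ennreal_mult_top)
  next
    case False
    then obtain b c where bc: "x = ennreal b" "0 \<le> b" "y = ennreal c" "0 \<le> c"
      by (metis ennreal_cases infinity_ennreal_def)
    have "(b + c) powr a \<le> \<rho> * b powr a + C * c powr a"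
    proof (cases "c \<le> d * b")
      case True
      then have "(b + c) powr a \<le> ((1 + d) * b) powr a"
        using bc assms by (intro powr_mono2) (auto simp: algebra_simps)
      also have "\<dots> = \<rho> * b powr a"
        using d bc by (simp add: powr_mult d1)
      also have "\<dots> \<le> \<rho> * b powr a + C * c powr a" using C by simp
      finally show ?thesis .
    next
      case False
      then have "(b + c) powr a \<le> ((1 + 1 / d) * c) powr a"
        using bc assms d by (intro powr_mono2) (auto simp: field_simps)
      also have "\<dots> = C * c powr a"
        using d bc by (simp add: powr_mult C_def)
      also have "\<dots> \<le> \<rho> * b powr a + C * c powr a" using assms by simp
      finally show ?thesis .
    qed
    then show ?thesis using bc C assms
      by (simp add: powe_ennreal ennreal_leI flip: ennreal_plus ennreal_mult)
  qed
  then show ?thesis using C by blast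
qed


section \<open>Least constants\<close>

lemma best_const_bound:
  assumes f: "f \<in> Mplus" and L: "Lnorm p v f < \<infinity>" and B: "best_const p v \<Phi> < \<infinity>"
  shows "\<Phi> f \<le> best_const p v \<Phi> * Lnorm p v f"
\<comment> \<open>The infimum is approached by admissible constants. Both finiteness assumptions
  guard against 0 times infinity: for infinite norm and best constant 0, or the reverse, the
  right-hand side is 0.\<close>
proof (rule ennreal_le_epsilon)
  fix e :: real assume "0 < e"
  obtain l where l: "Lnorm p v f = ennreal l" "0 \<le> l"
    using L by (cases "Lnorm p v f") auto
  obtain b where b: "best_const p v \<Phi> = ennreal b" "0 \<le> b"
    using B by (cases "best_const p v \<Phi>") auto
  define d where "d = e / (l + 1)"
  have d: "0 < d" "d * l \<le> e"
    using l \<open>0 < e\<close> by (auto simp: d_def field_simps)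
  have "best_const p v \<Phi> < ennreal (b + d)"
    using b d by (simp add: ennreal_less_iff)
  then obtain C where C: "C < ennreal (b + d)" "\<forall>f\<in>Mplus. \<Phi> f \<le> C * Lnorm p v f"
    unfolding best_const_def Inf_less_iff by blast
  have "\<Phi> f \<le> C * ennreal l" using C f l by auto
  also have "\<dots> \<le> ennreal (b + d) * ennreal l" using C by (intro mult_right_mono) auto
  also have "\<dots> = ennreal (b * l + d * l)"
    using b l d by (simp add: algebra_simps flip: ennreal_mult)
  also have "\<dots> \<le> ennreal (b * l + e)" using d by (intro ennreal_leI) auto
  also have "\<dots> = best_const p v \<Phi> * Lnorm p v f + ennreal e"
    using b l \<open>0 < e\<close> by (simp add: ennreal_mult)
  finally show "\<Phi> f \<le> best_const p v \<Phi> * Lnorm p v f + ennreal e" .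
qed

lemma best_const_leD:
  assumes "best_const p v \<Phi> \<le> ennreal S" "f \<in> Mplus" "Lnorm p v f < \<infinity>"
  shows "\<Phi> f \<le> ennreal S * Lnorm p v f"
proof -
  have "\<Phi> f \<le> best_const p v \<Phi> * Lnorm p v f"
    using assms by (intro best_const_bound) (auto intro: le_less_trans)
  also have "\<dots> \<le> ennreal S * Lnorm p v f"
    using assms by (intro mult_right_mono) auto
  finally show ?thesis .
qed

text \<open>Positivity of S disposes of the functions of infinite norm, so that only finite norms
  need be tested.\<close>

lemma best_const_leI:
  assumes "0 < S" "\<And>f. f \<in> Mplus \<Longrightarrow> Lnorm p v f < \<infinity> \<Longrightarrow> \<Phi> f \<le> S * Lnorm p v f"
  shows "best_const p v \<Phi> \<le> S"
  unfolding best_const_def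
proof (rule Inf_lower, safe)
  fix f assume "f \<in> Mplus"
  then show "\<Phi> f \<le> S * Lnorm p v f"
    using assms by (cases "Lnorm p v f = \<infinity>") (auto simp: ennreal_mult_top less_top)
qed

lemma best_const_mono:
  assumes "\<And>f. f \<in> Mplus \<Longrightarrow> \<Phi> f \<le> \<Psi> f"
  shows "best_const p v \<Phi> \<le> best_const p v \<Psi>"
  unfolding best_const_def by (rule Inf_superset_mono) (use assms order_trans in blast)

section \<open>Weighted norms on the half-line\<close>

abbreviation "HL \<equiv> lebesgue_on {0::real..}"

lemma MplusD [measurable_dest]: "f \<in> Mplus \<Longrightarrow> f \<in> borel_measurable HL"
  by (simp add: Mplus_def)

lemma MplusI: "f \<in> borel_measurable HL \<Longrightarrow> f \<in> Mplus"
  by (simp add: Mplus_def)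

lemma nn_integral_half_line:
  "(\<integral>\<^sup>+x\<in>{0..}. f x \<partial>lebesgue) = (\<integral>\<^sup>+x. f x \<partial>HL)" for f :: "real \<Rightarrow> ennreal"
  by (subst nn_integral_restrict_space) auto

lemma Lnorm_fin:
  "0 < q \<Longrightarrow> Lnorm (ennreal q) w g = (\<integral>\<^sup>+x. g x powe q * w x \<partial>HL) powe (1 / q)"
  by (simp add: Lnorm_def nn_integral_half_line)

lemma Lnorm_fin_le_iff:
  "0 < q \<Longrightarrow> Lnorm (ennreal q) w g \<le> c \<longleftrightarrow> (\<integral>\<^sup>+x. g x powe q * w x \<partial>HL) \<le> c powe q"
  by (simp add: Lnorm_fin powe_inverse_le_iff)

lemma Lnorm_fin_powe:
  "0 < q \<Longrightarrow> Lnorm (ennreal q) w g powe q = (\<integral>\<^sup>+x. g x powe q * w x \<partial>HL)"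
  by (simp add: Lnorm_fin powe_powe)

lemma Lnorm_inf: "Lnorm \<infinity> w g = esssup HL (\<lambda>x. w x * g x)"
  by (simp add: Lnorm_def)

lemma esssup_le_iff:
  fixes f :: "'a \<Rightarrow> ennreal"
  assumes "f \<in> borel_measurable M"
  shows "esssup M f \<le> c \<longleftrightarrow> (AE x in M. f x \<le> c)"
proof
  assume "esssup M f \<le> c"
  then show "AE x in M. f x \<le> c"
    by (intro eventually_mono[OF esssup_AE[of f M]]) (rule order_trans)
qed (use assms in \<open>auto intro: esssup_I\<close>)

lemma Lnorm_inf_le_iff:
  assumes [measurable]: "w \<in> Mplus" "g \<in> Mplus"
  shows "Lnorm \<infinity> w g \<le> c \<longleftrightarrow> (AE x in HL. w x * g x \<le> c)"
  unfolding Lnorm_inf by (rule esssup_le_iff) measurable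

lemma exponent_cases:
  assumes "0 < (q::ennreal)"
  obtains "q = \<infinity>" | q' where "0 < q'" "q = ennreal q'"
  using assms by (cases q) auto

lemma Lnorm_le_Lnorm:
  assumes q: "0 < q" and [measurable]: "w \<in> Mplus" "g \<in> Mplus"
    and le: "\<And>x. 0 \<le> x \<Longrightarrow> g x \<le> h x"
  shows "Lnorm q w g \<le> Lnorm q w h"
  using q
proof (cases rule: exponent_cases)
  case 1
  show ?thesis unfolding 1 Lnorm_inf
    using le by (intro esssup_AE_mono) (auto intro!: AE_I2 mult_left_mono)
next
  case (2 q')
  show ?thesis
    using le 2 by (auto simp: Lnorm_fin intro!: powe_mono nn_integral_mono mult_right_mono)
qed

text \<open>By the Archimedean property; it serves the infinite scalar in
  \<open>Lnorm_cmult\<close>.\<close>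

lemma ennreal_top_mult_le:
  assumes "\<And>n::nat. of_nat n * x \<le> (y::ennreal)"
  shows "\<infinity> * x \<le> y"
proof (cases "x = 0")
  case False
  have "y = \<infinity>"
  proof (rule ccontr)
    assume "y \<noteq> \<infinity>"
    then have "x \<noteq> \<infinity>" "y \<noteq> \<infinity>" using assms[of 1] by (auto simp: top_unique)
    then obtain a b where ab: "x = ennreal a" "y = ennreal b" "0 < a" "0 \<le> b"
      using False by (cases x; cases y) auto
    obtain n where n: "b < of_nat n * a" using ab(3) reals_Archimedean3 by blast
    have "ennreal (of_nat n * a) \<le> ennreal b"
      using assms[of n] ab by (simp add: ennreal_mult ennreal_of_nat_eq_real_of_nat)
    then show False using n ab by (simp add: ennreal_le_iff)
  qed
  then show ?thesis by simp
qed simp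

lemma Lnorm_cmult:
  assumes q: "0 < q" and [measurable]: "w \<in> Mplus" "g \<in> Mplus"
  shows "Lnorm q w (\<lambda>x. c * g x) = c * Lnorm q w g"
  using q
proof (cases rule: exponent_cases)
  case 1
  have ub: "Lnorm q w (\<lambda>x. c * h x) \<le> c * Lnorm q w h" if [measurable]: "h \<in> Mplus" for c h
  proof -
    have "AE x in HL. w x * h x \<le> Lnorm \<infinity> w h"
      using Lnorm_inf_le_iff[of w h "Lnorm \<infinity> w h"] that assms by simp
    then have "AE x in HL. w x * (c * h x) \<le> c * Lnorm \<infinity> w h"
      by eventually_elim (auto simp: mult.left_commute intro!: mult_left_mono)
    then show ?thesis
      unfolding 1 by (subst Lnorm_inf_le_iff) (auto intro!: MplusI)
  qed
  have lb: "ennreal a * Lnorm q w g \<le> Lnorm q w (\<lambda>x. ennreal a * g x)" if "0 < a" for a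
  proof -
    have "Lnorm q w (\<lambda>x. ennreal (1/a) * (ennreal a * g x)) \<le>
      ennreal (1/a) * Lnorm q w (\<lambda>x. ennreal a * g x)"
      by (rule ub) (auto intro!: MplusI)
    then have "Lnorm q w g \<le> ennreal (1/a) * Lnorm q w (\<lambda>x. ennreal a * g x)"
      using that by (simp add: mult.assoc[symmetric] flip: ennreal_mult)
    then have "ennreal a * Lnorm q w g \<le> ennreal a * (ennreal (1/a) * Lnorm q w (\<lambda>x. ennreal a * g x))"
      by (intro mult_left_mono) auto
    then show ?thesis
      using that by (simp add: mult.assoc[symmetric] flip: ennreal_mult)
  qed
  have "c * Lnorm q w g \<le> Lnorm q w (\<lambda>x. c * g x)"
  proof (cases c)
    case (real a)
    then show ?thesis using lb[of a] by (cases "a = 0") auto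
  next
    case top
    have "of_nat n * Lnorm q w g \<le> Lnorm q w (\<lambda>x. \<infinity> * g x)" for n
    proof (cases "n = 0")
      case False
      have "of_nat n * Lnorm q w g \<le> Lnorm q w (\<lambda>x. of_nat n * g x)"
        using lb[of "real n"] False by (simp add: ennreal_of_nat_eq_real_of_nat)
      also have "\<dots> \<le> Lnorm q w (\<lambda>x. \<infinity> * g x)"
        by (rule Lnorm_le_Lnorm) (auto intro!: MplusI mult_right_mono simp: q)
      finally show ?thesis .
    qed simp
    then show ?thesis using top by (simp add: ennreal_top_mult_le[simplified])
  qed
  then show ?thesis using ub[of g c] assms by (auto intro: antisym)
next
  case (2 q')
  have "(\<integral>\<^sup>+x. (c * g x) powe q' * w x \<partial>HL) = (\<integral>\<^sup>+x. c powe q' * (g x powe q' * w x) \<partial>HL)"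
    using 2 by (simp add: powe_mult mult_ac)
  also have "\<dots> = c powe q' * (\<integral>\<^sup>+x. g x powe q' * w x \<partial>HL)"
    by (rule nn_integral_cmult) auto
  finally show ?thesis using 2 by (simp add: Lnorm_fin powe_mult powe_powe)
qed

text \<open>A quasi-triangle inequality whose constant in front of the first summand is as close to 1
  as desired; iterating it over levels of geometrically growing weight then costs
  only a convergent geometric series.\<close>

lemma Lnorm_add_powe_le:
  assumes q: "0 < q" and r: "0 < r" and \<rho>: "1 < \<rho>"
  shows "\<exists>C>0. \<forall>w\<in>Mplus. \<forall>g\<in>Mplus. \<forall>h\<in>Mplus.
    Lnorm q w (\<lambda>x. g x + h x) powe r \<le> ennreal \<rho> * Lnorm q w g powe r + ennreal C * Lnorm q w h powe r"
  using q
proof (cases rule: exponent_cases)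
  case 1
  obtain C where C: "0 < C"
    "\<And>x y. (x + y) powe r \<le> ennreal \<rho> * x powe r + ennreal C * y powe r"
    using powe_sum_le[OF r \<rho>] by blast
  have "Lnorm q w (\<lambda>x. g x + h x) \<le> Lnorm q w g + Lnorm q w h"
    if [measurable]: "w \<in> Mplus" "g \<in> Mplus" "h \<in> Mplus" for w g h
  proof -
    have "AE x in HL. w x * g x \<le> Lnorm \<infinity> w g" "AE x in HL. w x * h x \<le> Lnorm \<infinity> w h"
      using Lnorm_inf_le_iff[of w g] Lnorm_inf_le_iff[of w h] that by auto
    then have "AE x in HL. w x * (g x + h x) \<le> Lnorm \<infinity> w g + Lnorm \<infinity> w h"
      by eventually_elim (auto simp: distrib_left intro: add_mono)
    then show ?thesis unfolding 1 by (subst Lnorm_inf_le_iff) (auto intro!: MplusI)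
  qed
  then have "Lnorm q w (\<lambda>x. g x + h x) powe r \<le> ennreal \<rho> * Lnorm q w g powe r + ennreal C * Lnorm q w h powe r"
    if "w \<in> Mplus" "g \<in> Mplus" "h \<in> Mplus" for w g h
    by (rule order_trans[OF powe_mono C(2)]) (use that r in auto)
  with C show ?thesis by blast
next
  case (2 q')
  \<comment> \<open>Two quasi-triangle inequalities are chained, one with exponent q' under the
    integral and one with exponent t outside it. The allowed loss is shared so that \<rho>2 *
    \<rho>1^t = \<rho>.\<close>
  define t where "t = r / q'"
  have t: "0 < t" using 2 r by (simp add: t_def)
  define \<rho>1 where "\<rho>1 = \<rho> powr (1 / (2 * t))"
  have "1 powr (1 / (2 * t)) < \<rho>1" unfolding \<rho>1_def using t \<rho> by (intro powr_less_mono2) auto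
  then have \<rho>1: "1 < \<rho>1" by simp
  define \<rho>2 where "\<rho>2 = \<rho> powr (1 / 2)"
  have "1 powr (1 / 2) < \<rho>2" unfolding \<rho>2_def using t \<rho> by (intro powr_less_mono2) auto
  then have \<rho>2: "1 < \<rho>2" by simp
  have "\<rho>1 powr t = \<rho> powr (1/2)"
    using t \<rho> by (simp add: \<rho>1_def powr_powr)
  then have \<rho>12: "\<rho>2 * \<rho>1 powr t = \<rho>"
    using \<rho> by (simp add: \<rho>2_def flip: powr_add)
  obtain C1 where C1: "0 < C1"
    "\<And>x y. (x + y) powe q' \<le> ennreal \<rho>1 * x powe q' + ennreal C1 * y powe q'"
    using powe_sum_le[OF 2(1) \<rho>1] by blast
  obtain C2 where C2: "0 < C2"
    "\<And>x y. (x + y) powe t \<le> ennreal \<rho>2 * x powe t + ennreal C2 * y powe t"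
    using powe_sum_le[OF t \<rho>2] by blast
  define C where "C = C2 * C1 powr t"
  have C: "0 < C" using C1 C2 by (simp add: C_def)
  have "Lnorm q w (\<lambda>x. g x + h x) powe r \<le> ennreal \<rho> * Lnorm q w g powe r + ennreal C * Lnorm q w h powe r"
    if [measurable]: "w \<in> Mplus" "g \<in> Mplus" "h \<in> Mplus" for w g h
  proof -
    let ?I = "\<lambda>g. \<integral>\<^sup>+x. g x powe q' * w x \<partial>HL"
    have L: "Lnorm q w g powe r = ?I g powe t" for g
      using 2 by (simp add: Lnorm_fin powe_powe t_def)
    have "?I (\<lambda>x. g x + h x) \<le> (\<integral>\<^sup>+x. ennreal \<rho>1 * (g x powe q' * w x) + ennreal C1 * (h x powe q' * w x) \<partial>HL)"
    proof (rule nn_integral_mono)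
      fix x show "(g x + h x) powe q' * w x
          \<le> ennreal \<rho>1 * (g x powe q' * w x) + ennreal C1 * (h x powe q' * w x)"
        using mult_right_mono[OF C1(2), of "w x" "g x" "h x"] by (simp add: distrib_right mult.assoc)
    qed
    also have "\<dots> = ennreal \<rho>1 * ?I g + ennreal C1 * ?I h"
      by (subst nn_integral_add) (auto simp: nn_integral_cmult)
    finally have "?I (\<lambda>x. g x + h x) powe t \<le> (ennreal \<rho>1 * ?I g + ennreal C1 * ?I h) powe t"
      using t by (intro powe_mono) auto
    also have "\<dots> \<le> ennreal \<rho>2 * (ennreal \<rho>1 * ?I g) powe t + ennreal C2 * (ennreal C1 * ?I h) powe t"
      by (rule C2)
    also have "\<dots> = ennreal \<rho> * ?I g powe t + ennreal C * ?I h powe t"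
      using t \<rho>1 \<rho>2 C1 C2
      by (simp add: powe_mult powe_ennreal C_def \<rho>12[symmetric] mult.assoc ennreal_mult)
    finally show ?thesis by (simp add: L)
  qed
  with C show ?thesis by blast
qed

text \<open>Monotone convergence for finite q, and a countable union of null sets for q =
  \<infinity>. It carries estimates over finitely many levels to a whole tail.\<close>

lemma Lnorm_Union_le:
  assumes q: "0 < q" and [measurable]: "w \<in> Mplus" "g \<in> Mplus"
    and S: "incseq S" "\<And>i. S i \<in> sets HL"
    and le: "\<And>i::nat. Lnorm q w (\<lambda>x. indicator (S i) x * g x) \<le> c"
  shows "Lnorm q w (\<lambda>x. indicator (\<Union>i. S i) x * g x) \<le> c"
  using q
proof (cases rule: exponent_cases)
  case 1
  have "AE x in HL. w x * (indicator (S i) x * g x) \<le> c" for i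
    using le[of i] S unfolding 1 by (subst (asm) Lnorm_inf_le_iff) (auto intro!: MplusI)
  then have "AE x in HL. \<forall>i. w x * (indicator (S i) x * g x) \<le> c"
    by (simp add: AE_all_countable)
  then have "AE x in HL. w x * (indicator (\<Union>i. S i) x * g x) \<le> c"
  proof eventually_elim
    fix x assume "\<forall>i. w x * (indicator (S i) x * g x) \<le> c"
    then have "w x * g x \<le> c" if "x \<in> S i" for i
      using that by (auto dest!: spec[of _ i])
    then show "w x * (indicator (\<Union>i. S i) x * g x) \<le> c"
      by (cases "\<exists>i. x \<in> S i") auto
  qed
  then show ?thesis
    using S unfolding 1 by (subst Lnorm_inf_le_iff) (auto intro!: MplusI)
next
  case (2 q')
  let ?g = "\<lambda>i x. indicator (S i) x * (g x powe q' * w x)"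
  have inc: "incseq ?g"
    using S(1) by (auto simp: incseq_def le_fun_def indicator_def split: if_splits; blast)
  have sup: "(SUP i. indicator (S i) x :: ennreal) = indicator (\<Union>i. S i) x" for x
    using S(1) LIMSEQ_indicator_incseq[OF S(1), where 'a = ennreal, of x]
    by (intro LIMSEQ_unique[OF LIMSEQ_SUP])
       (auto simp: incseq_def indicator_def split: if_splits; blast)
  have "(\<integral>\<^sup>+x. (indicator (\<Union>i. S i) x * g x) powe q' * w x \<partial>HL) = (\<integral>\<^sup>+x. (SUP i. ?g i x) \<partial>HL)"
    using 2 by (intro nn_integral_cong) (simp add: powe_mult SUP_mult_right_ennreal[symmetric] sup mult.assoc)
  also have "\<dots> = (SUP i. \<integral>\<^sup>+x. ?g i x \<partial>HL)"
    using S by (intro nn_integral_monotone_convergence_SUP inc) auto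
  also have "\<dots> \<le> c powe q'"
    using le 2 by (intro SUP_least) (simp add: Lnorm_fin_le_iff powe_mult mult.assoc)
  finally show ?thesis using 2 by (simp add: Lnorm_fin_le_iff)
qed

subsection \<open>Oinarov kernels and the levels of a primitive\<close>

lemma nn_integral_Icc_half_line:
  "0 \<le> a \<Longrightarrow> (\<integral>\<^sup>+z\<in>{a..b}. f z \<partial>lebesgue) = (\<integral>\<^sup>+z. f z * indicator {a..b} z \<partial>HL)"
  for f :: "real \<Rightarrow> ennreal"
  by (subst nn_integral_half_line[symmetric])
    (auto intro!: nn_integral_cong simp: indicator_def)

lemma half_line_borel: "f \<in> borel_measurable borel \<Longrightarrow> f \<in> borel_measurable HL"
  for f :: "real \<Rightarrow> 'a::topological_space"
  by (intro measurable_restrict_space1 measurable_completion) auto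

lemma Icc_sets_half_line [measurable]: "0 \<le> a \<Longrightarrow> {a..b} \<in> sets HL" "0 \<le> a \<Longrightarrow> {a..} \<in> sets HL"
  by (auto simp: sets_restrict_space intro: image_eqI[of _ _ "{a..b}"] image_eqI[of _ _ "{a..}"])

lemma indicator_half_line_measurable [measurable]:
  "(indicator {a..b} :: real \<Rightarrow> ennreal) \<in> borel_measurable HL"
  "(indicator {a..} :: real \<Rightarrow> ennreal) \<in> borel_measurable HL"
  by (auto intro!: half_line_borel)

context
  fixes D :: real and k :: "real \<Rightarrow> real \<Rightarrow> ennreal"
  assumes k: "oinarov_kernel D k"
begin

lemma oinarov_D: "1 \<le> D"
  using k by (simp add: oinarov_kernel_def)

lemma oinarov_lower:
  assumes "0 \<le> y" "y \<le> z" "z \<le> x"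
  shows "k x z + k z y \<le> ennreal D * k x y"
proof -
  have "ennreal (1 / D) * (k x z + k z y) \<le> k x y"
    using k assms by (auto simp: oinarov_kernel_def)
  then have "ennreal D * (ennreal (1 / D) * (k x z + k z y)) \<le> ennreal D * k x y"
    by (rule mult_left_mono) simp
  then show ?thesis
    using oinarov_D by (simp add: mult.assoc[symmetric] flip: ennreal_mult)
qed

text \<open>Dropping one summand of the lower kernel inequality leaves near-monotonicity: up to the
  factor D, the kernel decreases in its second variable and increases in its first.\<close>

lemma oinarov_lower1: "0 \<le> y \<Longrightarrow> y \<le> z \<Longrightarrow> z \<le> x \<Longrightarrow> k x z \<le> ennreal D * k x y"
  and oinarov_lower2: "0 \<le> y \<Longrightarrow> y \<le> z \<Longrightarrow> z \<le> x \<Longrightarrow> k z y \<le> ennreal D * k x y"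
  using oinarov_lower by (meson add_increasing add_increasing2 order_trans order_refl zero_le)+

lemma oinarov_upper:
  "0 \<le> y \<Longrightarrow> y \<le> z \<Longrightarrow> z \<le> x \<Longrightarrow> k x y \<le> ennreal D * (k x z + k z y)"
  using k by (auto simp: oinarov_kernel_def)

lemma kernel_borel:
  "(\<lambda>p. indicator ({0..} \<times> {0..}) p * k (fst p) (snd p)) \<in> borel_measurable (borel \<Otimes>\<^sub>M borel)"
proof -
  have "(\<lambda>(x, y). k x y) \<in> borel_measurable (restrict_space borel ({0..} \<times> {0..}))"
    using k by (simp add: oinarov_kernel_def)
  then have "(\<lambda>p. (case p of (x, y) \<Rightarrow> k x y) * indicator ({0..} \<times> {0..}) p) \<in> borel_measurable borel"
    by (subst (asm) borel_measurable_restrict_space_iff_ennreal)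
       (auto simp: borel_prod[symmetric])
  then show ?thesis
    by (simp add: borel_prod case_prod_beta mult.commute)
qed

lemma kernel_section1: "0 \<le> x \<Longrightarrow> k x \<in> borel_measurable HL"
proof -
  assume "0 \<le> x"
  have "(\<lambda>z. indicator ({0..} \<times> {0..}) (x, z) * k (fst (x, z)) (snd (x, z))) \<in> borel_measurable borel"
    by (rule measurable_compose[OF _ kernel_borel]) measurable
  then have "(\<lambda>z. indicator ({0..} \<times> {0..}) (x, z) * k x z) \<in> borel_measurable HL"
    by (intro half_line_borel) simp
  then show ?thesis
    by (rule measurable_cong[THEN iffD1, rotated]) (use \<open>0 \<le> x\<close> in auto)
qed

lemma kernel_section2: "0 \<le> x \<Longrightarrow> (\<lambda>y. k y x) \<in> borel_measurable HL"
proof -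
  assume "0 \<le> x"
  have "(\<lambda>z. indicator ({0..} \<times> {0..}) (z, x) * k (fst (z, x)) (snd (z, x))) \<in> borel_measurable borel"
    by (rule measurable_compose[OF _ kernel_borel]) measurable
  then have "(\<lambda>z. indicator ({0..} \<times> {0..}) (z, x) * k z x) \<in> borel_measurable HL"
    by (intro half_line_borel) simp
  then show ?thesis
    by (rule measurable_cong[THEN iffD1, rotated]) (use \<open>0 \<le> x\<close> in auto)
qed

lemma kernel_op_HL: "kernel_op k f x = (\<integral>\<^sup>+z. k x z * f z * indicator {0..x} z \<partial>HL)"
  unfolding kernel_op_def by (rule nn_integral_Icc_half_line) simp

text \<open>Tonelli's theorem is applied over Borel sets, whereas f is only Lebesgue measurable;
  replacing f by a Borel function equal to it almost everywhere does not change the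
  integral.\<close>

lemma kernel_op_measurable:
  assumes f: "f \<in> Mplus"
  shows "kernel_op k f \<in> Mplus"
proof -
  have "(\<lambda>z. f z * indicator {0..} z) \<in> borel_measurable lebesgue"
    using f unfolding Mplus_def by (subst (asm) borel_measurable_restrict_space_iff_ennreal) auto
  then obtain g where g [measurable]: "g \<in> borel_measurable lborel"
    and ae: "AE z in lborel. f z * indicator {0..} z = g z"
    using completion_ex_borel_measurable by blast
  define F where "F p = (indicator ({0..} \<times> {0..}) p * k (fst p) (snd p)) * g (snd p) * indicator {p. snd p \<le> fst p} p"
    for p
  have "F \<in> borel_measurable (borel \<Otimes>\<^sub>M borel)"
    unfolding F_def using g kernel_borel by measurable
  then have "(\<lambda>(x, z). F (x, z)) \<in> borel_measurable (borel \<Otimes>\<^sub>M lborel)"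
    by (simp cong: measurable_cong_sets)
  then have "(\<lambda>x. \<integral>\<^sup>+z. F (x, z) \<partial>lborel) \<in> borel_measurable borel" (is "?K \<in> _")
    by (rule lborel.borel_measurable_nn_integral)
  then have "?K \<in> borel_measurable HL" by (rule half_line_borel)
  moreover have "?K x = kernel_op k f x" if "x \<in> space HL" for x
  proof -
    have "?K x = (\<integral>\<^sup>+z. k x z * f z * indicator {0..x} z \<partial>lborel)"
      by (rule nn_integral_cong_AE, use ae in eventually_elim)
        (use that in \<open>auto simp: indicator_def F_def\<close>)
    then show ?thesis
      by (simp add: kernel_op_def nn_integral_completion)
  qed
  ultimately show ?thesis
    unfolding Mplus_def by (rule measurable_cong[THEN iffD1, rotated])
qed

lemma kernel_op_mono:
  "(\<And>z. 0 \<le> z \<Longrightarrow> z \<le> x \<Longrightarrow> f z \<le> g z) \<Longrightarrow> kernel_op k f x \<le> kernel_op k g x"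
  unfolding kernel_op_def by (intro nn_integral_mono) (auto simp: indicator_def mult_left_mono)

lemma kernel_op_cmult:
  assumes [measurable]: "f \<in> Mplus" and "0 \<le> x"
  shows "kernel_op k (\<lambda>z. c * f z) x = c * kernel_op k f x"
proof -
  have [measurable]: "k x \<in> borel_measurable HL" using assms by (intro kernel_section1)
  then show ?thesis
  unfolding kernel_op_HL
  by (subst nn_integral_cmult[symmetric]) (auto simp: mult_ac)
qed

text \<open>The two forms of near-monotonicity, integrated against f. They provide the pointwise
  lower bounds for \<open>T f\<close> behind \<open>A0_le\<close> and \<open>A1_le\<close>.\<close>

lemma kernel_op_le_later:
  assumes [measurable]: "f \<in> Mplus" and "0 \<le> x" "x \<le> y"
  shows "kernel_op k f x \<le> ennreal D * kernel_op k f y"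
    and "k y x * (\<integral>\<^sup>+z\<in>{0..x}. f z \<partial>lebesgue) \<le> ennreal D * kernel_op k f y"
proof -
  have [measurable]: "k y \<in> borel_measurable HL" using assms by (intro kernel_section1) auto
  have "kernel_op k f x \<le> (\<integral>\<^sup>+z. ennreal D * (k y z * f z * indicator {0..y} z) \<partial>HL)"
    unfolding kernel_op_HL
    using oinarov_lower2[of _ x y] assms
    by (intro nn_integral_mono) (auto simp: indicator_def mult.assoc[symmetric] intro!: mult_right_mono)
  also have "\<dots> = ennreal D * kernel_op k f y"
    unfolding kernel_op_HL by (rule nn_integral_cmult) measurable
  finally show "kernel_op k f x \<le> ennreal D * kernel_op k f y" .
  have "k y x * (\<integral>\<^sup>+z\<in>{0..x}. f z \<partial>lebesgue) = (\<integral>\<^sup>+z. k y x * (f z * indicator {0..x} z) \<partial>HL)"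
    by (simp add: nn_integral_Icc_half_line nn_integral_cmult)
  also have "\<dots> \<le> (\<integral>\<^sup>+z. ennreal D * (k y z * f z * indicator {0..y} z) \<partial>HL)"
    using oinarov_lower1[of _ x y] assms
    by (intro nn_integral_mono) (auto simp: indicator_def mult.assoc[symmetric] intro!: mult_right_mono)
  also have "\<dots> = ennreal D * kernel_op k f y"
    unfolding kernel_op_HL by (rule nn_integral_cmult) measurable
  finally show "k y x * (\<integral>\<^sup>+z\<in>{0..x}. f z \<partial>lebesgue) \<le> ennreal D * kernel_op k f y" .
qed

text \<open>The part of f on S is kept as it is; any other z <= y lies below x, where the upper
  kernel inequality with intermediate point x separates y from z.\<close>

lemma kernel_op_split:
  assumes [measurable]: "f \<in> Mplus" "(\<lambda>z. indicator S z * f z) \<in> Mplus"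
    and xy: "0 \<le> x" "x \<le> y" and S: "\<And>z. 0 \<le> z \<Longrightarrow> z \<le> y \<Longrightarrow> z \<notin> S \<Longrightarrow> z \<le> x"
  shows "kernel_op k f y \<le> kernel_op k (\<lambda>z. indicator S z * f z) y
    + ennreal D * (k y x * (\<integral>\<^sup>+z\<in>{0..x}. f z \<partial>lebesgue) + kernel_op k f x)"
proof -
  have [measurable]: "k y \<in> borel_measurable HL" "k x \<in> borel_measurable HL"
    using xy by (auto intro: kernel_section1)
  have "kernel_op k f y \<le> (\<integral>\<^sup>+z. k y z * (indicator S z * f z) * indicator {0..y} z
      + ennreal D * (k y x * (f z * indicator {0..x} z) + k x z * f z * indicator {0..x} z) \<partial>HL)"
    unfolding kernel_op_HL
  proof (rule nn_integral_mono)
    fix z assume "z \<in> space HL"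
    then have "0 \<le> z" by simp
    show "k y z * f z * indicator {0..y} z \<le> k y z * (indicator S z * f z) * indicator {0..y} z
      + ennreal D * (k y x * (f z * indicator {0..x} z) + k x z * f z * indicator {0..x} z)"
    proof (cases "z \<in> S \<or> y < z")
      case False
      then have z: "z \<le> x" using S \<open>0 \<le> z\<close> by auto
      have "k y z * f z \<le> ennreal D * (k y x + k x z) * f z"
        using z \<open>0 \<le> z\<close> xy by (intro mult_right_mono oinarov_upper) auto
      then show ?thesis using False z \<open>0 \<le> z\<close> by (simp add: algebra_simps)
    qed auto
  qed
  also have "\<dots> = kernel_op k (\<lambda>z. indicator S z * f z) y
    + ennreal D * (k y x * (\<integral>\<^sup>+z\<in>{0..x}. f z \<partial>lebesgue) + kernel_op k f x)"
    by (simp add: nn_integral_add nn_integral_cmult kernel_op_HL nn_integral_Icc_half_line)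
  finally show ?thesis .
qed

end

section \<open>The primitive of the weight and its generalised inverse\<close>

locale locally_integrable_weight =
  fixes u :: "real \<Rightarrow> ennreal"
  assumes u [measurable]: "u \<in> Mplus"
    and finite_integral: "0 < t \<Longrightarrow> (\<integral>\<^sup>+x\<in>{0..t}. u x \<partial>lebesgue) < \<infinity>"
begin

definition V :: "real \<Rightarrow> real" where
  "V x = enn2real (primitive u x)"

lemma primitive_mono: "x \<le> y \<Longrightarrow> primitive u x \<le> primitive u y"
  unfolding primitive_def by (intro nn_integral_mono) (auto simp: indicator_def)

lemma primitive_nonpos: "x \<le> 0 \<Longrightarrow> primitive u x = 0"
proof -
  assume "x \<le> 0"
  have "primitive u x \<le> primitive u 0"
    using \<open>x \<le> 0\<close> by (rule primitive_mono)
  also have "primitive u 0 = (\<integral>\<^sup>+(z::real). 0 \<partial>lebesgue)"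
    unfolding primitive_def
  proof (rule nn_integral_cong_AE)
    show "AE z in lebesgue. u z * indicator {0..0} z = 0"
      using AE_lborel_singleton[of "0::real", THEN AE_completion] by eventually_elim auto
  qed
  finally show ?thesis by simp
qed

lemma primitive_V: "primitive u x = ennreal (V x)"
proof (cases "0 < x")
  case True
  then have "primitive u x < \<infinity>" using finite_integral by (simp add: primitive_def)
  then show ?thesis by (simp add: V_def)
qed (simp add: V_def primitive_nonpos)

lemma V_nonneg [simp]: "0 \<le> V x"
  by (simp add: V_def)

lemma V_mono: "x \<le> y \<Longrightarrow> V x \<le> V y"
  using primitive_mono[of x y] by (simp add: primitive_V)

lemma V_nonpos: "x \<le> 0 \<Longrightarrow> V x = 0"
  by (simp add: V_def primitive_nonpos)

lemma V_less_imp_less: "V x < V y \<Longrightarrow> x < y"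
  using V_mono[of y x] by (meson not_le)

lemma V_pos_imp_pos: "0 < V x \<Longrightarrow> 0 < x"
  using V_nonpos[of x] by (cases "x \<le> 0") auto

text \<open>The purpose is continuity of \<open>V\<close>, through the indefinite gauge integral. As
  \<open>u\<close> is integrable on \<open>{0..x}\<close>, it is finite almost everywhere there, and
  \<open>enn2real\<close> loses nothing.\<close>

lemma V_eq_integral:
  assumes "0 \<le> x"
  shows "(\<lambda>z. enn2real (u z)) integrable_on {0..x}" "V x = integral {0..x} (\<lambda>z. enn2real (u z))"
proof -
  have fin: "(\<integral>\<^sup>+z. u z * indicator {0..x} z \<partial>lebesgue) < \<infinity>"
    using primitive_V[of x] by (simp add: primitive_def)
  define U where "U z = u z * indicator {0..} z" for z
  have [measurable]: "U \<in> borel_measurable lebesgue"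
    using u unfolding Mplus_def U_def by (subst (asm) borel_measurable_restrict_space_iff_ennreal) auto
  have U: "(\<lambda>z. u z * indicator {0..x} z) = (\<lambda>z. U z * indicator {0..x} z)"
    by (auto simp: indicator_def U_def)
  have m [measurable]: "(\<lambda>z. u z * indicator {0..x} z) \<in> borel_measurable lebesgue"
    unfolding U by (intro borel_measurable_times_ennreal borel_measurable_indicator) auto
  have eq: "indicat_real {0..x} z *\<^sub>R enn2real (u z) = enn2real (u z * indicator {0..x} z)" for z
    by (auto simp: indicator_def)
  have "AE z in lebesgue. u z * indicator {0..x} z \<noteq> \<infinity>"
    using fin by (intro nn_integral_PInf_AE m) (auto simp: less_top)
  then have eq2: "(\<integral>\<^sup>+z. ennreal (indicat_real {0..x} z *\<^sub>R enn2real (u z)) \<partial>lebesgue) = primitive u x"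
    unfolding primitive_def eq by (intro nn_integral_cong_AE) (auto elim!: eventually_mono simp: less_top)
  have int: "set_integrable lebesgue {0..x} (\<lambda>z. enn2real (u z))"
    unfolding set_integrable_def
    by (rule integrableI_nonneg) (use eq2 primitive_V[of x] eq in auto)
  show "(\<lambda>z. enn2real (u z)) integrable_on {0..x}"
    by (rule set_lebesgue_integral_eq_integral(1)[OF int])
  have "ennreal (LINT z:{0..x}|lebesgue. enn2real (u z)) = primitive u x"
    unfolding set_lebesgue_integral_def eq2[symmetric]
    using int unfolding set_integrable_def
    by (intro nn_integral_eq_integral[symmetric]) auto
  moreover have "0 \<le> (LINT z:{0..x}|lebesgue. enn2real (u z))"
    unfolding set_lebesgue_integral_def by (intro integral_nonneg_AE) auto
  ultimately have "V x = (LINT z:{0..x}|lebesgue. enn2real (u z))"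
    unfolding V_def by (metis enn2real_ennreal)
  then show "V x = integral {0..x} (\<lambda>z. enn2real (u z))"
    using set_lebesgue_integral_eq_integral(2)[OF int] by simp
qed

lemma continuous_on_V: "0 \<le> b \<Longrightarrow> continuous_on {0..b} V"
  by (rule continuous_on_cong[THEN iffD1, OF refl _ indefinite_integral_continuous_1[OF V_eq_integral(1)]])
    (auto simp: V_eq_integral(2))

text \<open>Left generalised inverse of \<open>V\<close>, with the same set as in
  \<open>sigma_inv\<close>, so that \<open>sigma_inv\<close> is a special case.\<close>

definition lev :: "real \<Rightarrow> real" where
  "lev c = Inf {y. 0 < y \<and> c \<le> V y}"

text \<open>By continuity the set where V = c is non-empty and compact in \<open>{0..b}\<close>; its
  least point is the infimum. The last claim is a Galois connection, by which all later comparisons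
  of points become comparisons of values of \<open>V\<close>.\<close>

lemma lev:
  assumes c: "0 < c" "c \<le> V b"
  shows V_lev: "V (lev c) = c" and lev_pos: "0 < lev c" and lev_le_iff: "lev c \<le> y \<longleftrightarrow> c \<le> V y"
proof -
  have ivt: "\<exists>t. 0 \<le> t \<and> t \<le> y \<and> V t = c" if "c \<le> V y" for y
  proof (rule IVT')
    show "V 0 \<le> c" using c V_nonpos[of 0] by simp
    have "0 < y" by (rule V_pos_imp_pos) (use that c in simp)
    then show "0 \<le> y" "continuous_on {0..y} V" by (auto intro: continuous_on_V)
  qed (fact that)
  have b: "0 < b" by (rule V_pos_imp_pos) (use c in simp)
  have "closed ({0..b} \<inter> V -` {c})"
    using b by (intro continuous_closed_preimage continuous_on_V) auto
  then have "compact ({0..b} \<inter> V -` {c})"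
    by (simp add: compact_eq_bounded_closed bounded_Int)
  moreover have "{0..b} \<inter> V -` {c} \<noteq> {}" using ivt[OF c(2)] by auto
  ultimately have "\<exists>t\<in>{0..b} \<inter> V -` {c}. \<forall>t'\<in>{0..b} \<inter> V -` {c}. t \<le> t'"
    by (rule compact_attains_inf)
  then obtain t where t: "t \<in> {0..b} \<inter> V -` {c}" "\<And>t'. t' \<in> {0..b} \<inter> V -` {c} \<Longrightarrow> t \<le> t'"
    by blast
  have t0: "V t = c" "0 < t" using t(1) c(1) V_pos_imp_pos[of t] by auto
  have iff: "t \<le> y \<longleftrightarrow> c \<le> V y" for y
  proof
    assume "c \<le> V y"
    then obtain t' where t': "0 \<le> t'" "t' \<le> y" "V t' = c" using ivt by blast
    then show "t \<le> y" using t(2)[of t'] t(1) by (cases "t' \<le> b"; simp)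
  qed (use V_mono t0 in auto)
  have "lev c = t"
    unfolding lev_def by (rule cInf_eq_minimum) (use iff t0 in auto)
  with t0 iff show "V (lev c) = c" "0 < lev c" "lev c \<le> y \<longleftrightarrow> c \<le> V y" by auto
qed

lemma sigma_inv_eq: "sigma_inv u x = lev (V x / 2)"
proof -
  have "ennreal (1 / 2) * ennreal (V x) = ennreal (V x / 2)"
    by (subst ennreal_mult[symmetric]) auto
  then have "ennreal (1 / 2) * ennreal (V x) \<le> ennreal (V y) \<longleftrightarrow> V x / 2 \<le> V y" for y
    by simp
  then show ?thesis by (simp add: sigma_inv_def lev_def primitive_V)
qed

lemma
  assumes "0 < V x"
  shows V_sigma_inv: "V (sigma_inv u x) = V x / 2" and sigma_inv_pos: "0 < sigma_inv u x"
    and sigma_inv_le_iff: "sigma_inv u x \<le> y \<longleftrightarrow> V x / 2 \<le> V y"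
  using lev[of "V x / 2" x] assms by (auto simp: sigma_inv_eq)

lemma less_sigma_iff:
  assumes "0 < V x" "0 \<le> y"
  shows "ennreal y < sigma u x \<longleftrightarrow> V y < 2 * V x"
proof -
  have *: "2 * primitive u x \<le> primitive u y \<longleftrightarrow> 2 * V x \<le> V y" for y
  proof -
    have "2 * primitive u x = ennreal (2 * V x)" by (simp add: primitive_V ennreal_mult)
    then show ?thesis by (simp add: primitive_V)
  qed
  show ?thesis
  proof
    assume y: "ennreal y < sigma u x"
    show "V y < 2 * V x"
    proof (rule ccontr)
      assume "\<not> V y < 2 * V x"
      then have "sigma u x \<le> ennreal y"
        unfolding sigma_def using assms V_pos_imp_pos[of y] by (intro Inf_lower) (auto simp: *)
      then show False using y by simp
    qed
  next
    assume y: "V y < 2 * V x"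
    show "ennreal y < sigma u x"
    proof (cases "\<exists>b. 2 * V x \<le> V b")
      case True
      then obtain b where b: "2 * V x \<le> V b" by blast
      have "y < lev (2 * V x)"
        using lev_le_iff[of "2 * V x" b y] b y assms by auto
      then have "ennreal y < ennreal (lev (2 * V x))"
        using assms by (simp add: ennreal_less_iff)
      also have "\<dots> \<le> sigma u x"
        unfolding sigma_def using lev_le_iff[of "2 * V x" b] b assms
        by (intro Inf_greatest) (auto simp: * intro!: ennreal_leI)
      finally show ?thesis .
    next
      case False
      \<comment> \<open>\<open>V\<close> never reaches twice its value at x, so the right end of the
        block is infinite.\<close>
      then have "sigma u x = Inf {}" unfolding sigma_def by (intro arg_cong[where f=Inf]) (auto simp: *)
      then show ?thesis by simp
    qed
  qed
qed

lemma V_measurable [measurable]: "V \<in> borel_measurable HL"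
  by (intro half_line_borel borel_measurable_mono) (simp add: mono_def V_mono)

text \<open>The sublevel set is an initial interval: it ends at \<open>lev c\<close>, or it is the
  whole half-line if c is never reached, which is then exhausted by
  \<open>{0..real n}\<close>.\<close>

lemma integral_sublevel_le:
  assumes c: "0 < c"
  shows "(\<integral>\<^sup>+x. indicator {x. V x < c} x * u x \<partial>HL) \<le> ennreal c"
proof (cases "\<exists>b. c \<le> V b")
  case True
  then obtain b where b: "c \<le> V b" by blast
  have "(\<integral>\<^sup>+x. indicator {x. V x < c} x * u x \<partial>HL) \<le> (\<integral>\<^sup>+x. u x * indicator {0..lev c} x \<partial>HL)"
  proof (rule nn_integral_mono)
    fix x assume "x \<in> space HL"
    moreover have "x \<le> lev c" if "V x < c" using lev_le_iff[OF c b, of x] that by linarith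
    ultimately show "indicator {x. V x < c} x * u x \<le> u x * indicator {0..lev c} x"
      by (auto simp: indicator_def)
  qed
  also have "\<dots> = ennreal c"
    using V_lev[OF c b] primitive_V[of "lev c"] by (simp add: primitive_def nn_integral_Icc_half_line)
  finally show ?thesis .
next
  case False
  have "(\<integral>\<^sup>+x. indicator {x. V x < c} x * u x \<partial>HL) \<le> (\<integral>\<^sup>+x. (SUP n::nat. u x * indicator {0..real n} x) \<partial>HL)"
  proof (rule nn_integral_mono)
    fix x assume "x \<in> space HL"
    then obtain n where "x \<le> real n" "0 \<le> x" using real_arch_simple[of x] by auto
    then have "u x \<le> (SUP n::nat. u x * indicator {0..real n} x)"
      by (intro SUP_upper2[of n]) auto
    then show "indicator {x. V x < c} x * u x \<le> (SUP n::nat. u x * indicator {0..real n} x)"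
      by (auto simp: indicator_def)
  qed
  also have "\<dots> = (SUP n::nat. \<integral>\<^sup>+x. u x * indicator {0..real n} x \<partial>HL)"
  proof (rule nn_integral_monotone_convergence_SUP)
    show "incseq (\<lambda>n x. u x * indicator {0..real n} x)"
      by (auto simp: incseq_def le_fun_def indicator_def)
  qed measurable
  also have "\<dots> \<le> ennreal c"
  proof (rule SUP_least)
    fix n :: nat
    have "V (real n) \<le> c" using False by (metis less_imp_le not_le)
    then show "(\<integral>\<^sup>+x. u x * indicator {0..real n} x \<partial>HL) \<le> ennreal c"
      using primitive_V[of "real n"] by (simp add: primitive_def nn_integral_Icc_half_line ennreal_leI)
  qed
  finally show ?thesis .
qed

text \<open>Let c tend to 0 in \<open>integral_sublevel_le\<close>. The points with
  \<open>V x = 0\<close> belong to no level, and this makes them negligible in integrals against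
  \<open>u\<close>.\<close>

lemma AE_weight_zero: "AE x in HL. V x = 0 \<longrightarrow> u x = 0"
proof -
  have "(\<integral>\<^sup>+x. indicator {x. V x = 0} x * u x \<partial>HL) \<le> 0"
  proof (rule ennreal_le_epsilon)
    fix e :: real assume "0 < e"
    then have "(\<integral>\<^sup>+x. indicator {x. V x = 0} x * u x \<partial>HL) \<le> (\<integral>\<^sup>+x. indicator {x. V x < e} x * u x \<partial>HL)"
      by (intro nn_integral_mono) (auto simp: indicator_def)
    also have "\<dots> \<le> ennreal e" using \<open>0 < e\<close> by (rule integral_sublevel_le)
    finally show "(\<integral>\<^sup>+x. indicator {x. V x = 0} x * u x \<partial>HL) \<le> 0 + ennreal e" by simp
  qed
  moreover have [measurable]: "{x. V x = 0} \<inter> {0..} \<in> sets HL"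
  proof -
    have "{x \<in> space HL. V x = 0} \<in> sets HL" by measurable
    also have "{x \<in> space HL. V x = 0} = {x. V x = 0} \<inter> {0..}" by auto
    finally show ?thesis .
  qed
  have "(\<integral>\<^sup>+x. indicator {x. V x = 0} x * u x \<partial>HL) = (\<integral>\<^sup>+x. indicator ({x. V x = 0} \<inter> {0..}) x * u x \<partial>HL)"
    by (intro nn_integral_cong) (auto simp: indicator_def)
  ultimately have "AE x in HL. indicator ({x. V x = 0} \<inter> {0..}) x * u x = 0"
    by (subst nn_integral_0_iff_AE[symmetric]) auto
  then show ?thesis
    using AE_space by eventually_elim (auto simp: indicator_def split: if_splits)
qed

text \<open>The levels have ratio \<open>sqrt 2\<close>, not 2: for \<open>x\<close> in level \<open>m - 1\<close> the whole level \<open>m\<close>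
  must lie below \<open>sigma u x\<close>.\<close>

definition lam :: "int \<Rightarrow> real" where
  "lam n = sqrt 2 powr real_of_int n"

definition E :: "int \<Rightarrow> real set" where
  "E n = {x. 0 \<le> x \<and> lam n \<le> V x \<and> V x < lam (n + 1)}"

text \<open>Meaningful only where \<open>V x > 0\<close>; at \<open>V x = 0\<close> the logarithm
  has a default value, hence the guards \<open>0 < V x\<close> below.\<close>

definition lv :: "real \<Rightarrow> int" where
  "lv x = \<lfloor>log (sqrt 2) (V x)\<rfloor>"

lemma lam_pos [simp]: "0 < lam n" "0 \<le> lam n" "lam n \<noteq> 0"
  by (simp_all add: lam_def)

lemma lam_Suc: "lam (n + 1) = sqrt 2 * lam n"
  by (simp add: lam_def powr_add)

lemma lam_plus_2: "lam (n + 2) = 2 * lam n"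
  using lam_Suc[of n] lam_Suc[of "n + 1"] by (simp add: add.assoc)

lemma lam_mono: "m \<le> n \<Longrightarrow> lam m \<le> lam n"
  by (simp add: lam_def)

lemma mem_E_iff: "x \<in> E n \<longleftrightarrow> 0 < V x \<and> lv x = n"
proof (cases "0 < V x")
  case True
  then have "lam n \<le> V x \<and> V x < lam (n + 1) \<longleftrightarrow> real_of_int n \<le> log (sqrt 2) (V x) \<and> log (sqrt 2) (V x) < real_of_int (n + 1)"
    by (simp add: lam_def powr_le_iff less_powr_iff)
  also have "\<dots> \<longleftrightarrow> lv x = n"
    unfolding lv_def by (auto simp: floor_eq_iff)
  finally show ?thesis using True V_pos_imp_pos[OF True] by (auto simp: E_def)
next
  case False
  then show ?thesis using lam_pos(1)[of n] by (auto simp: E_def simp del: lam_pos)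
qed

lemma E_disjoint: "x \<in> E m \<Longrightarrow> x \<in> E n \<Longrightarrow> m = n"
  by (simp add: mem_E_iff)

lemma lv_measurable [measurable]: "lv \<in> measurable HL (count_space UNIV)"
  unfolding lv_def by measurable

lemma E_sets [measurable]: "E n \<in> sets HL"
proof -
  have "{x \<in> space HL. lam n \<le> V x \<and> V x < lam (n + 1)} \<in> sets HL" by measurable
  also have "{x \<in> space HL. lam n \<le> V x \<and> V x < lam (n + 1)} = E n" by (auto simp: E_def)
  finally show ?thesis .
qed

section \<open>The mass of the levels\<close>

definition weight :: "int \<Rightarrow> ennreal" where
  "weight n = (\<integral>\<^sup>+x. indicator (E n) x * u x \<partial>HL)"

lemma weight_le: "weight n \<le> ennreal (lam (n + 1))"
proof -
  have "weight n \<le> (\<integral>\<^sup>+x. indicator {x. V x < lam (n + 1)} x * u x \<partial>HL)"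
    unfolding weight_def by (intro nn_integral_mono) (auto simp: indicator_def E_def)
  also have "\<dots> \<le> ennreal (lam (n + 1))" by (rule integral_sublevel_le) simp
  finally show ?thesis .
qed

text \<open>If \<open>V\<close> passes through the whole of level n, its increment there is
  \<open>lam (n + 1) - lam n\<close>. The hypothesis excludes the last level, on which
  \<open>V\<close> may stop growing at once; this forces the shift by one level wherever a lower
  bound for the mass is used.\<close>

lemma weight_ge:
  assumes b: "lam (n + 1) \<le> V b"
  shows "ennreal ((sqrt 2 - 1) * lam n) \<le> weight n"
proof -
  have b': "lam n \<le> V b" using b lam_mono[of n "n + 1"] by simp
  let ?s = "lev (lam n)" and ?t = "lev (lam (n + 1))"
  note t = lev[OF lam_pos(1) b] and s = lev[OF lam_pos(1) b']
  have "ennreal (lam (n + 1)) = (\<integral>\<^sup>+x. u x * indicator {0..?t} x \<partial>HL)"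
    using t primitive_V[of ?t] by (simp add: primitive_def nn_integral_Icc_half_line)
  also have "\<dots> \<le> (\<integral>\<^sup>+x. u x * indicator {0..?s} x + indicator (E n) x * u x \<partial>HL)"
  proof (rule nn_integral_mono_AE)
    \<comment> \<open>The right end point already belongs to the next level, but it is a null
      set.\<close>
    have "AE x in HL. x \<noteq> ?t"
      by (rule AE_restrict_space_iff[THEN iffD2])
         (use AE_lborel_singleton[of ?t, THEN AE_completion] in \<open>auto elim: eventually_mono\<close>)
    then show "AE x in HL. u x * indicator {0..?t} x \<le> u x * indicator {0..?s} x + indicator (E n) x * u x"
    proof eventually_elim
      case (elim x)
      show ?case
        using elim s(3)[of x] t(3)[of x] by (auto simp: indicator_def E_def)
    qed
  qed
  also have "\<dots> = ennreal (lam n) + weight n"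
    unfolding weight_def using s primitive_V[of ?s]
    by (subst nn_integral_add) (auto simp: primitive_def nn_integral_Icc_half_line)
  finally have "ennreal (lam (n + 1)) - ennreal (lam n) \<le> weight n"
    by (simp add: ennreal_minus_le_iff)
  moreover have "ennreal ((sqrt 2 - 1) * lam n) = ennreal (lam (n + 1)) - ennreal (lam n)"
    by (simp add: lam_Suc ennreal_minus left_diff_distrib)
  ultimately show ?thesis by simp
qed

text \<open>Tonelli's theorem for a function that is constant on levels. Sums over levels are
  written as integrals for the counting measure, so that an index shift is a change of variables by
  a bijection.\<close>

lemma nn_integral_levels:
  "(\<integral>\<^sup>+x. u x * (if 0 < V x then G (lv x) else 0) \<partial>HL) = (\<integral>\<^sup>+n. weight n * G n \<partial>count_space UNIV)"
proof -
  have pt: "u x * (if 0 < V x then G (lv x) else 0) = (\<integral>\<^sup>+n. indicator (E n) x * u x * G n \<partial>count_space UNIV)" for x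
  proof (cases "0 < V x")
    case True
    have "(\<integral>\<^sup>+n. indicator (E n) x * u x * G n \<partial>count_space UNIV) =
      (\<integral>\<^sup>+n. u x * G n * indicator {lv x} n \<partial>count_space UNIV)"
      using True by (intro nn_integral_cong) (auto simp: indicator_def mem_E_iff)
    then show ?thesis using True by simp
  next
    case False
    then have "(\<integral>\<^sup>+n. indicator (E n) x * u x * G n \<partial>count_space UNIV) = (\<integral>\<^sup>+(n::int). 0 \<partial>count_space UNIV)"
      by (intro nn_integral_cong) (auto simp: indicator_def mem_E_iff)
    then show ?thesis using False by simp
  qed
  have "(\<integral>\<^sup>+x. u x * (if 0 < V x then G (lv x) else 0) \<partial>HL) =
    (\<integral>\<^sup>+n. \<integral>\<^sup>+x. indicator (E n) x * u x * G n \<partial>HL \<partial>count_space UNIV)"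
    unfolding pt by (rule nn_integral_count_space_nn_integral) auto
  also have "\<dots> = (\<integral>\<^sup>+n. weight n * G n \<partial>count_space UNIV)"
    unfolding weight_def by (intro nn_integral_cong nn_integral_multc) auto
  finally show ?thesis .
qed

end

subsection \<open>Reformulation of the constants\<close>

text \<open>No measurability of f is assumed: a simple minorant of c f, divided by c, is a simple
  minorant of f. It is applied to integrands containing \<open>T f\<close>.\<close>

lemma nn_integral_cmult_le:
  assumes c: "0 < c"
  shows "(\<integral>\<^sup>+x. ennreal c * f x \<partial>M) \<le> ennreal c * (\<integral>\<^sup>+x. f x \<partial>M)"
proof -
  have "integral\<^sup>S M g \<le> ennreal c * (\<integral>\<^sup>+x. f x \<partial>M)"
    if g: "simple_function M g" "g \<le> (\<lambda>x. ennreal c * f x)" for g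
  proof -
    have "(\<integral>\<^sup>+x. ennreal (1 / c) * g x \<partial>M) \<le> (\<integral>\<^sup>+x. f x \<partial>M)"
    proof (rule nn_integral_mono)
      fix x
      have "ennreal (1 / c) * g x \<le> ennreal (1 / c) * (ennreal c * f x)"
        using g(2) by (intro mult_left_mono) (auto simp: le_fun_def)
      then show "ennreal (1 / c) * g x \<le> f x"
        using c by (simp add: mult.assoc[symmetric] flip: ennreal_mult)
    qed
    then have "ennreal c * (ennreal (1 / c) * (\<integral>\<^sup>+x. g x \<partial>M)) \<le> ennreal c * (\<integral>\<^sup>+x. f x \<partial>M)"
      using g by (subst (asm) nn_integral_cmult) (auto intro: mult_left_mono borel_measurable_simple_function)
    then show ?thesis
      using c g by (simp add: mult.assoc[symmetric] nn_integral_eq_simple_integral flip: ennreal_mult)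
  qed
  then show ?thesis
    unfolding nn_integral_def[of M "\<lambda>x. ennreal c * f x"] by (intro SUP_least) auto
qed

text \<open>For a function \<open>h\<close> that is not measurable, the integral is a lower integral, which need not be
  subadditive; it is so if the other summand and the minorant are measurable.\<close>

lemma nn_integral_add_le:
  assumes [measurable]: "b \<in> borel_measurable M" "g \<in> borel_measurable M"
    and le: "AE x in M. b x \<le> g x + h x"
  shows "(\<integral>\<^sup>+x. b x \<partial>M) \<le> (\<integral>\<^sup>+x. g x \<partial>M) + (\<integral>\<^sup>+x. h x \<partial>M)"
proof -
  \<comment> \<open>The smallest d with b <= g + d. Since infinity minus infinity is infinity in
    \<open>ennreal\<close>, the points with g x = \<infinity> must be set to 0 separately.\<close>
  define d where "d x = (if g x = \<infinity> then 0 else b x - g x)" for x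
  have [measurable]: "d \<in> borel_measurable M" unfolding d_def by measurable
  have "(\<integral>\<^sup>+x. b x \<partial>M) \<le> (\<integral>\<^sup>+x. g x + d x \<partial>M)"
    by (intro nn_integral_mono) (auto simp: d_def intro: ennreal_minus_le_iff[THEN iffD1, OF order_refl, THEN conjunct1])
  also have "\<dots> = (\<integral>\<^sup>+x. g x \<partial>M) + (\<integral>\<^sup>+x. d x \<partial>M)"
    by (rule nn_integral_add) auto
  also have "(\<integral>\<^sup>+x. d x \<partial>M) \<le> (\<integral>\<^sup>+x. h x \<partial>M)"
    using le by (intro nn_integral_mono_AE) (auto simp: d_def ennreal_minus_le_iff elim!: eventually_mono)
  finally show ?thesis by (simp add: add_left_mono)
qed

text \<open>Enumerating the integers makes the integral a supremum of finite sums; the duality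
  argument for \<open>A2\<close> controls only finite sums.\<close>

lemma nn_integral_count_space_int_le:
  fixes g :: "int \<Rightarrow> ennreal"
  assumes "\<And>F. finite F \<Longrightarrow> sum g F \<le> c"
  shows "(\<integral>\<^sup>+n. g n \<partial>count_space UNIV) \<le> c"
proof -
  have "(\<integral>\<^sup>+n. g n \<partial>count_space UNIV) = (\<integral>\<^sup>+i. g (int_decode i) \<partial>count_space UNIV)"
    by (rule nn_integral_bij_count_space[symmetric]) (rule bij_int_decode)
  also have "\<dots> = (\<Sum>i. g (int_decode i))" by (rule nn_integral_count_space_nat)
  also have "\<dots> \<le> c"
  proof (subst suminf_eq_SUP, rule SUP_least)
    fix n
    have "(\<Sum>i<n. g (int_decode i)) = sum g (int_decode ` {..<n})"
      by (subst sum.reindex) (auto intro: inj_on_subset[OF inj_int_decode])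
    then show "(\<Sum>i<n. g (int_decode i)) \<le> c" using assms by simp
  qed
  finally show ?thesis .
qed

lemma esssup_tail:
  assumes x: "0 \<le> x" and f [measurable]: "f \<in> borel_measurable HL"
  shows "esssup (lebesgue_on {x..}) f = esssup HL (\<lambda>y. indicator {x..} y * f y :: ennreal)"
proof -
  have *: "f \<in> borel_measurable (lebesgue_on {x..})"
    by (rule measurable_restrict_mono[OF f]) (use x in auto)
  have "esssup (lebesgue_on {x..}) f \<le> c \<longleftrightarrow> esssup HL (\<lambda>y. indicator {x..} y * f y) \<le> c" for c
  proof -
    have "(y \<in> {x..} \<longrightarrow> f y \<le> c) \<longleftrightarrow> (y \<in> {0..} \<longrightarrow> indicator {x..} y * f y \<le> c)" for y
      using x by (auto simp: indicator_def)
    moreover have "(AE y in lebesgue_on {x..}. f y \<le> c) \<longleftrightarrow> (AE y in lebesgue. y \<in> {x..} \<longrightarrow> f y \<le> c)"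
      by (rule AE_restrict_space_iff) simp
    moreover have "(AE y in HL. indicator {x..} y * f y \<le> c) \<longleftrightarrow>
        (AE y in lebesgue. y \<in> {0..} \<longrightarrow> indicator {x..} y * f y \<le> c)"
      by (rule AE_restrict_space_iff) simp
    ultimately have "(AE y in lebesgue_on {x..}. f y \<le> c) \<longleftrightarrow> (AE y in HL. indicator {x..} y * f y \<le> c)"
      by (simp only:)
    then show ?thesis
      by (subst esssup_le_iff[OF *], subst esssup_le_iff) auto
  qed
  then show ?thesis by (intro antisym; blast)
qed

lemma nn_integral_tail:
  "0 \<le> x \<Longrightarrow> (\<integral>\<^sup>+y\<in>{x..}. f y \<partial>lebesgue) = (\<integral>\<^sup>+y. indicator {x..} y * f y \<partial>HL)"
  for f :: "real \<Rightarrow> ennreal"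
  by (subst nn_integral_half_line[symmetric])
    (auto intro!: nn_integral_cong simp: indicator_def)

text \<open>Unifies the two cases of q: from here on \<open>T f\<close> and the weights in
  \<open>A0\<close> and \<open>A1\<close> are norms of truncated functions.\<close>

lemma Lnorm_tail:
  assumes q: "0 < q" and x: "0 \<le> x" and [measurable]: "w \<in> Mplus" "g \<in> Mplus"
  shows "(if q = \<infinity> then esssup (lebesgue_on {x..}) (\<lambda>y. w y * g y)
      else (\<integral>\<^sup>+y\<in>{x..}. w y * g y powe enn2real q \<partial>lebesgue) powe (1 / enn2real q))
    = Lnorm q w (\<lambda>y. indicator {x..} y * g y)"
  using q
proof (cases rule: exponent_cases)
  case 1
  have "esssup (lebesgue_on {x..}) (\<lambda>y. w y * g y) = Lnorm \<infinity> w (\<lambda>y. indicator {x..} y * g y)"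
    unfolding Lnorm_inf using x by (subst esssup_tail) (auto simp: mult.left_commute)
  then show ?thesis unfolding 1 by simp
next
  case (2 q')
  then show ?thesis
    by (subst nn_integral_tail[OF x]) (simp add: Lnorm_fin powe_mult mult.left_commute mult.commute)
qed

lemma T_op_eq:
  assumes "0 < q" "0 \<le> x" "w \<in> Mplus" "oinarov_kernel D k" "f \<in> Mplus"
  shows "T_op q w k f x = Lnorm q w (\<lambda>y. indicator {x..} y * kernel_op k f y)"
  unfolding T_op_def using assms by (intro Lnorm_tail kernel_op_measurable)

lemma C_T_eq:
  assumes "0 < q" "w \<in> Mplus" "oinarov_kernel D k" "0 < r"
  shows "C_T p q r u v w k = best_const (ennreal p) v (\<lambda>f.
    (\<integral>\<^sup>+x. u x * Lnorm q w (\<lambda>y. indicator {x..} y * kernel_op k f y) powe r \<partial>HL) powe (1 / r))"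
proof -
  have "Lnorm (ennreal r) u (T_op q w k f) =
    (\<integral>\<^sup>+x. u x * Lnorm q w (\<lambda>y. indicator {x..} y * kernel_op k f y) powe r \<partial>HL) powe (1 / r)"
    if "f \<in> Mplus" for f
    unfolding Lnorm_fin[OF \<open>0 < r\<close>] using assms that
    by (intro arg_cong[where f = "\<lambda>x. x powe (1 / r)"] nn_integral_cong)
       (simp add: T_op_eq mult.commute)
  then show ?thesis
    unfolding C_T_def op_norm_def by (intro antisym best_const_mono) auto
qed

lemma A0_eq:
  assumes q: "0 < q" and w: "w \<in> Mplus"
  shows "A0 p q r u v w k = best_const (ennreal p) v (\<lambda>f.
    (\<integral>\<^sup>+x. u x * Lnorm q w (indicator {x..}) powe r * kernel_op k f x powe r \<partial>HL) powe (1 / r))"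
proof -
  have "(if q = \<infinity> then esssup (lebesgue_on {x..}) w powe r
         else (\<integral>\<^sup>+y\<in>{x..}. w y \<partial>lebesgue) powe (r / enn2real q)) = Lnorm q w (indicator {x..}) powe r"
    if "0 \<le> x" for x
  proof -
    have "(\<lambda>_. 1) \<in> Mplus" by (intro MplusI) simp
    from Lnorm_tail[OF q that w this, symmetric] show ?thesis
      by (simp add: powe_powe split: if_splits)
  qed
  then show ?thesis
    unfolding A0_def nn_integral_half_line
    by (intro arg_cong[where f = "best_const (ennreal p) v"] ext
        arg_cong[where f = "\<lambda>x. x powe (1 / r)"] nn_integral_cong) (simp add: kernel_op_def)
qed

lemma A1_eq:
  assumes q: "0 < q" and w: "w \<in> Mplus" and k: "oinarov_kernel D k"
  shows "A1 p q r u v w k = best_const (ennreal p) v (\<lambda>f.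
    (\<integral>\<^sup>+x. u x * Lnorm q w (\<lambda>y. indicator {x..} y * k y x) powe r
      * (\<integral>\<^sup>+z\<in>{0..x}. f z \<partial>lebesgue) powe r \<partial>HL) powe (1 / r))"
proof -
  have "(if q = \<infinity> then esssup (lebesgue_on {x..}) (\<lambda>y. w y * k y x) powe r
         else (\<integral>\<^sup>+z\<in>{x..}. k z x powe enn2real q * w z \<partial>lebesgue) powe (r / enn2real q))
      = Lnorm q w (\<lambda>y. indicator {x..} y * k y x) powe r"
    if "0 \<le> x" for x
  proof -
    have "(\<lambda>y. k y x) \<in> Mplus" by (intro MplusI kernel_section2[OF k] that)
    from Lnorm_tail[OF q that w this, symmetric] show ?thesis
      by (simp add: powe_powe mult.commute split: if_splits)
  qed
  then show ?thesis
    unfolding A1_def nn_integral_half_line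
    by (intro arg_cong[where f = "best_const (ennreal p) v"] ext
        arg_cong[where f = "\<lambda>x. x powe (1 / r)"] nn_integral_cong) simp
qed

lemma kernel_op_Icc:
  assumes "0 \<le> a"
  shows "(\<integral>\<^sup>+z\<in>{a..y}. k y z * f z \<partial>lebesgue) = kernel_op k (\<lambda>z. indicator {a..} z * f z) y"
  unfolding kernel_op_def by (intro nn_integral_cong) (use assms in \<open>auto simp: indicator_def\<close>)

lemma H_tail_eq: "H_tail k c f = (\<lambda>y. indicator {c..} y * kernel_op k f y)"
  by (auto simp: H_tail_def kernel_op_def)

lemma H_block_eq:
  assumes "0 \<le> sigma_inv u c"
  shows "H_block u k c d f y = indicator {y. c \<le> y \<and> ennreal y < d} y
    * kernel_op k (\<lambda>z. indicator {sigma_inv u c..} z * f z) y"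
  unfolding H_block_def using assms by (simp add: kernel_op_Icc)

lemma H_tail_measurable:
  assumes "oinarov_kernel D k" "0 \<le> c" "f \<in> Mplus"
  shows "H_tail k c f \<in> Mplus"
proof -
  have [measurable]: "kernel_op k f \<in> borel_measurable HL"
    using assms kernel_op_measurable MplusD by blast
  show ?thesis unfolding H_tail_eq by (intro MplusI) measurable
qed

lemma H_block_measurable:
  assumes k: "oinarov_kernel D k" and c: "0 \<le> sigma_inv u c" and f: "f \<in> Mplus"
  shows "H_block u k c d f \<in> Mplus"
proof -
  have "(\<lambda>z. indicator {sigma_inv u c..} z * f z) \<in> Mplus"
    using f by (auto intro!: MplusI dest!: MplusD)
  then have [measurable]: "kernel_op k (\<lambda>z. indicator {sigma_inv u c..} z * f z) \<in> borel_measurable HL"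
    using k kernel_op_measurable MplusD by blast
  have "{y. c \<le> y \<and> ennreal y < d} \<in> sets borel" by measurable
  then have "(indicator {y. c \<le> y \<and> ennreal y < d} :: real \<Rightarrow> ennreal) \<in> borel_measurable HL"
    by (intro half_line_borel) auto
  then show ?thesis
    unfolding H_block_eq[OF c, abs_def] by (intro MplusI borel_measurable_times_ennreal) auto
qed

subsection \<open>Lower bounds\<close>

locale oinarov_setting = locally_integrable_weight u for u :: "real \<Rightarrow> ennreal" +
  fixes p r D :: real and q :: ennreal and v w :: "real \<Rightarrow> ennreal" and k :: "real \<Rightarrow> real \<Rightarrow> ennreal"
  assumes p: "1 \<le> p" and r: "0 < r" and q: "0 < q"
    and v [measurable]: "v \<in> Mplus" and w [measurable]: "w \<in> Mplus" and k: "oinarov_kernel D k"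
begin

abbreviation "K \<equiv> kernel_op k"
abbreviation "N \<equiv> Lnorm q w"
abbreviation "nrm \<equiv> Lnorm (ennreal p) v"
abbreviation "CT \<equiv> C_T p q r u v w k"
abbreviation "T \<equiv> \<lambda>f x. N (\<lambda>y. indicator {x..} y * K f y)"

lemma p_pos: "0 < p" using p by simp

lemma D: "1 \<le> D" by (rule oinarov_D[OF k])

lemma K_meas [measurable]: "f \<in> Mplus \<Longrightarrow> K f \<in> borel_measurable HL"
  using kernel_op_measurable[OF k] MplusD by blast

lemma indicator_K_Mplus: "f \<in> Mplus \<Longrightarrow> A \<in> sets HL \<Longrightarrow> (\<lambda>y. indicator A y * K f y) \<in> Mplus"
  by (rule MplusI) (intro borel_measurable_times_ennreal borel_measurable_indicator K_meas)

lemma indicator_Mplus: "f \<in> Mplus \<Longrightarrow> A \<in> sets HL \<Longrightarrow> (\<lambda>y. indicator A y * f y) \<in> Mplus"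
  by (intro MplusI borel_measurable_times_ennreal borel_measurable_indicator) (auto simp: Mplus_def)

lemma CT_leD:
  assumes "CT \<le> ennreal S" "f \<in> Mplus" "nrm f < \<infinity>"
  shows "(\<integral>\<^sup>+x. u x * T f x powe r \<partial>HL) \<le> (ennreal S * nrm f) powe r"
  using best_const_leD[OF assms(1)[unfolded C_T_eq[OF q w k r]] assms(2,3)] r
  by (simp add: powe_inverse_le_iff)

text \<open>Passes from a pointwise minorant of \<open>T f\<close> to a bound for a best constant; F
  need not be measurable.\<close>

lemma integral_bound_imp:
  assumes le: "\<And>x. 0 \<le> x \<Longrightarrow> F x \<le> ennreal c * T f x" and c: "0 < c"
    and S: "CT \<le> ennreal S" "f \<in> Mplus" "nrm f < \<infinity>" "0 < S"
  shows "(\<integral>\<^sup>+x. u x * F x powe r \<partial>HL) powe (1 / r) \<le> ennreal (c * S) * nrm f"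
proof -
  have "(\<integral>\<^sup>+x. u x * F x powe r \<partial>HL) \<le> (\<integral>\<^sup>+x. ennreal (c powr r) * (u x * T f x powe r) \<partial>HL)"
  proof (rule nn_integral_mono)
    fix x assume "x \<in> space HL"
    then have "F x powe r \<le> (ennreal c * T f x) powe r"
      using le r by (intro powe_mono) auto
    then have "u x * F x powe r \<le> u x * (ennreal c * T f x) powe r"
      by (rule mult_left_mono) simp
    then show "u x * F x powe r \<le> ennreal (c powr r) * (u x * T f x powe r)"
      using r c by (simp add: powe_mult powe_ennreal mult_ac)
  qed
  also have "\<dots> \<le> ennreal (c powr r) * (\<integral>\<^sup>+x. u x * T f x powe r \<partial>HL)"
    using c by (intro nn_integral_cmult_le) simp
  also have "\<dots> \<le> ennreal (c powr r) * (ennreal S * nrm f) powe r"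
    by (intro mult_left_mono CT_leD S) simp
  also have "\<dots> = (ennreal (c * S) * nrm f) powe r"
    using r c S by (simp add: powe_mult powe_ennreal ennreal_mult mult.assoc powr_mult)
  finally show ?thesis using r by (simp add: powe_inverse_le_iff)
qed

text \<open>In \<open>T f x\<close> the factor \<open>K f y\<close> is frozen at the left end y = x,
  at the cost of D.\<close>

lemma A0_le:
  assumes S: "CT \<le> ennreal S" "0 < S"
  shows "A0 p q r u v w k \<le> ennreal (D * S)"
  unfolding A0_eq[OF q w]
proof (rule best_const_leI)
  fix f assume f: "f \<in> Mplus" "nrm f < \<infinity>"
  have "N (indicator {x..}) * K f x \<le> ennreal D * T f x" if "0 \<le> x" for x
  proof -
    have "N (indicator {x..}) * K f x = N (\<lambda>y. K f x * indicator {x..} y)"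
      by (subst Lnorm_cmult[OF q]) (auto intro!: MplusI simp: mult.commute)
    also have "\<dots> \<le> N (\<lambda>y. ennreal D * (indicator {x..} y * K f y))"
    proof (rule Lnorm_le_Lnorm[OF q w])
      show "(\<lambda>y. K f x * indicator {x..} y) \<in> Mplus" by (intro MplusI) measurable
      fix y show "K f x * indicator {x..} y \<le> ennreal D * (indicator {x..} y * K f y)"
        using kernel_op_le_later(1)[OF k f(1) that] by (simp add: indicator_def)
    qed
    also have "\<dots> = ennreal D * T f x"
      using that f by (intro Lnorm_cmult q w indicator_K_Mplus) auto
    finally show ?thesis .
  qed
  then have "(\<integral>\<^sup>+x. u x * (N (indicator {x..}) * K f x) powe r \<partial>HL) powe (1 / r) \<le> ennreal (D * S) * nrm f"
    using D S f by (intro integral_bound_imp) auto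
  then show "(\<integral>\<^sup>+x. u x * N (indicator {x..}) powe r * K f x powe r \<partial>HL) powe (1 / r)
      \<le> ennreal (D * S) * nrm f"
    using r by (simp add: powe_mult mult.assoc)
qed (use D S in auto)

text \<open>Here it is the second argument of the kernel that is frozen at x, which leaves the plain
  integral of f.\<close>

lemma A1_le:
  assumes S: "CT \<le> ennreal S" "0 < S"
  shows "A1 p q r u v w k \<le> ennreal (D * S)"
  unfolding A1_eq[OF q w k]
proof (rule best_const_leI)
  fix f assume f: "f \<in> Mplus" "nrm f < \<infinity>"
  have "N (\<lambda>y. indicator {x..} y * k y x) * (\<integral>\<^sup>+z\<in>{0..x}. f z \<partial>lebesgue) \<le> ennreal D * T f x" if "0 \<le> x" for x
  proof -
    let ?c = "\<integral>\<^sup>+z\<in>{0..x}. f z \<partial>lebesgue"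
    have [measurable]: "(\<lambda>y. k y x) \<in> borel_measurable HL" by (rule kernel_section2[OF k that])
    have m: "(\<lambda>y. indicator {x..} y * k y x) \<in> Mplus"
      by (intro MplusI) measurable
    have "N (\<lambda>y. indicator {x..} y * k y x) * ?c = N (\<lambda>y. ?c * (indicator {x..} y * k y x))"
      by (subst Lnorm_cmult[OF q w m]) (rule mult.commute)
    also have "\<dots> \<le> N (\<lambda>y. ennreal D * (indicator {x..} y * K f y))"
      using kernel_op_le_later(2)[OF k f(1) that] m
      by (intro Lnorm_le_Lnorm q w) (auto intro!: MplusI dest!: MplusD simp: indicator_def mult.commute)
    also have "\<dots> = ennreal D * T f x"
      using that f by (intro Lnorm_cmult q w indicator_K_Mplus) auto
    finally show ?thesis .
  qed
  then have "(\<integral>\<^sup>+x. u x * (N (\<lambda>y. indicator {x..} y * k y x) * (\<integral>\<^sup>+z\<in>{0..x}. f z \<partial>lebesgue)) powe r \<partial>HL) powe (1 / r)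
      \<le> ennreal (D * S) * nrm f"
    using D S f by (intro integral_bound_imp) auto
  then show "(\<integral>\<^sup>+x. u x * N (\<lambda>y. indicator {x..} y * k y x) powe r
      * (\<integral>\<^sup>+z\<in>{0..x}. f z \<partial>lebesgue) powe r \<partial>HL) powe (1 / r) \<le> ennreal (D * S) * nrm f"
    using r by (simp add: powe_mult mult.assoc)
qed (use D S in auto)

text \<open>On all of \<open>{0..t}\<close> the function \<open>T f\<close> is at least the norm of
  the tail from t, and \<open>u\<close> has mass \<open>V t\<close> there. If this mass is 0, the
  convention that 0 times infinity is 0 gives the claim.\<close>

lemma tail_bound:
  assumes S: "CT \<le> ennreal S" "0 < S" and t: "0 < t"
  shows "primitive u t powe (1 / r) * op_norm (ennreal p) v q w (H_tail k t) \<le> ennreal S"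
proof (cases "V t = 0")
  case False
  define c where "c = V t powr (1 / r)"
  have c: "0 < c" "primitive u t powe (1 / r) = ennreal c"
    using False V_nonneg[of t] by (auto simp: c_def primitive_V powe_ennreal)
  have "op_norm (ennreal p) v q w (H_tail k t) \<le> ennreal (S / c)"
    unfolding op_norm_def
  proof (rule best_const_leI)
    fix f assume f: "f \<in> Mplus" "nrm f < \<infinity>"
    have le: "N (H_tail k t f) \<le> T f x" if "0 \<le> x" "x \<le> t" for x
      unfolding H_tail_eq using that f
      by (intro Lnorm_le_Lnorm q w indicator_K_Mplus) (auto simp: indicator_def)
    have "primitive u t * N (H_tail k t f) powe r = (\<integral>\<^sup>+x. u x * indicator {0..t} x * N (H_tail k t f) powe r \<partial>HL)"
      unfolding primitive_def nn_integral_Icc_half_line[OF order_refl]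
      by (rule nn_integral_multc[symmetric]) measurable
    also have "\<dots> \<le> (\<integral>\<^sup>+x. u x * T f x powe r \<partial>HL)"
      using le r by (intro nn_integral_mono) (auto simp: indicator_def intro!: mult_left_mono powe_mono)
    also have "\<dots> \<le> (ennreal S * nrm f) powe r" by (rule CT_leD[OF S(1) f])
    finally have "(primitive u t * N (H_tail k t f) powe r) powe (1 / r) \<le> ((ennreal S * nrm f) powe r) powe (1 / r)"
      using r by (intro powe_mono) auto
    then have "ennreal c * N (H_tail k t f) \<le> ennreal S * nrm f"
      using r by (simp add: powe_mult powe_powe c(2))
    then have "ennreal (1 / c) * (ennreal c * N (H_tail k t f)) \<le> ennreal (1 / c) * (ennreal S * nrm f)"
      by (rule mult_left_mono) simp
    then show "N (H_tail k t f) \<le> ennreal (S / c) * nrm f"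
      using c S by (simp add: mult.assoc[symmetric] flip: ennreal_mult)
  qed (use c S in auto)
  then have "ennreal c * op_norm (ennreal p) v q w (H_tail k t) \<le> ennreal c * ennreal (S / c)"
    by (rule mult_left_mono) simp
  also have "\<dots> = ennreal S" using c S by (simp flip: ennreal_mult)
  finally show ?thesis using c by simp
qed (simp add: primitive_V)

lemma A2_le_p_le_r:
  assumes S: "CT \<le> ennreal S" "0 < S" and "p \<le> r"
  shows "A2 p q r u v w k \<le> ennreal S"
  unfolding A2_def using assms by (auto intro!: SUP_least tail_bound)

section \<open>Discrete duality for r < p\<close>

lemma best_const_approx:
  assumes fin: "best_const (ennreal p) v \<Phi> < \<infinity>"
    and hom: "\<And>c f. f \<in> Mplus \<Longrightarrow> 0 < c \<Longrightarrow> ennreal c * \<Phi> f \<le> \<Phi> (\<lambda>x. ennreal c * f x)"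
  shows "\<exists>f\<in>Mplus. nrm f \<le> 1 \<and> ennreal (1 / 2) * best_const (ennreal p) v \<Phi> \<le> \<Phi> f"
proof (cases "best_const (ennreal p) v \<Phi> = 0")
  case True
  have "nrm (\<lambda>x. 0) = 0" using p_pos by (simp add: Lnorm_fin)
  then show ?thesis
    unfolding True by (intro bexI[of _ "\<lambda>x. 0"]) (auto intro: MplusI)
next
  case False
  obtain b where b: "best_const (ennreal p) v \<Phi> = ennreal b" "0 < b"
    using fin False by (cases "best_const (ennreal p) v \<Phi>") auto
  \<comment> \<open>Half of a finite positive best constant is not admissible, so some f violates
    it. That f has positive norm, since by \<open>best_const_bound\<close> norm 0 would make both
    sides 0; hence it can be normalised.\<close>
  have "\<not> best_const (ennreal p) v \<Phi> \<le> ennreal (b / 2)"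
    using b by (simp add: ennreal_le_iff)
  then obtain f where f: "f \<in> Mplus" "nrm f < \<infinity>" "\<not> \<Phi> f \<le> ennreal (b / 2) * nrm f"
    using best_const_leI[of "ennreal (b / 2)" "ennreal p" v \<Phi>] b by auto
  have "\<Phi> f \<le> best_const (ennreal p) v \<Phi> * nrm f"
    by (rule best_const_bound[OF f(1,2) fin])
  then have "nrm f \<noteq> 0" using f(3) by auto
  then obtain l where l: "nrm f = ennreal l" "0 < l"
    using f(2) by (cases "nrm f") auto
  define g where "g x = ennreal (1 / l) * f x" for x
  have "nrm g = ennreal (1 / l) * nrm f"
    unfolding g_def using p_pos f by (intro Lnorm_cmult v) auto
  then have "nrm g = 1" using l by (simp flip: ennreal_mult)
  moreover have "ennreal (1 / l) * (ennreal (b / 2) * nrm f) \<le> ennreal (1 / l) * \<Phi> f"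
    using f(3) by (intro mult_left_mono) auto
  then have "ennreal (b / 2) \<le> ennreal (1 / l) * \<Phi> f"
    using l b by (simp flip: ennreal_mult)
  then have "ennreal (1 / 2) * ennreal b \<le> \<Phi> g"
  proof -
    have "ennreal (1 / 2) * ennreal b = ennreal (b / 2)"
      using b by (subst ennreal_mult[symmetric]) auto
    also note \<open>ennreal (b / 2) \<le> ennreal (1 / l) * \<Phi> f\<close>
    also have "ennreal (1 / l) * \<Phi> f \<le> \<Phi> g"
      unfolding g_def using l by (intro hom f) simp
    finally show ?thesis .
  qed
  moreover have "g \<in> Mplus" unfolding g_def using f by (auto intro!: MplusI dest!: MplusD)
  ultimately show ?thesis unfolding b(1) by (intro bexI[of _ g]) auto
qed

lemma H_tail_hom:
  assumes "f \<in> Mplus" "0 \<le> t" "0 < q"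
  shows "N (H_tail k t (\<lambda>x. c * f x)) = c * N (H_tail k t f)"
proof -
  have [measurable]: "f \<in> borel_measurable HL" using assms by (intro MplusD)
  have cf: "(\<lambda>x. c * f x) \<in> Mplus" by (intro MplusI) measurable
  have "(\<lambda>y. indicator {t..} y * K f y) \<in> Mplus"
    using assms by (intro indicator_K_Mplus) auto
  then have "(\<lambda>y. c * (indicator {t..} y * K f y)) \<in> Mplus"
    by (auto simp: Mplus_def)
  moreover have "(\<lambda>y. indicator {t..} y * K (\<lambda>x. c * f x) y) \<in> Mplus"
    using assms by (intro indicator_K_Mplus cf) auto
  moreover have "indicator {t..} y * K (\<lambda>x. c * f x) y = c * (indicator {t..} y * K f y)" if "0 \<le> y" for y
    using that assms by (simp add: kernel_op_cmult[OF k] mult_ac)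
  ultimately have "N (H_tail k t (\<lambda>x. c * f x)) = N (\<lambda>y. c * (indicator {t..} y * K f y))"
    unfolding H_tail_eq by (intro antisym Lnorm_le_Lnorm q w) auto
  also have "\<dots> = c * N (H_tail k t f)"
    unfolding H_tail_eq using assms by (intro Lnorm_cmult q w indicator_K_Mplus) auto
  finally show ?thesis .
qed

lemma s_exp:
  assumes "r < p"
  defines "s \<equiv> s_exp p r"
  shows s_pos: "0 < s" and inverse_s: "1 / s = 1 / r - 1 / p" and r_less_s: "r < s"
proof -
  have pos: "0 < 1 / r - 1 / p" using assms(1) r p_pos by (simp add: field_simps)
  then have s: "s = 1 / (1 / r - 1 / p)" by (simp add: s_def s_exp_def)
  then show "0 < s" "1 / s = 1 / r - 1 / p" using pos by auto
  have "1 / s < 1 / r" using \<open>1 / s = _\<close> p_pos by simp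
  then show "r < s" using r \<open>0 < s\<close> by (simp add: field_simps)
qed

text \<open>Discrete duality: the test function \<open>SUP m\<in>F. a m * f m\<close> combines near-extremals of the tails.
  A supremum instead of a sum makes the estimate of its norm immediate.\<close>

lemma finite_tail_sum_le:
  assumes S: "CT \<le> ennreal S" "0 < S" and rp: "r < p"
    and F: "finite F" "\<And>m. m \<in> F \<Longrightarrow> \<exists>b. lam m \<le> V b"
  defines "s \<equiv> s_exp p r"
  defines "\<kappa> \<equiv> (sqrt 2 - 1) / sqrt 2 * (1 / 2) powr r"
  shows "(\<Sum>m\<in>F. ennreal (lam m powr (s / r)) * op_norm (ennreal p) v q w (H_tail k (lev (lam m))) powe s)
    \<le> ennreal ((1 / \<kappa>) powr (s / r) * S powr s)"
proof -
  note s = s_exp[OF rp, folded s_def]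
  \<comment> \<open>The factor \<open>(sqrt 2 - 1) / sqrt 2\<close> in \<kappa> is the lower bound
    for the mass of level m - 1 divided by \<open>lam m\<close>; the factor
    \<open>(1 / 2) powr r\<close> is the loss of near-extremality.\<close>
  have \<kappa>: "0 < \<kappa>" by (simp add: \<kappa>_def)
  define t where "t m = lev (lam m)" for m
  have t: "0 < t m" "V (t m) = lam m" "\<And>y. t m \<le> y \<longleftrightarrow> lam m \<le> V y" if "m \<in> F" for m
    using F(2)[OF that] lev[OF lam_pos(1)[of m]] by (auto simp: t_def)
  define h where "h m = op_norm (ennreal p) v q w (H_tail k (t m))" for m
  have hfin: "h m < \<infinity>" if "m \<in> F" for m
  proof -
    have "ennreal (lam m powr (1 / r)) * h m \<le> ennreal S"
      using tail_bound[OF S t(1)[OF that]] t(2)[OF that] by (simp add: h_def primitive_V powe_ennreal)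
    then show ?thesis
      by (cases "h m") (auto simp: ennreal_mult_top top_unique)
  qed
  define \<eta> where "\<eta> m = enn2real (h m)" for m
  have \<eta>: "h m = ennreal (\<eta> m)" "0 \<le> \<eta> m" if "m \<in> F" for m
    using hfin[OF that] by (auto simp: \<eta>_def)
  have "\<exists>f\<in>Mplus. nrm f \<le> 1 \<and> ennreal (1 / 2) * h m \<le> N (H_tail k (t m) f)" if "m \<in> F" for m
    unfolding h_def op_norm_def
    by (rule best_const_approx) (use hfin[OF that] t[OF that] q in \<open>auto simp: h_def op_norm_def H_tail_hom\<close>)
  then obtain f where f: "\<And>m. m \<in> F \<Longrightarrow> f m \<in> Mplus" "\<And>m. m \<in> F \<Longrightarrow> nrm (f m) \<le> 1"
    "\<And>m. m \<in> F \<Longrightarrow> ennreal (1 / 2) * h m \<le> N (H_tail k (t m) (f m))"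
    by metis
  \<comment> \<open>The case of equality in Hoelder's inequality: with
    \<open>a m = \<beta> m powr (1 / p)\<close> the norm of g is at most
    \<open>B powr (1 / p)\<close>, while \<open>lam m * (a m * \<eta> m) powr r\<close> is again
    \<open>\<beta> m\<close>.\<close>
  define \<beta> where "\<beta> m = lam m powr (s / r) * \<eta> m powr s" for m
  define a where "a m = \<beta> m powr (1 / p)" for m
  define B where "B = (\<Sum>m\<in>F. \<beta> m)"
  have \<beta>: "0 \<le> \<beta> m" for m by (simp add: \<beta>_def)
  have a: "0 \<le> a m" for m by (simp add: a_def)
  have B: "0 \<le> B" unfolding B_def by (intro sum_nonneg \<beta>)
  define g where "g z = (SUP m\<in>F. ennreal (a m) * f m z)" for z
  have g [measurable]: "g \<in> Mplus"
    unfolding g_def using f F(1)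
    by (intro MplusI borel_measurable_SUP) (auto intro: countable_finite dest!: MplusD)
  have "nrm g \<le> ennreal (B powr (1 / p))"
  proof -
    have "(\<integral>\<^sup>+z. g z powe p * v z \<partial>HL) \<le> (\<integral>\<^sup>+z. (\<Sum>m\<in>F. ennreal (\<beta> m) * (f m z powe p * v z)) \<partial>HL)"
    proof (rule nn_integral_mono)
      fix z
      have "g z \<le> (\<Sum>m\<in>F. (ennreal (a m) * f m z) powe p) powe (1 / p)"
        unfolding g_def
      proof (rule SUP_least)
        fix m assume "m \<in> F"
        then have "(ennreal (a m) * f m z) powe p \<le> (\<Sum>m\<in>F. (ennreal (a m) * f m z) powe p)"
          using F(1) by (intro member_le_sum) auto
        then have "((ennreal (a m) * f m z) powe p) powe (1 / p) \<le> (\<Sum>m\<in>F. (ennreal (a m) * f m z) powe p) powe (1 / p)"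
          using p by (intro powe_mono) auto
        then show "ennreal (a m) * f m z \<le> (\<Sum>m\<in>F. (ennreal (a m) * f m z) powe p) powe (1 / p)"
          using p by (simp add: powe_powe)
      qed
      then have "g z powe p \<le> ((\<Sum>m\<in>F. (ennreal (a m) * f m z) powe p) powe (1 / p)) powe p"
        using p by (intro powe_mono) auto
      then have "g z powe p \<le> (\<Sum>m\<in>F. ennreal (\<beta> m) * f m z powe p)"
        using p \<beta> a by (simp add: powe_powe powe_mult powe_ennreal a_def powr_powr)
      then have "g z powe p * v z \<le> (\<Sum>m\<in>F. ennreal (\<beta> m) * f m z powe p) * v z"
        by (rule mult_right_mono) simp
      then show "g z powe p * v z \<le> (\<Sum>m\<in>F. ennreal (\<beta> m) * (f m z powe p * v z))"
        by (simp add: sum_distrib_right mult.assoc)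
    qed
    also have "\<dots> = (\<Sum>m\<in>F. ennreal (\<beta> m) * (\<integral>\<^sup>+z. f m z powe p * v z \<partial>HL))"
      using f(1) by (subst nn_integral_sum) (auto intro!: sum.cong nn_integral_cmult dest!: MplusD)
    also have "\<dots> \<le> (\<Sum>m\<in>F. ennreal (\<beta> m) * 1)"
      using f(2) p_pos by (intro sum_mono mult_left_mono) (auto simp: Lnorm_fin_le_iff)
    also have "\<dots> = ennreal B" using \<beta> by (simp add: B_def)
    finally show ?thesis
      using p_pos B by (simp add: Lnorm_fin_le_iff powe_ennreal powr_powr)
  qed
  then have gfin: "nrm g < \<infinity>" by (rule le_less_trans) simp
  \<comment> \<open>The test takes place on \<open>E (m - 1)\<close>, to the left of
    \<open>t m\<close>: there \<open>T g\<close> dominates the m-th tail. As these levels are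
    disjoint, at most one summand is non-zero at each x.\<close>
  have "(\<Sum>m\<in>F. weight (m - 1) * ennreal ((a m * \<eta> m / 2) powr r)) =
      (\<integral>\<^sup>+x. (\<Sum>m\<in>F. indicator (E (m - 1)) x * u x * ennreal ((a m * \<eta> m / 2) powr r)) \<partial>HL)"
    unfolding weight_def by (subst nn_integral_sum) (auto intro!: sum.cong nn_integral_multc[symmetric])
  also have "\<dots> \<le> (\<integral>\<^sup>+x. u x * T g x powe r \<partial>HL)"
  proof (rule nn_integral_mono)
    fix x assume "x \<in> space HL"
    have T: "ennreal ((a m * \<eta> m / 2) powr r) \<le> T g x powe r" if m: "m \<in> F" "x \<in> E (m - 1)" for m
    proof -
      have "x \<le> t m" using m t(3)[OF m(1), of x] by (auto simp: E_def)
      have "ennreal (a m * \<eta> m / 2) = ennreal (a m) * (ennreal (1 / 2) * h m)"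
        using \<eta>(2)[OF m(1)] a[of m] unfolding \<eta>(1)[OF m(1)]
        by (subst ennreal_mult[symmetric], simp, simp, subst ennreal_mult[symmetric]) auto
      also have "\<dots> \<le> ennreal (a m) * N (H_tail k (t m) (f m))"
        using f m by (intro mult_left_mono) auto
      also have "\<dots> = N (H_tail k (t m) (\<lambda>z. ennreal (a m) * f m z))"
        using f m t q by (simp add: H_tail_hom less_imp_le)
      also have "\<dots> \<le> T g x"
      proof (rule Lnorm_le_Lnorm[OF q w])
        show "H_tail k (t m) (\<lambda>z. ennreal (a m) * f m z) \<in> Mplus"
          using f m t[OF m(1)] by (intro H_tail_measurable[OF k]) (auto intro!: MplusI dest!: MplusD)
        fix y
        have "K (\<lambda>z. ennreal (a m) * f m z) y \<le> K g y"
          using m by (intro kernel_op_mono[OF k]) (auto simp: g_def intro: SUP_upper)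
        then show "H_tail k (t m) (\<lambda>z. ennreal (a m) * f m z) y \<le> indicator {x..} y * K g y"
          using \<open>x \<le> t m\<close> by (auto simp: H_tail_eq indicator_def)
      qed
      finally have "ennreal (a m * \<eta> m / 2) powe r \<le> T g x powe r" using r by (intro powe_mono) auto
      then show ?thesis using a \<eta> m by (simp add: powe_ennreal)
    qed
    show "(\<Sum>m\<in>F. indicator (E (m - 1)) x * u x * ennreal ((a m * \<eta> m / 2) powr r)) \<le> u x * T g x powe r"
    proof (cases "\<exists>m\<in>F. x \<in> E (m - 1)")
      case True
      then obtain m where m: "m \<in> F" "x \<in> E (m - 1)" by blast
      have "(\<Sum>m\<in>F. indicator (E (m - 1)) x * u x * ennreal ((a m * \<eta> m / 2) powr r)) =
        (\<Sum>m\<in>{m}. indicator (E (m - 1)) x * u x * ennreal ((a m * \<eta> m / 2) powr r))"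
        using m F(1) E_disjoint[OF m(2)] by (intro sum.mono_neutral_right) (fastforce simp: indicator_def)+
      then show ?thesis using T[OF m] m by (simp add: mult_left_mono)
    next
      case False
      then show ?thesis by (simp add: indicator_def)
    qed
  qed
  also have "\<dots> \<le> (ennreal S * nrm g) powe r" by (rule CT_leD[OF S(1) g gfin])
  also have "\<dots> \<le> (ennreal S * ennreal (B powr (1 / p))) powe r"
    using r \<open>nrm g \<le> _\<close> by (intro powe_mono mult_left_mono) auto
  also have "\<dots> = ennreal (S powr r * B powr (r / p))"
    using S B by (simp add: powe_ennreal powr_mult powr_powr flip: ennreal_mult)
  finally have le: "(\<Sum>m\<in>F. weight (m - 1) * ennreal ((a m * \<eta> m / 2) powr r)) \<le> ennreal (S powr r * B powr (r / p))" .
  have "\<kappa> * \<beta> m = (sqrt 2 - 1) * lam (m - 1) * (a m * \<eta> m / 2) powr r" if "m \<in> F" for m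
  proof (cases "\<eta> m = 0")
    case True
    then show ?thesis by (simp add: \<beta>_def s)
  next
    case False
    then have e: "0 < \<eta> m" using \<eta>[OF that] by simp
    have rs: "r / s + r / p = 1" "1 / s = 1 / r - 1 / p" using s r p_pos by (auto simp: field_simps)
    have "s / r = 1 + s / p" using s r p_pos by (simp add: field_simps)
    have b1: "\<beta> m = lam m * \<eta> m powr r * \<beta> m powr (r / p)"
    proof -
      have "s / r * (r / p) = s / p" using r by simp
      then have e1: "s / r * (r / p) = s / r - 1" using \<open>s / r = 1 + s / p\<close> by linarith
      have e2: "s * (r / p) = s - r" using rs(1) s(1) by (simp add: field_simps)
      have "\<beta> m powr (r / p) = lam m powr (s / r * (r / p)) * \<eta> m powr (s * (r / p))"
        by (simp add: \<beta>_def powr_mult powr_powr)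
      also have "\<dots> = (lam m powr (s / r) / lam m) * (\<eta> m powr s / \<eta> m powr r)"
        unfolding e1 e2 by (simp add: powr_diff)
      finally show ?thesis using e by (simp add: \<beta>_def)
    qed
    have b2: "(a m * \<eta> m / 2) powr r = \<beta> m powr (r / p) * \<eta> m powr r * (1 / 2) powr r"
      using e by (simp add: a_def powr_mult powr_powr powr_divide)
    have "\<kappa> * \<beta> m = \<kappa> * (lam m * \<eta> m powr r * \<beta> m powr (r / p))"
      using b1 by (rule arg_cong)
    also have "lam m = sqrt 2 * lam (m - 1)" using lam_Suc[of "m - 1"] by simp
    finally show ?thesis unfolding b2 by (simp add: \<kappa>_def)
  qed
  then have "ennreal (\<kappa> * B) = (\<Sum>m\<in>F. ennreal ((sqrt 2 - 1) * lam (m - 1)) * ennreal ((a m * \<eta> m / 2) powr r))"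
    using \<beta> \<kappa> unfolding B_def sum_distrib_left
    by (subst sum_ennreal[symmetric]) (auto intro!: sum.cong simp: ennreal_mult)
  also have "\<dots> \<le> (\<Sum>m\<in>F. weight (m - 1) * ennreal ((a m * \<eta> m / 2) powr r))"
    using F(2) by (intro sum_mono mult_right_mono) (auto intro: weight_ge[of "m - 1" for m, simplified])
  also note le
  finally have kB: "\<kappa> * B \<le> S powr r * B powr (r / p)"
    by (simp add: ennreal_le_iff)
  \<comment> \<open>B is finite because F is, so \<open>B powr (r / p)\<close> may be cancelled;
    what remains is \<open>B powr (r / s)\<close>.\<close>
  have "B \<le> (1 / \<kappa>) powr (s / r) * S powr s"
  proof (cases "B = 0")
    case False
    then have B0: "0 < B" using B by simp
    have "r / p + r / s = 1" using s r p_pos by (simp add: field_simps)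
    then have "B = B powr (r / p) * B powr (r / s)" using B0 by (simp flip: powr_add)
    with kB have "\<kappa> * B powr (r / s) * B powr (r / p) \<le> S powr r * B powr (r / p)"
      by (simp add: mult_ac)
    then have "\<kappa> * B powr (r / s) \<le> S powr r"
      using B0 by simp
    then have "B powr (r / s) \<le> 1 / \<kappa> * S powr r"
      using \<kappa> by (simp add: field_simps)
    then have "(B powr (r / s)) powr (s / r) \<le> (1 / \<kappa> * S powr r) powr (s / r)"
      using s r by (intro powr_mono2) auto
    moreover have "(1 / \<kappa> * S powr r) powr (s / r) = (1 / \<kappa>) powr (s / r) * S powr s"
      using s(1) r by (subst powr_mult) (simp add: powr_powr)
    moreover have "(B powr (r / s)) powr (s / r) = B"
      using s(1) r B0 by (simp add: powr_powr)
    ultimately show ?thesis by simp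
  qed simp
  moreover have "(\<Sum>m\<in>F. ennreal (lam m powr (s / r)) * h m powe s) = ennreal B"
    unfolding B_def using \<beta> \<eta>
    by (subst sum_ennreal[symmetric]) (auto intro!: sum.cong simp: \<beta>_def powe_ennreal ennreal_mult)
  ultimately show ?thesis by (simp add: h_def t_def ennreal_leI)
qed

text \<open>Two levels down means half the value of \<open>V\<close>, so the block of x starts no
  earlier than level \<open>lv x - 2\<close> and is dominated by the tail from there. The integral
  thus becomes a sum over tails, to which the duality bound applies.\<close>

lemma A2_le_r_less_p:
  assumes S: "CT \<le> ennreal S" "0 < S" and rp: "r < p"
  defines "s \<equiv> s_exp p r"
  defines "\<kappa> \<equiv> (sqrt 2 - 1) / sqrt 2 * (1 / 2) powr r"
  shows "A2 p q r u v w k \<le> ennreal ((2 * sqrt 2 / \<kappa>) powr (1 / r) * S)"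
proof -
  note s = s_exp[OF rp, folded s_def]
  have \<kappa>: "0 < \<kappa>" by (simp add: \<kappa>_def)
  \<comment> \<open>For a level that is never reached, \<open>lev\<close> is the infimum of the
    empty set and carries no meaning.\<close>
  define h where "h m = (if \<exists>b. lam m \<le> V b then op_norm (ennreal p) v q w (H_tail k (lev (lam m))) else 0)" for m
  \<comment> \<open>Passing from \<open>lam (n + 1)\<close> to \<open>lam (n - 2)\<close> crosses
    three levels, that is, a factor \<open>sqrt 2 ^ 3\<close>; the exponent arises as 1 + s / p = s
    / r.\<close>
  define c where "c = (2 * sqrt 2) powr (s / r)"
  have block: "op_norm (ennreal p) v q w (H_block u k (sigma_inv u x) (sigma u x)) \<le> h (lv x - 2)" if x: "0 < V x" for x
  proof -
    let ?m = "lv x - 2"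
    have "x \<in> E (lv x)" using x by (simp add: mem_E_iff)
    then have "lam ?m \<le> V x / 2" using lam_plus_2[of ?m] by (simp add: E_def)
    then have ex: "\<exists>b. lam ?m \<le> V b" using x by (intro exI[of _ x]) simp
    note t = lev_le_iff[OF lam_pos(1)[of ?m]]
    have c: "0 < V (sigma_inv u x)" using V_sigma_inv[OF x] x by simp
    note c' = sigma_inv_pos[OF c]
    have "N (H_block u k (sigma_inv u x) (sigma u x) f) \<le> N (H_tail k (lev (lam ?m)) f)" if f: "f \<in> Mplus" for f
    proof (rule Lnorm_le_Lnorm[OF q w H_block_measurable[OF k _ f]])
      show "0 \<le> sigma_inv u (sigma_inv u x)" using c' by simp
      fix y :: real assume "0 \<le> y"
      have "K (\<lambda>z. indicator {sigma_inv u (sigma_inv u x)..} z * f z) y \<le> K f y"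
        by (intro kernel_op_mono[OF k]) (auto simp: indicator_def)
      moreover have "lev (lam ?m) \<le> y" if "sigma_inv u x \<le> y"
        using that t[of _ y] ex sigma_inv_le_iff[OF x, of y] \<open>lam ?m \<le> V x / 2\<close> by auto
      ultimately show "H_block u k (sigma_inv u x) (sigma u x) f y \<le> H_tail k (lev (lam ?m)) f y"
        using c' by (auto simp: H_block_eq H_tail_eq indicator_def)
    qed
    then have "op_norm (ennreal p) v q w (H_block u k (sigma_inv u x) (sigma u x)) \<le>
        op_norm (ennreal p) v q w (H_tail k (lev (lam ?m)))"
      unfolding op_norm_def by (rule best_const_mono)
    then show ?thesis using ex by (simp add: h_def)
  qed
  have "(\<integral>\<^sup>+x. u x * primitive u x powe (s / p) *
      op_norm (ennreal p) v q w (H_block u k (sigma_inv u x) (sigma u x)) powe s \<partial>HL) \<le>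
    (\<integral>\<^sup>+x. u x * (if 0 < V x then ennreal (lam (lv x + 1) powr (s / p)) * h (lv x - 2) powe s else 0) \<partial>HL)"
  proof (rule nn_integral_mono)
    fix x
    show "u x * primitive u x powe (s / p) *
      op_norm (ennreal p) v q w (H_block u k (sigma_inv u x) (sigma u x)) powe s \<le>
      u x * (if 0 < V x then ennreal (lam (lv x + 1) powr (s / p)) * h (lv x - 2) powe s else 0)"
    proof (cases "0 < V x")
      case True
      then have "x \<in> E (lv x)" by (simp add: mem_E_iff)
      then have "V x \<le> lam (lv x + 1)" by (simp add: E_def)
      then have "primitive u x powe (s / p) \<le> ennreal (lam (lv x + 1) powr (s / p))"
        using s p_pos by (simp add: primitive_V powe_ennreal ennreal_leI powr_mono2)
      then show ?thesis
        using block[OF True] s True by (auto simp: mult.assoc intro!: mult_mono powe_mono)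
    next
      case False
      then have "V x = 0" using V_nonneg[of x] by linarith
      then show ?thesis by (simp add: primitive_V)
    qed
  qed
  also have "\<dots> = (\<integral>\<^sup>+n. weight n * (ennreal (lam (n + 1) powr (s / p)) * h (n - 2) powe s) \<partial>count_space UNIV)"
    by (rule nn_integral_levels)
  also have "\<dots> \<le> (\<integral>\<^sup>+n. ennreal c * (ennreal (lam (n - 2) powr (s / r)) * h (n - 2) powe s) \<partial>count_space UNIV)"
  proof (rule nn_integral_mono)
    fix n
    have "1 + s / p = s / r" using s r p_pos by (simp add: field_simps)
    then have "lam (n + 1) * lam (n + 1) powr (s / p) = lam (n + 1) powr (s / r)"
      by (metis lam_pos(1) powr_add powr_one less_imp_le)
    moreover have "lam (n + 1) = 2 * sqrt 2 * lam (n - 2)"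
      using lam_plus_2[of "n - 2"] lam_Suc[of n] by simp
    then have "lam (n + 1) powr (s / r) = c * lam (n - 2) powr (s / r)"
      unfolding c_def by (simp only: powr_mult)
    ultimately have "ennreal (lam (n + 1)) * ennreal (lam (n + 1) powr (s / p)) = ennreal c * ennreal (lam (n - 2) powr (s / r))"
      by (simp add: c_def flip: ennreal_mult)
    moreover have "weight n * (ennreal (lam (n + 1) powr (s / p)) * h (n - 2) powe s) \<le>
      ennreal (lam (n + 1)) * (ennreal (lam (n + 1) powr (s / p)) * h (n - 2) powe s)"
      by (intro mult_right_mono weight_le) simp
    ultimately show "weight n * (ennreal (lam (n + 1) powr (s / p)) * h (n - 2) powe s) \<le>
      ennreal c * (ennreal (lam (n - 2) powr (s / r)) * h (n - 2) powe s)"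
      by (simp add: mult.assoc[symmetric])
  qed
  also have "\<dots> = (\<integral>\<^sup>+m. ennreal c * (ennreal (lam m powr (s / r)) * h m powe s) \<partial>count_space UNIV)"
    by (rule nn_integral_bij_count_space[where g = "\<lambda>n. n - 2"]) (rule bij_betwI[where g = "\<lambda>n. n + 2"], auto)
  also have "\<dots> \<le> ennreal (c * ((1 / \<kappa>) powr (s / r) * S powr s))"
  proof (rule nn_integral_count_space_int_le)
    fix F :: "int set" assume F: "finite F"
    let ?F = "{m\<in>F. \<exists>b. lam m \<le> V b}"
    have "(\<Sum>m\<in>F. ennreal (lam m powr (s / r)) * h m powe s) = (\<Sum>m\<in>?F. ennreal (lam m powr (s / r)) * h m powe s)"
      using F by (intro sum.mono_neutral_right) (auto simp: h_def)
    also have "\<dots> = (\<Sum>m\<in>?F. ennreal (lam m powr (s / r)) * op_norm (ennreal p) v q w (H_tail k (lev (lam m))) powe s)"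
      by (intro sum.cong) (auto simp: h_def)
    also have "\<dots> \<le> ennreal ((1 / \<kappa>) powr (s / r) * S powr s)"
      unfolding s_def \<kappa>_def by (rule finite_tail_sum_le[OF S rp]) (use F in auto)
    finally have "ennreal c * (\<Sum>m\<in>F. ennreal (lam m powr (s / r)) * h m powe s) \<le>
      ennreal c * ennreal ((1 / \<kappa>) powr (s / r) * S powr s)"
      by (rule mult_left_mono) simp
    then show "(\<Sum>m\<in>F. ennreal c * (ennreal (lam m powr (s / r)) * h m powe s)) \<le>
      ennreal (c * ((1 / \<kappa>) powr (s / r) * S powr s))"
      by (simp add: sum_distrib_left ennreal_mult c_def)
  qed
  also have "c * ((1 / \<kappa>) powr (s / r) * S powr s) = ((2 * sqrt 2 / \<kappa>) powr (1 / r) * S) powr s"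
  proof -
    have "(2 * sqrt 2 / \<kappa>) powr (s / r) = c * (1 / \<kappa>) powr (s / r)"
      using powr_mult[of "2 * sqrt 2" "1 / \<kappa>" "s / r"] by (simp add: c_def)
    then show ?thesis by (simp add: powr_mult powr_powr)
  qed
  finally have "(\<integral>\<^sup>+x. u x * primitive u x powe (s / p) *
      op_norm (ennreal p) v q w (H_block u k (sigma_inv u x) (sigma u x)) powe s \<partial>HL)
    \<le> ennreal ((2 * sqrt 2 / \<kappa>) powr (1 / r) * S) powe s"
    using S by (simp add: powe_ennreal)
  then show ?thesis
    using rp s(1) unfolding A2_def by (simp add: Let_def nn_integral_half_line powe_inverse_le_iff flip: s_def)
qed

end

subsection \<open>Upper bounds\<close>

lemma powr_mult_le_add:
  fixes x y a b :: real
  assumes "0 \<le> x" "0 \<le> y" "1 < a" "1 < b" "1 / a + 1 / b = 1"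
  shows "x * y \<le> x powr a + y powr b"
proof -
  have "x * y \<le> x powr a / a + y powr b / b"
    by (rule Youngs_inequality) (use assms in auto)
  also have "x powr a / a \<le> x powr a" using assms by (simp add: divide_le_eq mult_le_cancel_left1)
  also have "y powr b / b \<le> y powr b" using assms by (simp add: divide_le_eq mult_le_cancel_left1)
  finally show ?thesis by simp
qed

text \<open>Dominates the three coefficients produced by two applications of the quasi-triangle
  inequality in \<open>level_split\<close>, two of which carry the kernel constant.\<close>

definition split_const :: "real \<Rightarrow> real \<Rightarrow> real \<Rightarrow> real" where
  "split_const r D c = (5 / 4 + c * (5 / 4) + c * c) * D powr r"

text \<open>Product of the constants of \<open>integral_tail_le\<close>,
  \<open>level_sum_le_integral\<close> and \<open>level_split\<close>. The last factor adds 1 for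
  each of \<open>A0\<close>, \<open>A1\<close> and W, and \<open>2 * sqrt 2\<close> for the local
  norms of f.\<close>

definition upper_const :: "real \<Rightarrow> real \<Rightarrow> real \<Rightarrow> real" where
  "upper_const r D c = c * sqrt 2 / (1 - 5 / 4 / sqrt 2) * (sqrt 2 / (sqrt 2 - 1))
    * split_const r D c * (3 + 2 * sqrt 2)"

lemma five_quarters_less_sqrt_2: "(5 / 4 :: real) < sqrt 2"
  by (rule real_less_rsqrt) (simp add: power2_eq_square)

lemma split_const_pos: "0 < c \<Longrightarrow> 1 \<le> D \<Longrightarrow> 0 < split_const r D c"
  unfolding split_const_def by (intro mult_pos_pos add_pos_pos) auto

lemma upper_const_pos: "0 < c \<Longrightarrow> 1 \<le> D \<Longrightarrow> 0 < upper_const r D c"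
  unfolding upper_const_def using five_quarters_less_sqrt_2
  by (intro mult_pos_pos divide_pos_pos add_pos_pos split_const_pos) auto

text \<open>Instead of 5/4, any number between 1 and the ratio \<open>sqrt 2\<close> of the levels would do.\<close>

locale oinarov_quasi_add = oinarov_setting +
  fixes Cq :: real
  assumes Cq: "0 < Cq"
    and add_le: "\<And>g h. g \<in> Mplus \<Longrightarrow> h \<in> Mplus \<Longrightarrow>
      N (\<lambda>x. g x + h x) powe r \<le> ennreal (5 / 4) * N g powe r + ennreal Cq * N h powe r"
begin

section \<open>Reduction of tails to single levels\<close>

lemma Lnorm_zero: "N (\<lambda>x. 0) = 0"
  using Lnorm_cmult[OF q w, of "\<lambda>x. 0" 0] by (simp add: Mplus_def)

text \<open>The lowest level is split off as the second summand of \<open>add_le\<close>, so that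
  the large constant \<open>Cq\<close> falls on it once and only the factor 5/4 is iterated on the
  rest.\<close>

lemma Lnorm_levels_le:
  assumes g: "g \<in> Mplus"
  shows "N (\<lambda>y. indicator (\<Union>j<M. E (n + int j)) y * g y) powe r
    \<le> ennreal Cq * (\<Sum>j<M. ennreal ((5 / 4) ^ j) * N (\<lambda>y. indicator (E (n + int j)) y * g y) powe r)"
proof (induction M arbitrary: n)
  case 0
  show ?case by (simp add: Lnorm_zero)
next
  case (Suc M)
  let ?U = "\<Union>j<M. E (n + 1 + int j)"
  let ?b = "\<lambda>m. N (\<lambda>y. indicator (E m) y * g y) powe r"
  have U: "(\<Union>j<Suc M. E (n + int j)) = E n \<union> ?U"
    unfolding lessThan_Suc_eq_insert_0 by (auto simp: image_image add.assoc)
  have disj: "E n \<inter> ?U = {}"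
    by (auto simp: mem_E_iff)
  have "N (\<lambda>y. indicator (\<Union>j<Suc M. E (n + int j)) y * g y) =
    N (\<lambda>y. indicator ?U y * g y + indicator (E n) y * g y)"
    unfolding U using disj by (intro arg_cong[where f = N] ext) (auto simp: indicator_def)
  also have "\<dots> powe r \<le> ennreal (5 / 4) * N (\<lambda>y. indicator ?U y * g y) powe r + ennreal Cq * ?b n"
    by (intro add_le indicator_Mplus g) auto
  also have "\<dots> \<le> ennreal (5 / 4) * (ennreal Cq * (\<Sum>j<M. ennreal ((5 / 4) ^ j) * ?b (n + 1 + int j))) + ennreal Cq * ?b n"
    by (intro add_right_mono mult_left_mono Suc.IH) simp
  also have "\<dots> = ennreal Cq * (\<Sum>j<Suc M. ennreal ((5 / 4) ^ j) * ?b (n + int j))"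
  proof -
    define e where "e j = ennreal ((5 / 4) ^ j)" for j
    have "e (Suc j) = ennreal (5 / 4) * e j" for j
      unfolding e_def by (subst ennreal_mult[symmetric]) auto
    moreover have "e 0 = 1" by (simp add: e_def)
    ultimately show ?thesis
      unfolding sum.lessThan_Suc_shift e_def[symmetric]
      by (simp add: sum_distrib_left distrib_left mult_ac add_ac)
  qed
  finally show ?case .
qed

lemma Lnorm_tail_le:
  assumes g: "g \<in> Mplus" and x: "0 < V x"
  shows "N (\<lambda>y. indicator {x..} y * g y) powe r
    \<le> ennreal Cq * (\<Sum>j. ennreal ((5 / 4) ^ j) * N (\<lambda>y. indicator (E (lv x + int j)) y * g y) powe r)"
    (is "_ \<le> ?R")
proof -
  let ?U = "\<lambda>M. \<Union>j<M. E (lv x + int j)"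
  have U [measurable]: "?U M \<in> sets HL" for M by auto
  have le: "N (\<lambda>y. indicator (?U M) y * g y) \<le> ?R powe (1 / r)" for M
  proof -
    have "N (\<lambda>y. indicator (?U M) y * g y) powe r \<le> ?R"
      by (rule order_trans[OF Lnorm_levels_le[OF g]]) (auto intro!: mult_left_mono sum_le_suminf)
    then have "(N (\<lambda>y. indicator (?U M) y * g y) powe r) powe (1 / r) \<le> ?R powe (1 / r)"
      using r by (intro powe_mono) auto
    then show ?thesis using r by (simp add: powe_powe)
  qed
  have xE: "x \<in> E (lv x)" using x by (simp add: mem_E_iff)
  have "N (\<lambda>y. indicator {x..} y * g y) \<le> N (\<lambda>y. indicator (\<Union>M. ?U M) y * g y)"
  proof (rule Lnorm_le_Lnorm[OF q w indicator_Mplus[OF g]])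
    show "{x..} \<in> sets HL" using V_pos_imp_pos[OF x] by auto
    fix y
    have "y \<in> (\<Union>M. ?U M)" if "x \<le> y"
    proof -
      have V: "0 < V y" "V x \<le> V y" using V_mono[OF that] x by auto
      then have "lv x \<le> lv y" unfolding lv_def using x by (intro floor_mono) simp
      then have "lv y = lv x + int (nat (lv y - lv x))" by simp
      moreover have "y \<in> E (lv y)" using V by (simp add: mem_E_iff)
      ultimately show ?thesis by (metis UN_I UNIV_I lessI lessThan_iff)
    qed
    then show "indicator {x..} y * g y \<le> indicator (\<Union>M. ?U M) y * g y"
      by (auto simp: indicator_def)
  qed
  also have "\<dots> \<le> ?R powe (1 / r)"
    by (rule Lnorm_Union_le[OF q w g _ U le]) (auto simp: incseq_def, force)
  finally show ?thesis using r by (simp add: powe_mono powe_inverse_le_iff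
    order_trans[OF powe_mono, of _ "?R powe (1 / r)" r] powe_powe)
qed

text \<open>A discrete Hardy inequality. The mass of level n is at most \<open>lam (n + 1)\<close>,
  which is \<open>sqrt 2 / sqrt 2 ^ j\<close> times \<open>lam (n + j)\<close>; against the factor
  (5/4)^j there remains a geometric series of ratio \<theta> < 1.\<close>

lemma integral_tail_le:
  assumes f: "f \<in> Mplus"
  shows "(\<integral>\<^sup>+x. u x * T f x powe r \<partial>HL)
    \<le> ennreal (Cq * sqrt 2 / (1 - 5 / 4 / sqrt 2))
      * (\<integral>\<^sup>+m. ennreal (lam m) * N (\<lambda>y. indicator (E m) y * K f y) powe r \<partial>count_space UNIV)"
proof -
  let ?b = "\<lambda>m. N (\<lambda>y. indicator (E m) y * K f y) powe r"
  let ?X = "\<integral>\<^sup>+m. ennreal (lam m) * ?b m \<partial>count_space UNIV"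
  let ?G = "\<lambda>n. ennreal Cq * (\<Sum>j. ennreal ((5 / 4) ^ j) * ?b (n + int j))"
  define \<theta> :: real where "\<theta> = 5 / 4 / sqrt 2"
  have \<theta>: "0 < \<theta>" "\<theta> < 1"
    using five_quarters_less_sqrt_2 by (auto simp: \<theta>_def)
  have Kf: "K f \<in> Mplus" by (rule kernel_op_measurable[OF k f])
  \<comment> \<open>Points outside all levels are removed by \<open>AE_weight_zero\<close>.\<close>
  have "(\<integral>\<^sup>+x. u x * T f x powe r \<partial>HL) \<le> (\<integral>\<^sup>+x. u x * (if 0 < V x then ?G (lv x) else 0) \<partial>HL)"
  proof (rule nn_integral_mono_AE, use AE_weight_zero in eventually_elim)
    case (elim x)
    show ?case
    proof (cases "0 < V x")
      case True
      then show ?thesis using Lnorm_tail_le[OF Kf True] by (simp add: mult_left_mono)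
    next
      case False
      then have "V x = 0" using V_nonneg[of x] by linarith
      then show ?thesis using elim by simp
    qed
  qed
  also have "\<dots> = (\<integral>\<^sup>+n. weight n * ?G n \<partial>count_space UNIV)"
    by (rule nn_integral_levels)
  also have "\<dots> \<le> (\<integral>\<^sup>+n. ennreal Cq * (\<Sum>j. ennreal ((5 / 4) ^ j) * (ennreal (lam (n + 1)) * ?b (n + int j))) \<partial>count_space UNIV)"
  proof (rule nn_integral_mono)
    fix n
    have "weight n * ?G n \<le> ennreal (lam (n + 1)) * ?G n"
      by (intro mult_right_mono weight_le) simp
    also have "\<dots> = ennreal Cq * (\<Sum>j. ennreal (lam (n + 1)) * (ennreal ((5 / 4) ^ j) * ?b (n + int j)))"
      by (simp add: ennreal_suminf_cmult mult.left_commute)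
    finally show "weight n * ?G n \<le> ennreal Cq * (\<Sum>j. ennreal ((5 / 4) ^ j) * (ennreal (lam (n + 1)) * ?b (n + int j)))"
      by (simp add: mult.left_commute)
  qed
  also have "\<dots> = ennreal Cq * (\<Sum>j. ennreal ((5 / 4) ^ j) * (\<integral>\<^sup>+n. ennreal (lam (n + 1)) * ?b (n + int j) \<partial>count_space UNIV))"
    by (simp add: nn_integral_cmult nn_integral_suminf)
  also have "\<dots> = ennreal Cq * (\<Sum>j. ennreal (sqrt 2 * \<theta> ^ j) * ?X)"
  proof (intro arg_cong[where f = "\<lambda>x. ennreal Cq * x"] suminf_cong)
    fix j :: nat
    have lam: "lam (n + 1) = sqrt 2 / sqrt 2 ^ j * lam (n + int j)" for n
      by (simp add: lam_def powr_add powr_realpow)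
    have "(\<integral>\<^sup>+n. ennreal (lam (n + 1)) * ?b (n + int j) \<partial>count_space UNIV) =
      (\<integral>\<^sup>+n. ennreal (sqrt 2 / sqrt 2 ^ j) * (ennreal (lam (n + int j)) * ?b (n + int j)) \<partial>count_space UNIV)"
      by (intro nn_integral_cong, subst lam, subst ennreal_mult) (auto simp: mult.assoc)
    also have "\<dots> = (\<integral>\<^sup>+m. ennreal (sqrt 2 / sqrt 2 ^ j) * (ennreal (lam m) * ?b m) \<partial>count_space UNIV)"
      by (rule nn_integral_bij_count_space[where g = "\<lambda>n. n + int j"]) (rule bij_betwI[where g = "\<lambda>n. n - int j"], auto)
    also have "\<dots> = ennreal (sqrt 2 / sqrt 2 ^ j) * ?X" by (rule nn_integral_cmult) simp
    finally show "ennreal ((5 / 4) ^ j) * (\<integral>\<^sup>+n. ennreal (lam (n + 1)) * ?b (n + int j) \<partial>count_space UNIV) =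
      ennreal (sqrt 2 * \<theta> ^ j) * ?X"
      by (simp add: \<theta>_def power_divide mult.assoc[symmetric] mult_ac flip: ennreal_mult)
  qed
  also have "(\<Sum>j. ennreal (sqrt 2 * \<theta> ^ j) * ?X) = (\<Sum>j. ennreal (sqrt 2 * \<theta> ^ j)) * ?X"
    by (rule ennreal_suminf_multc)
  also have "(\<Sum>j. ennreal (sqrt 2 * \<theta> ^ j)) = ennreal (sqrt 2 * (1 / (1 - \<theta>)))"
    using \<theta> by (intro suminf_ennreal_eq sums_mult geometric_sums) auto
  finally show ?thesis
    using \<theta> Cq by (simp add: \<theta>_def mult.assoc[symmetric] flip: ennreal_mult)
qed

text \<open>The return from levels to an integral over x. If \<open>E m\<close> is non-empty, level
  m - 1 is passed completely and its mass is comparable with \<open>lam m\<close>; for empty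
  \<open>E m\<close> the hypothesis removes the term.\<close>

lemma level_sum_le_integral:
  assumes b: "\<And>m. E m = {} \<Longrightarrow> b m = 0"
  shows "(\<integral>\<^sup>+m. ennreal (lam m) * b m \<partial>count_space UNIV)
    \<le> ennreal (sqrt 2 / (sqrt 2 - 1)) * (\<integral>\<^sup>+x. u x * (if 0 < V x then b (lv x + 1) else 0) \<partial>HL)"
proof -
  have "(\<integral>\<^sup>+m. ennreal (lam m) * b m \<partial>count_space UNIV) \<le>
    (\<integral>\<^sup>+m. ennreal (sqrt 2 / (sqrt 2 - 1)) * (weight (m - 1) * b m) \<partial>count_space UNIV)"
  proof (rule nn_integral_mono)
    fix m
    show "ennreal (lam m) * b m \<le> ennreal (sqrt 2 / (sqrt 2 - 1)) * (weight (m - 1) * b m)"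
    proof (cases "E m = {}")
      case False
      then obtain y where "lam (m - 1 + 1) \<le> V y" by (auto simp: E_def)
      then have "ennreal ((sqrt 2 - 1) * lam (m - 1)) \<le> weight (m - 1)" by (rule weight_ge)
      then have "ennreal (sqrt 2 / (sqrt 2 - 1)) * ennreal ((sqrt 2 - 1) * lam (m - 1)) \<le> ennreal (sqrt 2 / (sqrt 2 - 1)) * weight (m - 1)"
        by (rule mult_left_mono) simp
      moreover have "ennreal (sqrt 2 / (sqrt 2 - 1)) * ennreal ((sqrt 2 - 1) * lam (m - 1)) = ennreal (lam m)"
        using lam_Suc[of "m - 1"] by (subst ennreal_mult[symmetric]) auto
      ultimately show ?thesis by (simp add: mult.assoc[symmetric] mult_right_mono)
    qed (simp add: b)
  qed
  also have "\<dots> = (\<integral>\<^sup>+n. ennreal (sqrt 2 / (sqrt 2 - 1)) * (weight n * b (n + 1)) \<partial>count_space UNIV)"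
    by (rule nn_integral_bij_count_space[where g = "\<lambda>n. n + 1", of UNIV UNIV
          "\<lambda>m. ennreal (sqrt 2 / (sqrt 2 - 1)) * (weight (m - 1) * b m)", simplified, symmetric])
       (rule bij_betwI[where g = "\<lambda>n. n - 1"], auto)
  also have "\<dots> = ennreal (sqrt 2 / (sqrt 2 - 1)) * (\<integral>\<^sup>+n. weight n * b (n + 1) \<partial>count_space UNIV)"
    by (rule nn_integral_cmult) simp
  also have "(\<integral>\<^sup>+n. weight n * b (n + 1) \<partial>count_space UNIV) =
      (\<integral>\<^sup>+x. u x * (if 0 < V x then b (lv x + 1) else 0) \<partial>HL)"
    by (rule nn_integral_levels[symmetric])
  finally show ?thesis .
qed

section \<open>Local operators on two adjacent levels\<close>

definition two_levels :: "int \<Rightarrow> real set" where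
  "two_levels m = E (m - 1) \<union> E m"

lemma two_levels_sets [measurable]: "two_levels m \<in> sets HL"
  by (simp add: two_levels_def)

lemma mem_two_levels_iff: "x \<in> two_levels m \<longleftrightarrow> 0 \<le> x \<and> lam (m - 1) \<le> V x \<and> V x < lam (m + 1)"
  using lam_mono[of "m - 1" m] lam_mono[of m "m + 1"] by (auto simp: two_levels_def E_def)

abbreviation "C3 \<equiv> split_const r D Cq"

lemma level_split:
  assumes f: "f \<in> Mplus" and x: "0 < V x"
  defines "m \<equiv> lv x + 1"
  shows "N (\<lambda>y. indicator (E m) y * K f y) powe r \<le> ennreal C3 *
    (N (\<lambda>y. indicator (E m) y * K (\<lambda>z. indicator (two_levels m) z * f z) y) powe r
     + (N (\<lambda>y. indicator {x..} y * k y x) powe r * (\<integral>\<^sup>+z\<in>{0..x}. f z \<partial>lebesgue) powe r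
     + N (indicator (E m)) powe r * K f x powe r))"
proof -
  let ?fm = "\<lambda>z. indicator (two_levels m) z * f z"
  let ?F = "\<integral>\<^sup>+z\<in>{0..x}. f z \<partial>lebesgue"
  have x0: "0 \<le> x" using V_pos_imp_pos[OF x] by simp
  have xE: "x \<in> E (m - 1)" using x by (simp add: mem_E_iff m_def)
  have fm: "?fm \<in> Mplus" by (intro indicator_Mplus f) simp
  let ?g1 = "\<lambda>y. indicator (E m) y * K ?fm y"
  let ?g2 = "\<lambda>y. (ennreal D * ?F) * (indicator {x..} y * k y x)"
  let ?g3 = "\<lambda>y. (ennreal D * K f x) * indicator (E m) y"
  have [measurable]: "(\<lambda>y. k y x) \<in> borel_measurable HL" by (rule kernel_section2[OF k x0])
  have kx: "(\<lambda>y. indicator {x..} y * k y x) \<in> Mplus" by (intro MplusI) measurable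
  have iE: "indicator (E m) \<in> Mplus" by (intro MplusI) measurable
  have g1: "?g1 \<in> Mplus" by (intro indicator_K_Mplus fm) simp
  have g2: "?g2 \<in> Mplus" using kx by (auto simp: Mplus_def)
  have g3: "?g3 \<in> Mplus" using iE by (auto simp: Mplus_def)
  have g23: "(\<lambda>y. ?g2 y + ?g3 y) \<in> Mplus" using g2 g3 by (auto simp: Mplus_def)
  have "N (\<lambda>y. indicator (E m) y * K f y) \<le> N (\<lambda>y. ?g1 y + (?g2 y + ?g3 y))"
  proof (rule Lnorm_le_Lnorm[OF q w indicator_K_Mplus[OF f]])
    fix y
    show "indicator (E m) y * K f y \<le> ?g1 y + (?g2 y + ?g3 y)"
    proof (cases "y \<in> E m")
      case True
      then have xy: "x \<le> y" using xE V_less_imp_less[of x y] by (auto simp: E_def)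
      have "K f y \<le> K ?fm y + ennreal D * (k y x * ?F + K f x)"
      \<comment> \<open>A point z <= y outside both levels satisfies
        \<open>V z < lam (m - 1) <= V x\<close>, hence lies below x.\<close>
      proof (rule kernel_op_split[OF k f fm x0 xy])
        fix z assume z: "0 \<le> z" "z \<le> y" "z \<notin> two_levels m"
        then have "V z < V x"
          using V_mono[OF z(2)] True xE by (auto simp: mem_two_levels_iff E_def)
        then show "z \<le> x" using V_less_imp_less[of z x] by simp
      qed
      then show ?thesis using True xy by (simp add: distrib_left mult_ac)
    qed simp
  qed simp
  then have "N (\<lambda>y. indicator (E m) y * K f y) powe r \<le> N (\<lambda>y. ?g1 y + (?g2 y + ?g3 y)) powe r"
    using r by (intro powe_mono) auto
  also have "\<dots> \<le> ennreal (5 / 4) * N ?g1 powe r + ennreal Cq * N (\<lambda>y. ?g2 y + ?g3 y) powe r"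
    by (rule add_le[OF g1 g23])
  also have "\<dots> \<le> ennreal (5 / 4) * N ?g1 powe r
      + ennreal Cq * (ennreal (5 / 4) * N ?g2 powe r + ennreal Cq * N ?g3 powe r)"
    by (intro add_left_mono mult_left_mono add_le[OF g2 g3]) simp
  also have "N ?g2 powe r = ennreal (D powr r) * (N (\<lambda>y. indicator {x..} y * k y x) powe r * ?F powe r)"
    by (subst Lnorm_cmult[OF q w kx]) (use r D in \<open>simp add: powe_mult powe_ennreal mult_ac\<close>)
  also have "N ?g3 powe r = ennreal (D powr r) * (N (indicator (E m)) powe r * K f x powe r)"
    by (subst Lnorm_cmult[OF q w iE]) (use r D in \<open>simp add: powe_mult powe_ennreal mult_ac\<close>)
  finally have main: "N (\<lambda>y. indicator (E m) y * K f y) powe r \<le> ennreal (5 / 4) * N ?g1 powe r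
      + ennreal Cq * (ennreal (5 / 4) * (ennreal (D powr r) * (N (\<lambda>y. indicator {x..} y * k y x) powe r * ?F powe r))
        + ennreal Cq * (ennreal (D powr r) * (N (indicator (E m)) powe r * K f x powe r)))" .
  \<comment> \<open>Needed because the local term carries no factor D, whereas \<open>C3\<close>
    contains one throughout.\<close>
  have D1: "1 \<le> D powr r" using D r by (simp add: ge_one_powr_ge_zero)
  have c1: "5 / 4 \<le> C3"
  proof -
    have "5 / 4 * 1 \<le> (5 / 4 + Cq * (5 / 4) + Cq * Cq) * D powr r"
      using D1 Cq by (intro mult_mono) auto
    then show ?thesis by (simp add: split_const_def)
  qed
  have c2: "Cq * (5 / 4) * D powr r \<le> C3" "Cq * Cq * D powr r \<le> C3"
    unfolding split_const_def using Cq by (intro mult_right_mono; simp)+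
  have "ennreal (5 / 4) * a + ennreal Cq * (ennreal (5 / 4) * (ennreal (D powr r) * b) + ennreal Cq * (ennreal (D powr r) * c))
    \<le> ennreal C3 * (a + (b + c))" for a b c
  proof -
    have "ennreal (5 / 4) * a + ennreal Cq * (ennreal (5 / 4) * (ennreal (D powr r) * b) + ennreal Cq * (ennreal (D powr r) * c))
      = ennreal (5 / 4) * a + (ennreal (Cq * (5 / 4) * D powr r) * b + ennreal (Cq * Cq * D powr r) * c)"
    proof -
      have "ennreal (Cq * (5 / 4) * D powr r) = ennreal Cq * (ennreal (5 / 4) * ennreal (D powr r))"
        "ennreal (Cq * Cq * D powr r) = ennreal Cq * (ennreal Cq * ennreal (D powr r))"
        using Cq by (simp_all only: ennreal_mult[symmetric] mult.assoc less_imp_le zero_le_mult_iff powr_ge_zero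
          zero_le_divide_iff zero_le_numeral simp_thms)
      then show ?thesis by (simp only: distrib_left mult.assoc)
    qed
    also have "\<dots> \<le> ennreal C3 * a + (ennreal C3 * b + ennreal C3 * c)"
      using c1 c2 by (intro add_mono mult_right_mono ennreal_leI) auto
    finally show ?thesis by (simp add: distrib_left)
  qed
  then show ?thesis by (rule order_trans[OF main])
qed

text \<open>Norm of the operator localised on both sides. Restricting the input as well is what
  makes the local norms of f summable over m.\<close>

definition blk :: "int \<Rightarrow> ennreal" where
  "blk m = best_const (ennreal p) v
    (\<lambda>g. N (\<lambda>y. indicator (E m) y * K (\<lambda>z. indicator (two_levels m) z * g z) y))"

text \<open>Restriction to the two levels is idempotent, so the best constant may be applied to the
  restricted function; the gain is the local norm on the right.\<close>

lemma blk_bound: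
  assumes f: "f \<in> Mplus" "nrm f < \<infinity>" and fin: "blk m < \<infinity>"
  shows "N (\<lambda>y. indicator (E m) y * K (\<lambda>z. indicator (two_levels m) z * f z) y)
    \<le> blk m * nrm (\<lambda>z. indicator (two_levels m) z * f z)"
proof -
  let ?f = "\<lambda>z. indicator (two_levels m) z * f z"
  have m: "?f \<in> Mplus" by (intro indicator_Mplus f) simp
  have "nrm ?f \<le> nrm f"
    using p_pos by (intro Lnorm_le_Lnorm v m) (auto simp: indicator_def)
  then have n: "nrm ?f < \<infinity>" using f(2) by (rule le_less_trans)
  have "(\<lambda>z. indicator (two_levels m) z * ?f z) = ?f" by (auto simp: indicator_def)
  then show ?thesis
    using best_const_bound[OF m n fin[unfolded blk_def]] by (simp add: blk_def)
qed

lemma blk_le_H_tail: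
  assumes "E m \<noteq> {}"
  shows "blk m \<le> op_norm (ennreal p) v q w (H_tail k (lev (lam m)))"
  unfolding blk_def op_norm_def
proof (rule best_const_mono, rule Lnorm_le_Lnorm[OF q w])
  fix g assume g: "g \<in> Mplus"
  show "(\<lambda>y. indicator (E m) y * K (\<lambda>z. indicator (two_levels m) z * g z) y) \<in> Mplus"
    by (intro indicator_K_Mplus indicator_Mplus g) auto
  fix y :: real
  have "K (\<lambda>z. indicator (two_levels m) z * g z) y \<le> K g y"
    by (intro kernel_op_mono[OF k]) (auto simp: indicator_def)
  moreover have "lev (lam m) \<le> y" if "y \<in> E m"
    using that lev_le_iff[OF lam_pos(1)[of m], of y y] by (auto simp: E_def)
  ultimately show "indicator (E m) y * K (\<lambda>z. indicator (two_levels m) z * g z) y \<le> H_tail k (lev (lam m)) g y"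
    by (auto simp: H_tail_eq indicator_def)
qed

text \<open>With n = \<open>lv x\<close>, points of level n + 1 have \<open>V\<close> between V x /
  2 and \<open>lam (n + 2) = 2 * lam n <= 2 * V x\<close>, so they lie in the block. The input
  starts at \<open>V >= lam n\<close>, above V x / 4, the value of \<open>V\<close> at the lower end
  of integration.\<close>

lemma blk_le_H_block:
  assumes x: "0 < V x"
  shows "blk (lv x + 1) \<le> op_norm (ennreal p) v q w (H_block u k (sigma_inv u x) (sigma u x))"
  unfolding blk_def op_norm_def
proof (rule best_const_mono, rule Lnorm_le_Lnorm[OF q w])
  fix g assume g: "g \<in> Mplus"
  let ?m = "lv x + 1"
  show "(\<lambda>y. indicator (E ?m) y * K (\<lambda>z. indicator (two_levels ?m) z * g z) y) \<in> Mplus"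
    by (intro indicator_K_Mplus indicator_Mplus g) auto
  fix y :: real
  assume y: "0 \<le> y"
  have "x \<in> E (lv x)" using x by (simp add: mem_E_iff)
  then have Vx: "lam (lv x) \<le> V x" "V x < lam ?m" by (auto simp: E_def)
  have l2: "lam (lv x + 2) = 2 * lam (lv x)" by (rule lam_plus_2)
  have l1: "lam ?m \<le> 2 * lam (lv x)" using lam_mono[of ?m "lv x + 2"] l2 by simp
  have c: "V (sigma_inv u x) = V x / 2" by (rule V_sigma_inv[OF x])
  then have c0: "0 < V (sigma_inv u x)" using x by simp
  note cp = sigma_inv_pos[OF c0]
  show "indicator (E ?m) y * K (\<lambda>z. indicator (two_levels ?m) z * g z) y
    \<le> H_block u k (sigma_inv u x) (sigma u x) g y"
  proof (cases "y \<in> E ?m")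
    case True
    then have Vy: "lam ?m \<le> V y" "V y < 2 * lam (lv x)" using l2 by (auto simp: E_def add.commute)
    have "sigma_inv u x \<le> y" using sigma_inv_le_iff[OF x] Vy Vx x by simp
    moreover have "ennreal y < sigma u x" using less_sigma_iff[OF x y] Vy Vx by simp
    moreover have "K (\<lambda>z. indicator (two_levels ?m) z * g z) y \<le> K (\<lambda>z. indicator {sigma_inv u (sigma_inv u x)..} z * g z) y"
    proof (intro kernel_op_mono[OF k])
      fix z
      have "sigma_inv u (sigma_inv u x) \<le> z" if "z \<in> two_levels ?m"
        using that sigma_inv_le_iff[OF c0, of z] Vx l1 lam_pos(1)[of "lv x"]
        by (auto simp: c mem_two_levels_iff simp del: lam_pos)
      then show "indicator (two_levels ?m) z * g z \<le> indicator {sigma_inv u (sigma_inv u x)..} z * g z"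
        by (auto simp: indicator_def)
    qed
    ultimately show ?thesis using True cp by (simp add: H_block_eq)
  qed simp
qed

text \<open>Each point lies in at most two of the overlapping sets, those with index
  \<open>lv x\<close> and \<open>lv x + 1\<close>.\<close>

lemma nrm_levels_sum:
  assumes f: "f \<in> Mplus" "nrm f \<le> 1"
  shows "(\<integral>\<^sup>+m. nrm (\<lambda>z. indicator (two_levels m) z * f z) powe p \<partial>count_space UNIV) \<le> 2"
proof -
  have [measurable]: "f \<in> borel_measurable HL" using f by (simp add: Mplus_def)
  have "(\<integral>\<^sup>+m. nrm (\<lambda>z. indicator (two_levels m) z * f z) powe p \<partial>count_space UNIV) =
    (\<integral>\<^sup>+m. \<integral>\<^sup>+x. indicator (two_levels m) x * (f x powe p * v x) \<partial>HL \<partial>count_space UNIV)"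
    using p_pos by (simp add: Lnorm_fin_powe powe_mult mult.assoc)
  also have "\<dots> = (\<integral>\<^sup>+x. \<integral>\<^sup>+m. indicator (two_levels m) x * (f x powe p * v x) \<partial>count_space UNIV \<partial>HL)"
    by (rule nn_integral_count_space_nn_integral[symmetric]) auto
  also have "\<dots> \<le> (\<integral>\<^sup>+x. 2 * (f x powe p * v x) \<partial>HL)"
  proof (rule nn_integral_mono)
    fix x
    have "(\<integral>\<^sup>+m. indicator (two_levels m) x * (f x powe p * v x) \<partial>count_space UNIV) \<le>
      (\<integral>\<^sup>+m. (f x powe p * v x) * indicator {lv x, lv x + 1} m \<partial>count_space UNIV)"
      by (intro nn_integral_mono) (auto simp: indicator_def two_levels_def mem_E_iff)
    also have "\<dots> = 2 * (f x powe p * v x)"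
      by (subst nn_integral_indicator_finite) (auto simp: mult_2)
    finally show "(\<integral>\<^sup>+m. indicator (two_levels m) x * (f x powe p * v x) \<partial>count_space UNIV) \<le> 2 * (f x powe p * v x)" .
  qed
  also have "\<dots> = 2 * nrm f powe p"
    using p_pos by (simp add: Lnorm_fin_powe nn_integral_cmult)
  also have "\<dots> \<le> 2 * 1 powe p"
    using f p_pos by (intro mult_left_mono powe_mono) auto
  finally show ?thesis by simp
qed

text \<open>\<open>W\<close> is the part of \<open>A2\<close> left over by Young's inequality if \<open>r < p\<close>; it is 0 if \<open>p \<le> r\<close>.\<close>

lemma blk_sum:
  assumes A2: "A2 p q r u v w k \<le> ennreal S" and S: "0 < S"
  shows "\<exists>W. (\<integral>\<^sup>+n. weight n * W (n + 1) \<partial>count_space UNIV) \<le> 1 \<and>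
    (\<forall>f m. f \<in> Mplus \<longrightarrow> nrm f \<le> 1 \<longrightarrow>
      N (\<lambda>y. indicator (E m) y * K (\<lambda>z. indicator (two_levels m) z * f z) y) powe r
      \<le> ennreal (S powr r) * (W m + nrm (\<lambda>z. indicator (two_levels m) z * f z) powe p * ennreal (1 / lam (m - 1))))"
proof -
  have \<phi>1: "nrm (\<lambda>z. indicator (two_levels m) z * f z) \<le> 1" if "f \<in> Mplus" "nrm f \<le> 1" for f m
  proof -
    have "nrm (\<lambda>z. indicator (two_levels m) z * f z) \<le> nrm f"
      using p_pos that by (intro Lnorm_le_Lnorm v indicator_Mplus) (auto simp: indicator_def)
    then show ?thesis using that(2) by (rule order_trans)
  qed
  show ?thesis
  proof (cases "p \<le> r")
    case True
    have "N (\<lambda>y. indicator (E m) y * K (\<lambda>z. indicator (two_levels m) z * f z) y) powe r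
      \<le> ennreal (S powr r) * (nrm (\<lambda>z. indicator (two_levels m) z * f z) powe p * ennreal (1 / lam (m - 1)))"
      if f: "f \<in> Mplus" "nrm f \<le> 1" for f m
    proof (cases "E m = {}")
      case False
      then obtain b where b: "lam m \<le> V b" by (auto simp: E_def)
      note t = lev[OF lam_pos(1)[of m] b]
      let ?\<phi> = "nrm (\<lambda>z. indicator (two_levels m) z * f z)"
      have "primitive u (lev (lam m)) powe (1 / r) * op_norm (ennreal p) v q w (H_tail k (lev (lam m))) \<le> A2 p q r u v w k"
        unfolding A2_def using True t(2) by (auto intro!: SUP_upper)
      then have "ennreal (lam m powr (1 / r)) * op_norm (ennreal p) v q w (H_tail k (lev (lam m))) \<le> ennreal S"
        using A2 t(1) by (simp add: primitive_V powe_ennreal)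
      then have le: "ennreal (lam m powr (1 / r)) * blk m \<le> ennreal S"
        using blk_le_H_tail[OF False] by (meson mult_left_mono order_trans zero_le)
      then have fin: "blk m < \<infinity>"
        by (cases "blk m") (auto simp: ennreal_mult_top top_unique)
      have fin': "nrm f < \<infinity>" using f(2) by (rule le_less_trans) simp
      have "ennreal (lam m) * N (\<lambda>y. indicator (E m) y * K (\<lambda>z. indicator (two_levels m) z * f z) y) powe r
        \<le> ennreal (lam m) * (blk m * ?\<phi>) powe r"
        using blk_bound[OF f(1) fin' fin] r by (intro mult_left_mono powe_mono) auto
      also have "\<dots> = (ennreal (lam m powr (1 / r)) * blk m) powe r * ?\<phi> powe r"
        using r by (simp add: powe_mult powe_ennreal powr_powr mult.assoc)
      also have "\<dots> \<le> ennreal S powe r * ?\<phi> powe p"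
      proof (rule mult_mono)
        \<comment> \<open>This uses that the local norm is at most 1 and p <= r; it is the reason
          for normalising f.\<close>
        show "?\<phi> powe r \<le> ?\<phi> powe p"
          using \<phi>1[OF f, of m] True p_pos
          by (cases ?\<phi>) (auto simp: powe_ennreal powr_mono' intro!: ennreal_leI)
      qed (use le r in \<open>auto intro: powe_mono\<close>)
      finally have "ennreal (1 / lam m) * (ennreal (lam m) * N (\<lambda>y. indicator (E m) y * K (\<lambda>z. indicator (two_levels m) z * f z) y) powe r)
        \<le> ennreal (1 / lam m) * (ennreal S powe r * ?\<phi> powe p)"
        by (rule mult_left_mono) simp
      also have "\<dots> \<le> ennreal (1 / lam (m - 1)) * (ennreal S powe r * ?\<phi> powe p)"
        using lam_mono[of "m - 1" m] by (intro mult_right_mono ennreal_leI) (auto simp: field_simps)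
      finally show ?thesis
        using S by (simp add: mult.assoc[symmetric] powe_ennreal mult_ac flip: ennreal_mult)
    qed (simp add: Lnorm_zero)
    then show ?thesis by (intro exI[of _ "\<lambda>_. 0"]) auto
  next
    case False
    then have rp: "r < p" by simp
    define s where "s = s_exp p r"
    note s = s_exp[OF rp, folded s_def]
    \<comment> \<open>A lower bound, up to the factor S^s, for the integrand of \<open>A2\<close>
      without \<open>u\<close> on level m - 1; hence its total mass is at most 1.\<close>
    define W where "W m = ennreal (lam (m - 1) powr (s / p)) * (ennreal (1 / S) * blk m) powe s" for m
    have "(\<integral>\<^sup>+x. u x * (if 0 < V x then ennreal (lam (lv x) powr (s / p)) * blk (lv x + 1) powe s else 0) \<partial>HL)
      \<le> (\<integral>\<^sup>+x. u x * primitive u x powe (s / p) *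
          op_norm (ennreal p) v q w (H_block u k (sigma_inv u x) (sigma u x)) powe s \<partial>HL)"
    proof (rule nn_integral_mono)
      fix x
      show "u x * (if 0 < V x then ennreal (lam (lv x) powr (s / p)) * blk (lv x + 1) powe s else 0) \<le>
        u x * primitive u x powe (s / p) *
          op_norm (ennreal p) v q w (H_block u k (sigma_inv u x) (sigma u x)) powe s"
      proof (cases "0 < V x")
        case True
        then have "x \<in> E (lv x)" by (simp add: mem_E_iff)
        then have "ennreal (lam (lv x) powr (s / p)) \<le> primitive u x powe (s / p)"
          using s p_pos by (auto simp: E_def primitive_V powe_ennreal intro!: ennreal_leI powr_mono2)
        then show ?thesis using True s blk_le_H_block[OF True]
          by (auto simp: mult.assoc intro!: mult_mono powe_mono)
      qed simp
    qed
    also have "\<dots> \<le> ennreal S powe s"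
      using A2 rp s(1) unfolding A2_def by (simp add: Let_def nn_integral_half_line powe_inverse_le_iff flip: s_def)
    finally have int: "(\<integral>\<^sup>+n. weight n * (ennreal (lam n powr (s / p)) * blk (n + 1) powe s) \<partial>count_space UNIV) \<le> ennreal (S powr s)"
      using S by (subst (asm) nn_integral_levels) (simp add: powe_ennreal)
    have "(\<integral>\<^sup>+n. weight n * W (n + 1) \<partial>count_space UNIV) =
      (\<integral>\<^sup>+n. ennreal ((1 / S) powr s) * (weight n * (ennreal (lam n powr (s / p)) * blk (n + 1) powe s)) \<partial>count_space UNIV)"
      using s S by (simp add: W_def powe_mult powe_ennreal mult_ac)
    also have "\<dots> = ennreal ((1 / S) powr s) * (\<integral>\<^sup>+n. weight n * (ennreal (lam n powr (s / p)) * blk (n + 1) powe s) \<partial>count_space UNIV)"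
      by (rule nn_integral_cmult) simp
    also have "\<dots> \<le> ennreal ((1 / S) powr s) * ennreal (S powr s)"
      by (intro mult_left_mono int) simp
    also have "\<dots> = 1"
      using S by (simp flip: ennreal_mult powr_mult)
    finally have W1: "(\<integral>\<^sup>+n. weight n * W (n + 1) \<partial>count_space UNIV) \<le> 1" .
    have "N (\<lambda>y. indicator (E m) y * K (\<lambda>z. indicator (two_levels m) z * f z) y) powe r
      \<le> ennreal (S powr r) * (W m + nrm (\<lambda>z. indicator (two_levels m) z * f z) powe p * ennreal (1 / lam (m - 1)))"
      if f: "f \<in> Mplus" "nrm f \<le> 1" for f m
    proof (cases "E m = {}")
      case ne: False
      let ?\<phi> = "nrm (\<lambda>z. indicator (two_levels m) z * f z)"
      \<comment> \<open>A single term of the bounded sum has positive mass, so W m, and with it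
        \<open>blk m\<close>, is finite.\<close>
      have "weight (m - 1) * W (m - 1 + 1) \<le> (\<integral>\<^sup>+n. weight n * W (n + 1) \<partial>count_space UNIV)"
        by (rule nn_integral_ge_point) simp
      then have w1: "weight (m - 1) * W m \<le> 1" using W1 by simp
      from ne obtain b where "lam (m - 1 + 1) \<le> V b" by (auto simp: E_def)
      then have "ennreal ((sqrt 2 - 1) * lam (m - 1)) \<le> weight (m - 1)" by (rule weight_ge)
      then have "0 < weight (m - 1)" by (rule less_le_trans[rotated]) simp
      then have "W m \<noteq> \<infinity>" using w1 by (auto simp: ennreal_mult_top top_unique split: if_splits)
      then have fin: "blk m < \<infinity>"
        using S by (cases "blk m") (auto simp: W_def ennreal_mult_top)
      have fin': "nrm f < \<infinity>" using f(2) by (rule le_less_trans) simp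
      obtain a where a: "blk m = ennreal a" "0 \<le> a" using fin by (cases "blk m") auto
      obtain c where c: "?\<phi> = ennreal c" "0 \<le> c" using \<phi>1[OF f, of m] by (cases ?\<phi>) (auto simp: top_unique)
      let ?L = "lam (m - 1)"
      \<comment> \<open>The power of \<open>lam (m - 1)\<close> is split between the factors so that
        Young's inequality with the conjugate exponents s / r and p / r yields W m and the p-th
        power of the local norm over \<open>lam (m - 1)\<close>.\<close>
      define X where "X = ?L powr (r / p) * (a / S) powr r"
      define Y where "Y = ?L powr (- (r / p)) * c powr r"
      have "N (\<lambda>y. indicator (E m) y * K (\<lambda>z. indicator (two_levels m) z * f z) y) powe r \<le> (blk m * ?\<phi>) powe r"
        using blk_bound[OF f(1) fin' fin] r by (intro powe_mono) auto
      also have "\<dots> = ennreal (a powr r * c powr r)"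
        unfolding a(1) c(1) using a c by (simp add: powe_ennreal powr_mult flip: ennreal_mult)
      also have "a powr r * c powr r = S powr r * (X * Y)"
        unfolding X_def Y_def using S a by (simp add: powr_divide powr_minus field_simps)
      also have "X * Y \<le> X powr (s / r) + Y powr (p / r)"
      proof (rule powr_mult_le_add)
        show "1 / (s / r) + 1 / (p / r) = 1" using s r p_pos by (simp add: field_simps)
      qed (use s r rp in \<open>auto simp: X_def Y_def\<close>)
      also have "X powr (s / r) = ?L powr (s / p) * (a / S) powr s"
        unfolding X_def using r a S by (simp add: powr_mult powr_powr)
      also have "Y powr (p / r) = c powr p * (1 / ?L)"
      proof -
        have e: "- (r / p) * (p / r) = - 1" "r * (p / r) = p" using r p_pos by auto
        show ?thesis
          unfolding Y_def powr_mult powr_powr e by (simp add: powr_minus_divide mult.commute)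
      qed
      finally have "N (\<lambda>y. indicator (E m) y * K (\<lambda>z. indicator (two_levels m) z * f z) y) powe r \<le>
          ennreal (S powr r * (?L powr (s / p) * (a / S) powr s + c powr p * (1 / ?L)))"
        using S by (simp add: mult_left_mono ennreal_leI)
      also have "\<dots> = ennreal (S powr r) * (W m + ?\<phi> powe p * ennreal (1 / ?L))"
        unfolding W_def a(1) c(1) using a c S
        by (simp add: powe_ennreal ennreal_plus[symmetric] flip: ennreal_mult del: ennreal_plus)
      finally show ?thesis .
    qed (simp add: Lnorm_zero)
    with W1 show ?thesis by blast
  qed
qed

abbreviation "Cup \<equiv> upper_const r D Cq"

section \<open>Assembling the upper bound\<close>

lemma integral_T_le:
  assumes f: "f \<in> Mplus" "nrm f \<le> 1" and S: "0 < S"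
    and A: "A0 p q r u v w k \<le> ennreal S" "A1 p q r u v w k \<le> ennreal S" "A2 p q r u v w k \<le> ennreal S"
  shows "(\<integral>\<^sup>+x. u x * T f x powe r \<partial>HL) \<le> ennreal (Cup * S powr r)"
proof -
  have fin: "nrm f < \<infinity>" using f(2) by (rule le_less_trans) simp
  have SL: "(ennreal S * nrm f) powe r \<le> ennreal (S powr r)"
  proof -
    have "(ennreal S * nrm f) powe r \<le> (ennreal S * 1) powe r"
      using f r by (intro powe_mono mult_left_mono) auto
    then show ?thesis using S by (simp add: powe_ennreal)
  qed
  let ?F0 = "\<lambda>x. u x * N (indicator {x..}) powe r * K f x powe r"
  let ?F1 = "\<lambda>x. u x * N (\<lambda>y. indicator {x..} y * k y x) powe r * (\<integral>\<^sup>+z\<in>{0..x}. f z \<partial>lebesgue) powe r"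
  have F0: "(\<integral>\<^sup>+x. ?F0 x \<partial>HL) \<le> ennreal (S powr r)"
    using best_const_leD[OF A(1)[unfolded A0_eq[OF q w]] f(1) fin] SL r
    by (auto simp: powe_inverse_le_iff intro: order_trans)
  have F1: "(\<integral>\<^sup>+x. ?F1 x \<partial>HL) \<le> ennreal (S powr r)"
    using best_const_leD[OF A(2)[unfolded A1_eq[OF q w k]] f(1) fin] SL r
    by (auto simp: powe_inverse_le_iff intro: order_trans)
  obtain W where W: "(\<integral>\<^sup>+n. weight n * W (n + 1) \<partial>count_space UNIV) \<le> 1"
    and blk: "\<And>m. N (\<lambda>y. indicator (E m) y * K (\<lambda>z. indicator (two_levels m) z * f z) y) powe r
      \<le> ennreal (S powr r) * (W m + nrm (\<lambda>z. indicator (two_levels m) z * f z) powe p * ennreal (1 / lam (m - 1)))"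
    using blk_sum[OF A(3) S] f by blast
  define b where "b m = N (\<lambda>y. indicator (E m) y * K f y) powe r" for m
  define Q where "Q n = ennreal (S powr r) * (W (n + 1)
    + nrm (\<lambda>z. indicator (two_levels (n + 1)) z * f z) powe p * ennreal (1 / lam n))" for n
  let ?b = "\<lambda>x. u x * (if 0 < V x then b (lv x + 1) else 0)"
  let ?Q = "\<lambda>x. u x * (if 0 < V x then Q (lv x) else 0)"
  \<comment> \<open>Unlike \<open>?F0\<close>, this is visibly measurable, as its norm depends on x
    only through the level. So \<open>?Q\<close> and \<open>?G\<close> form the measurable summand
    in \<open>nn_integral_add_le\<close>, and \<open>?F1\<close> the arbitrary one;
    \<open>?G\<close> is enlarged to \<open>?F0\<close> only afterwards.\<close>
  let ?G = "\<lambda>x. u x * (if 0 < V x then N (indicator (E (lv x + 1))) powe r else 0) * K f x powe r"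
  have lv_comp [measurable]: "(\<lambda>x. if 0 < V x then h (lv x) else 0 :: ennreal) \<in> borel_measurable HL" for h :: "int \<Rightarrow> ennreal"
  proof -
    have [measurable]: "(\<lambda>x. h (lv x)) \<in> borel_measurable HL"
      by (rule measurable_compose[OF lv_measurable]) simp
    show ?thesis by measurable
  qed
  have [measurable]: "K f \<in> borel_measurable HL" by (rule K_meas[OF f(1)])
  have mb: "?b \<in> borel_measurable HL"
    using lv_comp[of "\<lambda>n. b (n + 1)"] by measurable
  have mQ [measurable]: "?Q \<in> borel_measurable HL" by measurable
  have mG [measurable]: "?G \<in> borel_measurable HL"
    using lv_comp[of "\<lambda>n. N (indicator (E (n + 1))) powe r"] by measurable
  have mg: "(\<lambda>x. ennreal C3 * (?Q x + ?G x)) \<in> borel_measurable HL" by measurable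
  have C3: "0 < C3" by (rule split_const_pos[OF Cq D])
  have "(\<integral>\<^sup>+x. ?b x \<partial>HL) \<le> (\<integral>\<^sup>+x. ennreal C3 * (?Q x + ?G x) \<partial>HL) + (\<integral>\<^sup>+x. ennreal C3 * ?F1 x \<partial>HL)"
  proof (rule nn_integral_add_le[OF mb mg AE_I2])
    fix x
    show "?b x \<le> ennreal C3 * (?Q x + ?G x) + ennreal C3 * ?F1 x"
    proof (cases "0 < V x")
      case True
      let ?a = "N (\<lambda>y. indicator {x..} y * k y x) powe r * (\<integral>\<^sup>+z\<in>{0..x}. f z \<partial>lebesgue) powe r"
      let ?c = "N (indicator (E (lv x + 1))) powe r * K f x powe r"
      have "b (lv x + 1) \<le> ennreal C3 * (Q (lv x) + (?a + ?c))"
      proof -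
        have "b (lv x + 1) \<le> ennreal C3 * (N (\<lambda>y. indicator (E (lv x + 1)) y
            * K (\<lambda>z. indicator (two_levels (lv x + 1)) z * f z) y) powe r + (?a + ?c))"
          unfolding b_def by (rule level_split[OF f(1) True])
        also have "\<dots> \<le> ennreal C3 * (Q (lv x) + (?a + ?c))"
          using blk[of "lv x + 1"] by (intro mult_left_mono add_right_mono) (simp_all add: Q_def)
        finally show ?thesis .
      qed
      then have "u x * b (lv x + 1) \<le> u x * (ennreal C3 * (Q (lv x) + (?a + ?c)))"
        by (rule mult_left_mono) simp
      then show ?thesis using True by (simp add: distrib_left mult_ac add_ac)
    qed simp
  qed
  also have "(\<integral>\<^sup>+x. ennreal C3 * ?F1 x \<partial>HL) \<le> ennreal C3 * ennreal (S powr r)"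
    by (rule order_trans[OF nn_integral_cmult_le[OF C3]]) (intro mult_left_mono F1, simp)
  also have "(\<integral>\<^sup>+x. ennreal C3 * (?Q x + ?G x) \<partial>HL) = ennreal C3 * ((\<integral>\<^sup>+x. ?Q x \<partial>HL) + (\<integral>\<^sup>+x. ?G x \<partial>HL))"
    by (simp add: nn_integral_cmult nn_integral_add)
  also have "(\<integral>\<^sup>+x. ?G x \<partial>HL) \<le> (\<integral>\<^sup>+x. ?F0 x \<partial>HL)"
  proof (rule nn_integral_mono)
    fix x
    show "?G x \<le> ?F0 x"
    proof (cases "0 < V x")
      case True
      have "N (indicator (E (lv x + 1))) \<le> N (indicator {x..})"
      proof (rule Lnorm_le_Lnorm[OF q w])
        show "indicator (E (lv x + 1)) \<in> Mplus" by (intro MplusI) measurable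
        fix y
        have "x \<in> E (lv x)" using True by (simp add: mem_E_iff)
        then have "x \<le> y" if "y \<in> E (lv x + 1)"
          using that V_less_imp_less[of x y] by (auto simp: E_def)
        then show "indicator (E (lv x + 1)) y \<le> (indicator {x..} y :: ennreal)"
          by (auto simp: indicator_def)
      qed
      then show ?thesis using True r by (auto intro!: mult_mono powe_mono)
    qed simp
  qed
  also note F0
  \<comment> \<open>W contributes 1. In the other term \<open>weight n / lam n <= sqrt 2\<close>,
    and the local norms sum to at most 2.\<close>
  also have "(\<integral>\<^sup>+x. ?Q x \<partial>HL) \<le> ennreal (S powr r) * ennreal (1 + 2 * sqrt 2)"
  proof -
    let ?\<phi> = "\<lambda>m. nrm (\<lambda>z. indicator (two_levels m) z * f z) powe p"
    have "(\<integral>\<^sup>+x. ?Q x \<partial>HL) = (\<integral>\<^sup>+n. weight n * Q n \<partial>count_space UNIV)"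
      by (rule nn_integral_levels)
    also have "\<dots> \<le> (\<integral>\<^sup>+n. ennreal (S powr r) * (weight n * W (n + 1) + ennreal (sqrt 2) * ?\<phi> (n + 1)) \<partial>count_space UNIV)"
    proof (rule nn_integral_mono)
      fix n
      have "weight n * ennreal (1 / lam n) \<le> ennreal (lam (n + 1)) * ennreal (1 / lam n)"
        by (intro mult_right_mono weight_le) simp
      also have "\<dots> = ennreal (sqrt 2)"
        unfolding lam_Suc by (subst ennreal_mult[symmetric]) auto
      finally have "weight n * ennreal (1 / lam n) * ?\<phi> (n + 1) \<le> ennreal (sqrt 2) * ?\<phi> (n + 1)"
        by (rule mult_right_mono) simp
      then have "ennreal (S powr r) * (weight n * W (n + 1) + weight n * ennreal (1 / lam n) * ?\<phi> (n + 1)) \<le>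
          ennreal (S powr r) * (weight n * W (n + 1) + ennreal (sqrt 2) * ?\<phi> (n + 1))"
        by (intro mult_left_mono add_left_mono) auto
      then show "weight n * Q n \<le> ennreal (S powr r) * (weight n * W (n + 1) + ennreal (sqrt 2) * ?\<phi> (n + 1))"
        by (simp add: Q_def distrib_left mult_ac)
    qed
    also have "\<dots> = ennreal (S powr r) * ((\<integral>\<^sup>+n. weight n * W (n + 1) \<partial>count_space UNIV)
        + ennreal (sqrt 2) * (\<integral>\<^sup>+n. ?\<phi> (n + 1) \<partial>count_space UNIV))"
      by (simp add: nn_integral_cmult nn_integral_add)
    also have "(\<integral>\<^sup>+n. ?\<phi> (n + 1) \<partial>count_space UNIV) = (\<integral>\<^sup>+m. ?\<phi> m \<partial>count_space UNIV)"
      by (rule nn_integral_bij_count_space[where g = "\<lambda>n. n + 1"]) (rule bij_betwI[where g = "\<lambda>n. n - 1"], auto)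
    also have "ennreal (S powr r) * ((\<integral>\<^sup>+n. weight n * W (n + 1) \<partial>count_space UNIV)
        + ennreal (sqrt 2) * (\<integral>\<^sup>+m. ?\<phi> m \<partial>count_space UNIV)) \<le> ennreal (S powr r) * (1 + ennreal (sqrt 2) * 2)"
      by (intro mult_left_mono add_mono W nrm_levels_sum f) auto
    also have "1 + ennreal (sqrt 2) * 2 = ennreal (1 + 2 * sqrt 2)"
      by (simp add: ennreal_mult mult.commute)
    finally show ?thesis .
  qed
  finally have "(\<integral>\<^sup>+x. ?b x \<partial>HL) \<le> ennreal C3 * (ennreal (S powr r) * ennreal (1 + 2 * sqrt 2) + ennreal (S powr r))
      + ennreal C3 * ennreal (S powr r)"
    by (simp add: add_mono mult_left_mono)
  also have "\<dots> = ennreal (C3 * (3 + 2 * sqrt 2) * S powr r)"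
    using C3 by (simp add: algebra_simps flip: ennreal_mult ennreal_plus)
  finally have B: "(\<integral>\<^sup>+x. ?b x \<partial>HL) \<le> ennreal (C3 * (3 + 2 * sqrt 2) * S powr r)" .
  have b0: "b m = 0" if "E m = {}" for m
    using that by (simp add: b_def Lnorm_zero)
  let ?c1 = "Cq * sqrt 2 / (1 - 5 / 4 / sqrt 2)" and ?c2 = "sqrt 2 / (sqrt 2 - 1)"
  have c1: "0 \<le> ?c1"
    using Cq five_quarters_less_sqrt_2 by (intro divide_nonneg_pos) auto
  have "(\<integral>\<^sup>+x. u x * T f x powe r \<partial>HL) \<le> ennreal ?c1 * (\<integral>\<^sup>+m. ennreal (lam m) * b m \<partial>count_space UNIV)"
    unfolding b_def by (rule integral_tail_le[OF f(1)])
  also have "\<dots> \<le> ennreal ?c1 * (ennreal ?c2 * (\<integral>\<^sup>+x. ?b x \<partial>HL))"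
    by (intro mult_left_mono level_sum_le_integral b0) auto
  also have "\<dots> \<le> ennreal ?c1 * (ennreal ?c2 * ennreal (C3 * (3 + 2 * sqrt 2) * S powr r))"
    by (intro mult_left_mono B) auto
  also have "\<dots> = ennreal (?c1 * (?c2 * (C3 * (3 + 2 * sqrt 2) * S powr r)))"
    using c1 C3 by (subst ennreal_mult[symmetric], simp, simp, subst ennreal_mult[symmetric]) auto
  also have "?c1 * (?c2 * (C3 * (3 + 2 * sqrt 2) * S powr r)) = Cup * S powr r"
    unfolding upper_const_def by (simp only: mult.assoc)
  finally show ?thesis .
qed

lemma T_hom:
  assumes f: "f \<in> Mplus" and x: "0 \<le> x"
  shows "T (\<lambda>z. c * f z) x = c * T f x"
  using H_tail_hom[OF f x q, of c] by (simp add: H_tail_eq)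

text \<open>Homogeneity reduces to norm at most 1.\<close>

lemma CT_le:
  assumes S: "0 < S"
    and A: "A0 p q r u v w k \<le> ennreal S" "A1 p q r u v w k \<le> ennreal S" "A2 p q r u v w k \<le> ennreal S"
  shows "CT \<le> ennreal (Cup powr (1 / r) * S)"
  unfolding C_T_eq[OF q w k r]
proof (rule best_const_leI)
  let ?c = "Cup powr (1 / r) * S"
  have c: "0 < ?c" using upper_const_pos[OF Cq D, of r] S by simp
  then show "0 < ennreal ?c" by simp
  fix f assume f: "f \<in> Mplus" "nrm f < \<infinity>"
  have [measurable]: "f \<in> borel_measurable HL" using f by (simp add: Mplus_def)
  show "(\<integral>\<^sup>+x. u x * T f x powe r \<partial>HL) powe (1 / r) \<le> ennreal ?c * nrm f"
  proof (rule ennreal_le_epsilon)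
    fix e :: real assume e: "0 < e"
    obtain l where l: "nrm f = ennreal l" "0 \<le> l" using f(2) by (cases "nrm f") auto
    \<comment> \<open>Dividing by slightly more than the norm covers norm 0 too; the excess costs
      exactly e at the end.\<close>
    define l' where "l' = l + e / ?c"
    have l': "0 < l'" "l \<le> l'" using l e c by (auto simp: l'_def add_nonneg_pos)
    define g where "g z = ennreal (1 / l') * f z" for z
    have g: "g \<in> Mplus" unfolding g_def by (intro MplusI) measurable
    have "nrm g = ennreal (1 / l') * nrm f"
      unfolding g_def using p_pos f by (intro Lnorm_cmult v) auto
    also have "\<dots> \<le> 1" using l l' by (simp flip: ennreal_mult)
    finally have "nrm g \<le> 1" .
    from integral_T_le[OF g this S A]
    have le: "(\<integral>\<^sup>+x. u x * T g x powe r \<partial>HL) \<le> ennreal (Cup * S powr r)" .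
    have "f = (\<lambda>z. ennreal l' * g z)"
      unfolding g_def using l' by (simp add: mult.assoc[symmetric] flip: ennreal_mult)
    then have T: "T f x = ennreal l' * T g x" if "0 \<le> x" for x
      using T_hom[OF g that] by simp
    have "(\<integral>\<^sup>+x. u x * T f x powe r \<partial>HL) = (\<integral>\<^sup>+x. ennreal (l' powr r) * (u x * T g x powe r) \<partial>HL)"
      by (intro nn_integral_cong) (use T r l' in \<open>simp add: powe_mult powe_ennreal mult.left_commute\<close>)
    also have "\<dots> \<le> ennreal (l' powr r) * (\<integral>\<^sup>+x. u x * T g x powe r \<partial>HL)"
      using l' by (intro nn_integral_cmult_le) simp
    also have "\<dots> \<le> ennreal (l' powr r) * ennreal (Cup * S powr r)"
      by (intro mult_left_mono le) simp
    also have "\<dots> = ennreal (?c * l') powe r"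
      using l' upper_const_pos[OF Cq D, of r] S r by (simp add: powe_ennreal powr_mult powr_powr mult_ac flip: ennreal_mult)
    finally have "(\<integral>\<^sup>+x. u x * T f x powe r \<partial>HL) powe (1 / r) \<le> ennreal (?c * l')"
      using r by (simp add: powe_inverse_le_iff)
    also have "?c * l' = ?c * l + e" using S upper_const_pos[OF Cq D, of r] by (simp add: l'_def distrib_left)
    also have "ennreal (?c * l + e) = ennreal ?c * nrm f + ennreal e"
      using c l e by (simp add: ennreal_mult)
    finally show "(\<integral>\<^sup>+x. u x * T f x powe r \<partial>HL) powe (1 / r) \<le> ennreal ?c * nrm f + ennreal e" .
  qed
qed

end

text \<open>Positive real bounds S decrease to x, which may itself be 0; infinite x is
  trivial.\<close>

lemma ennreal_le_cmultI:
  fixes x y :: ennreal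
  assumes c: "0 < c" and le: "\<And>S. 0 < S \<Longrightarrow> x \<le> ennreal S \<Longrightarrow> y \<le> ennreal (c * S)"
  shows "y \<le> ennreal c * x"
proof (cases "x = \<infinity>")
  case False
  then obtain a where a: "x = ennreal a" "0 \<le> a" by (cases x) auto
  show ?thesis
  proof (rule ennreal_le_epsilon)
    fix e :: real assume e: "0 < e"
    have "y \<le> ennreal (c * (a + e / c))"
      using a c e by (intro le) (auto simp: add_nonneg_pos intro!: ennreal_leI)
    also have "c * (a + e / c) = c * a + e" using c by (simp add: distrib_left)
    also have "ennreal (c * a + e) = ennreal c * x + ennreal e"
      using a c e by (simp add: ennreal_mult)
    finally show "y \<le> ennreal c * x + ennreal e" .
  qed
qed (use c in \<open>simp add: ennreal_mult_top\<close>)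

theorem theorem2p1:
  fixes p r D :: real and q :: ennreal
  assumes "1 \<le> p" and "0 < r" and "0 < q" and "1 \<le> D"
  shows "\<exists>c1 c2 :: real. 0 < c1 \<and> 0 < c2 \<and>
    (\<forall>u v w k. u \<in> Mplus \<and> v \<in> Mplus \<and> w \<in> Mplus \<and>
       (\<forall>t>0. (\<integral>\<^sup>+x\<in>{0..t}. u x \<partial>lebesgue) < \<infinity>) \<and> oinarov_kernel D k \<longrightarrow>
       (C_T p q r u v w k < \<infinity> \<longleftrightarrow>
          A0 p q r u v w k < \<infinity> \<and> A1 p q r u v w k < \<infinity> \<and> A2 p q r u v w k < \<infinity>) \<and>
       C_T p q r u v w k \<le>
         ennreal c1 * (A0 p q r u v w k + A1 p q r u v w k + A2 p q r u v w k) \<and>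
       A0 p q r u v w k + A1 p q r u v w k + A2 p q r u v w k \<le>
         ennreal c2 * C_T p q r u v w k)"
proof -
  \<comment> \<open>Chosen before the weights and the kernel, so that the final constants do not
    depend on them.\<close>
  obtain Cq where Cq: "0 < Cq" "\<forall>w\<in>Mplus. \<forall>g\<in>Mplus. \<forall>h\<in>Mplus.
    Lnorm q w (\<lambda>x. g x + h x) powe r \<le> ennreal (5 / 4) * Lnorm q w g powe r + ennreal Cq * Lnorm q w h powe r"
    using Lnorm_add_powe_le[OF assms(3,2), of "5 / 4"] by auto
  define c1 where "c1 = upper_const r D Cq powr (1 / r)"
  define \<kappa> where "\<kappa> = (sqrt 2 - 1) / sqrt 2 * (1 / 2 :: real) powr r"
  \<comment> \<open>The entry 1 serves p <= r, the other one r < p.\<close>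
  define d where "d = max 1 ((2 * sqrt 2 / \<kappa>) powr (1 / r))"
  define c2 where "c2 = D + D + d"
  have c1: "0 < c1" using upper_const_pos[OF Cq(1) assms(4), of r] by (simp add: c1_def)
  have d: "1 \<le> d" "(2 * sqrt 2 / \<kappa>) powr (1 / r) \<le> d" by (auto simp: d_def)
  have c2: "0 < c2" using assms d by (simp add: c2_def)
  show ?thesis
  proof (rule exI[of _ c1], rule exI[of _ c2], intro conjI c1 c2 allI impI)
    fix u v w k
    assume "u \<in> Mplus \<and> v \<in> Mplus \<and> w \<in> Mplus \<and>
       (\<forall>t>0. (\<integral>\<^sup>+x\<in>{0..t}. u x \<partial>lebesgue) < \<infinity>) \<and> oinarov_kernel D k"
    then interpret oinarov_quasi_add u p r D q v w k Cq
      using assms Cq by unfold_locales auto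
    let ?A = "A0 p q r u v w k + A1 p q r u v w k + A2 p q r u v w k"
    show up: "CT \<le> ennreal c1 * ?A"
    proof (rule ennreal_le_cmultI[OF c1])
      fix S :: real assume S: "0 < S" "?A \<le> ennreal S"
      have "CT \<le> ennreal (Cup powr (1 / r) * S)"
        by (rule CT_le[OF S(1)]) (use S(2) in \<open>auto intro: order_trans[rotated] simp: add_increasing add_increasing2\<close>)
      then show "CT \<le> ennreal (c1 * S)" by (simp add: c1_def)
    qed
    show lo: "?A \<le> ennreal c2 * CT"
    proof (rule ennreal_le_cmultI[OF c2])
      fix S :: real assume S: "0 < S" "CT \<le> ennreal S"
      have "A2 p q r u v w k \<le> ennreal (d * S)"
      proof (cases "p \<le> r")
        case True
        have "A2 p q r u v w k \<le> ennreal S" by (rule A2_le_p_le_r[OF S(2,1) True])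
        also have "\<dots> \<le> ennreal (d * S)" using d S by (intro ennreal_leI) simp
        finally show ?thesis .
      next
        case False
        have "A2 p q r u v w k \<le> ennreal ((2 * sqrt 2 / \<kappa>) powr (1 / r) * S)"
          unfolding \<kappa>_def using False by (intro A2_le_r_less_p S) simp
        also have "\<dots> \<le> ennreal (d * S)" using d S by (intro ennreal_leI mult_right_mono) auto
        finally show ?thesis .
      qed
      then have "?A \<le> ennreal (D * S) + ennreal (D * S) + ennreal (d * S)"
        by (intro add_mono A0_le A1_le S)
      also have "\<dots> = ennreal (c2 * S)"
        using assms(4) d S by (simp add: c2_def distrib_right flip: ennreal_plus)
      finally show "?A \<le> ennreal (c2 * S)" .
    qed
    show "CT < \<infinity> \<longleftrightarrow> A0 p q r u v w k < \<infinity> \<and> A1 p q r u v w k < \<infinity> \<and> A2 p q r u v w k < \<infinity>"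
    proof
      assume "CT < \<infinity>"
      then have "ennreal c2 * CT < \<infinity>" by (simp add: ennreal_mult_less_top)
      with lo have "?A < \<infinity>" by (rule le_less_trans)
      then show "A0 p q r u v w k < \<infinity> \<and> A1 p q r u v w k < \<infinity> \<and> A2 p q r u v w k < \<infinity>" by simp
    next
      assume "A0 p q r u v w k < \<infinity> \<and> A1 p q r u v w k < \<infinity> \<and> A2 p q r u v w k < \<infinity>"
      then have "ennreal c1 * ?A < \<infinity>" by (simp add: ennreal_mult_less_top)
      with up show "CT < \<infinity>" by (rule le_less_trans)
    qed
  qed
qed

end
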